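(* Let $X$ be a shift space (subshift) over a finite alphabet, with language $\mathcal{L}=\mathcal{L}(X)$ and left shift $\sigma$, and let $\varphi:X\to\mathbb{R}$ be a continuous function. Suppose that $\mathcal{G}\subset\mathcal{L}$ has $(W)$-specification and that $\mathcal{L}$ is edit approachable by $\mathcal{G}$. Then for every non-empty compact connected subset $K\subset M_\sigma(X)$, $$P_{G_K(X,\sigma)}(\varphi)=\inf_{\mu\in K}\Big\{h_\mu(\sigma)+\int\varphi\,d\mu\Big\}.$$
   Context: Shift spaces. Let $p\ge 2$, $\mathcal{A}=\{1,\dots,p\}$, and let $\mathcal{A}^{\mathbb{N}}$ be the space of one-sided sequences $(w_i)_{i\ge1}$ with the product topology, with left shift $\sigma((w_i)_{i\ge1})=(w_{i+1})_{i\ge1}$. A shift space is a non-empty compact $X\subset\mathcal{A}^{\mathbb{N}}$ with $\sigma(X)\subset X$. Let $\mathcal{A}^*=\bigcup_{n\ge0}\mathcal{A}^n$ be the set of finite words, $|w|$ the length of $w$, and $[w]$ the set of sequences beginning with $w$. The language is $\mathcal{L}(X)=\{w\in\mathcal{A}^*:[w]\cap X\ne\emptyset\}$. Juxtaposition of words denotes concatenation. $(W)$-specification. $\mathcal{G}\subset\mathcal{L}$ has $(W)$-specification if there is $\tau\in\mathbb{N}$ such that for all $v,w\in\mathcal{G}$ there is $u\in\mathcal{L}$ with $|u|\le\tau$ and $vuw\in\mathcal{G}$. Edit approachability. An edit of a word is one of: substitution $u^1au^2\mapsto u^1a'u^2$; insertion $u^1u^2\mapsto u^1a'u^2$; deletion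 $u^1au^2\mapsto u^1u^2$, where $u^1,u^2$ are arbitrary (possibly empty) words and $a,a'\in\mathcal{A}$. For words $v,w$, $\hat d(v,w)$ is the minimum number of edits needed to transform $v$ into $w$. A mistake function is a non-decreasing $g:\{0,1,2,\dots\}\to\{0,1,2,\dots\}$ with $g(n)/n\to0$. $\mathcal{L}$ is edit approachable by $\mathcal{G}$ if there is a mistake function $g$ such that for every $w\in\mathcal{L}$ there is $v\in\mathcal{G}$ with $\hat d(v,w)\le g(|w|)$. Measures. $M_\sigma(X)$ is the set of $\sigma$-invariant Borel probability measures on $X$ with the weak$^*$ topology, and $h_\mu(\sigma)$ is the measure-theoretic entropy. Put $\mathcal{E}_n(x)=\frac1n\sum_{i=0}^{n-1}\delta_{\sigma^ix}$, and let $A(\mathcal{E}_n(x))$ be the set of weak$^*$ limit points of the sequence $(\mathcal{E}_n(x))_{n\ge1}$. The saturated set of $K$ is $G_K(X,\sigma)=\{x\in X:A(\mathcal{E}_n(x))=K\}$. Topological pressure. For Borel $Z\subset X$, $t\in\mathbb{R}$, $N\in\mathbb{N}$, let $$M(Z,t,\varphi,N)=\inf_{\mathcal{S}}\sum_{[w_0\cdots w_m]\in\mathcal{S}}\exp\Big(-t(m+1)+\sup_{x\in[w_0\cdots w_m]\cap X}\sum_{k=0}^m\varphi(\sigma^kx)\Big),$$ the infimum over finite or countable collections $\mathcal{S}$ of cylinders $[w_0\cdots w_m]$ (of words in $\mathcal{L}$) with $m\ge N$ that cover $Z$. Let $M(Z,t,\varphi)=\lim_{N\to\infty}M(Z,t,\varphi,N)$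 and $P_Z(\varphi)=\inf\{t:M(Z,t,\varphi)=0\}$. *)

theory Defs
  imports "HOL-Probability.Probability"
begin

section \<open>Shift spaces and languages\<close>

text \<open>
  The alphabet is \<open>{1..p}\<close>. One-sided sequences are functions \<open>nat \<Rightarrow> nat\<close> indexed from \<open>0\<close>
  (the first letter is \<open>x 0\<close>); the product topology is the one that the library puts
  on the type \<open>nat \<Rightarrow> nat\<close>, restricted to \<open>full_shift p\<close>. Finite words are lists.
\<close>

definition full_shift :: "nat \<Rightarrow> (nat \<Rightarrow> nat) set" where
  "full_shift p = {x. \<forall>i. x i \<in> {1..p}}"

definition words :: "nat \<Rightarrow> nat list set" where
  "words p = lists {1..p}"

definition shift_map :: "(nat \<Rightarrow> nat) \<Rightarrow> (nat \<Rightarrow> nat)" where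
  "shift_map x = (\<lambda>i. x (Suc i))"

definition shift_space :: "nat \<Rightarrow> (nat \<Rightarrow> nat) set \<Rightarrow> bool" where
  "shift_space p X \<longleftrightarrow> X \<noteq> {} \<and> compact X \<and> X \<subseteq> full_shift p \<and> shift_map ` X \<subseteq> X"

definition cylinder :: "nat \<Rightarrow> nat list \<Rightarrow> (nat \<Rightarrow> nat) set" where
  "cylinder p w = {x \<in> full_shift p. \<forall>i<length w. x i = w ! i}"

definition language :: "nat \<Rightarrow> (nat \<Rightarrow> nat) set \<Rightarrow> nat list set" where
  "language p X = {w \<in> words p. cylinder p w \<inter> X \<noteq> {}}"

definition W_specification :: "nat list set \<Rightarrow> nat list set \<Rightarrow> bool" where
  "W_specification L G \<longleftrightarrow>
     (\<exists>\<tau>::nat. \<forall>v\<in>G. \<forall>w\<in>G. \<exists>u\<in>L. length u \<le> \<tau> \<and> v @ u @ w \<in> G)"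

section \<open>Edit approachability\<close>

inductive edit :: "nat \<Rightarrow> nat list \<Rightarrow> nat list \<Rightarrow> bool" for p :: nat where
  substitution: "\<lbrakk>u1 \<in> words p; u2 \<in> words p; a \<in> {1..p}; a' \<in> {1..p}\<rbrakk>
    \<Longrightarrow> edit p (u1 @ [a] @ u2) (u1 @ [a'] @ u2)"
| insertion: "\<lbrakk>u1 \<in> words p; u2 \<in> words p; a' \<in> {1..p}\<rbrakk>
    \<Longrightarrow> edit p (u1 @ u2) (u1 @ [a'] @ u2)"
| deletion: "\<lbrakk>u1 \<in> words p; u2 \<in> words p; a \<in> {1..p}\<rbrakk>
    \<Longrightarrow> edit p (u1 @ [a] @ u2) (u1 @ u2)"

definition edit_dist :: "nat \<Rightarrow> nat list \<Rightarrow> nat list \<Rightarrow> nat" where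
  "edit_dist p v w = (LEAST n. (edit p ^^ n) v w)"

definition mistake_function :: "(nat \<Rightarrow> nat) \<Rightarrow> bool" where
  "mistake_function g \<longleftrightarrow> mono g \<and> (\<lambda>n. real (g n) / real n) \<longlonglongrightarrow> 0"

definition edit_approachable :: "nat \<Rightarrow> nat list set \<Rightarrow> nat list set \<Rightarrow> bool" where
  "edit_approachable p L G \<longleftrightarrow>
     (\<exists>g. mistake_function g \<and> (\<forall>w\<in>L. \<exists>v\<in>G. edit_dist p v w \<le> g (length w)))"

section \<open>Measures and the weak* topology\<close>

definition borel_probs :: "'a::topological_space set \<Rightarrow> 'a measure set" where
  "borel_probs X = {\<mu>. sets \<mu> = sets (restrict_space borel X) \<and> prob_space \<mu>}"

text \<open>The coarsest topology making all \<open>\<mu> \<mapsto> \<integral>f d\<mu>\<close> with \<open>f\<close> continuous on \<open>X\<close> continuous. It is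
  meant for compact \<open>X\<close>, where every such \<open>f\<close> is bounded.\<close>

definition weak_star :: "'a::topological_space set \<Rightarrow> 'a measure topology" where
  "weak_star X = topology_generated_by
     {{\<mu> \<in> borel_probs X. (\<integral>x. f x \<partial>\<mu>) \<in> U} | f U. continuous_on X f \<and> open (U :: real set)}"

definition invariant_measures :: "(nat \<Rightarrow> nat) set \<Rightarrow> (nat \<Rightarrow> nat) measure set" where
  "invariant_measures X = {\<mu> \<in> borel_probs X. distr \<mu> \<mu> shift_map = \<mu>}"

text \<open>The value at \<open>n = 0\<close> is junk, and irrelevant for the limit points below.\<close>

definition empirical_measure ::
  "(nat \<Rightarrow> nat) set \<Rightarrow> nat \<Rightarrow> (nat \<Rightarrow> nat) \<Rightarrow> (nat \<Rightarrow> nat) measure" where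
  "empirical_measure X n x =
     measure_of X (sets (restrict_space borel X))
       (\<lambda>A. ennreal (1 / real n) *
             (\<Sum>i<n. emeasure (return (restrict_space borel X) ((shift_map ^^ i) x)) A))"

definition seq_limit_points :: "'a topology \<Rightarrow> (nat \<Rightarrow> 'a) \<Rightarrow> 'a set" where
  "seq_limit_points T s =
     {l \<in> topspace T. \<forall>U. openin T U \<and> l \<in> U \<longrightarrow> (\<exists>\<^sub>F n in sequentially. s n \<in> U)}"

definition saturated_set ::
  "(nat \<Rightarrow> nat) set \<Rightarrow> (nat \<Rightarrow> nat) measure set \<Rightarrow> (nat \<Rightarrow> nat) set" where
  "saturated_set X K =
     {x \<in> X. seq_limit_points (weak_star X) (\<lambda>n. empirical_measure X n x) = K}"

section \<open>Measure-theoretic entropy\<close>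

text \<open>Natural logarithms throughout; \<open>ln 0 = 0\<close> yields the convention \<open>0 log 0 = 0\<close>.\<close>

definition partition_entropy :: "'a measure \<Rightarrow> 'a set set \<Rightarrow> real" where
  "partition_entropy \<mu> P = - (\<Sum>A\<in>P. measure \<mu> A * ln (measure \<mu> A))"

text \<open>The join of \<open>P, T\<^sup>-\<^sup>1 P, \<dots>, T\<^sup>-\<^sup>(\<^sup>n\<^sup>-\<^sup>1\<^sup>) P\<close>.\<close>

definition iterated_join ::
  "'a measure \<Rightarrow> ('a \<Rightarrow> 'a) \<Rightarrow> 'a set set \<Rightarrow> nat \<Rightarrow> 'a set set" where
  "iterated_join \<mu> T P n =
     common_refinement ((\<lambda>i. (\<lambda>A. (T ^^ i) -` A \<inter> space \<mu>) ` P) ` {..<n})"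

definition entropy_wrt_partition :: "'a measure \<Rightarrow> ('a \<Rightarrow> 'a) \<Rightarrow> 'a set set \<Rightarrow> real" where
  "entropy_wrt_partition \<mu> T P = lim (\<lambda>n. partition_entropy \<mu> (iterated_join \<mu> T P n) / real n)"

definition ks_entropy :: "'a measure \<Rightarrow> ('a \<Rightarrow> 'a) \<Rightarrow> ereal" where
  "ks_entropy \<mu> T =
     (SUP P\<in>{P. finite P \<and> P \<subseteq> sets \<mu> \<and> partition_on (space \<mu>) P}.
        ereal (entropy_wrt_partition \<mu> T P))"

section \<open>Topological pressure\<close>

text \<open>
  A collection of cylinders is given by its set \<open>S\<close> of words \<open>w\<^sub>0 \<dots> w\<^sub>m\<close>, which is no loss since
  for \<open>p \<ge> 2\<close> distinct words have distinct cylinders. With \<open>length w = m + 1\<close>, the condition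
  \<open>m \<ge> N\<close> reads \<open>length w > N\<close>.
\<close>

definition pressure_sum ::
  "nat \<Rightarrow> (nat \<Rightarrow> nat) set \<Rightarrow> (nat \<Rightarrow> nat) set \<Rightarrow> real \<Rightarrow> ((nat \<Rightarrow> nat) \<Rightarrow> real) \<Rightarrow> nat \<Rightarrow> ennreal" where
  "pressure_sum p X Z t \<phi> N =
     (INF S\<in>{S. countable S \<and> S \<subseteq> language p X \<and> (\<forall>w\<in>S. length w > N) \<and>
               Z \<subseteq> (\<Union>w\<in>S. cylinder p w)}.
        \<Sum>\<^sub>\<infinity>w\<in>S. ennreal (exp (- t * real (length w) +
                  (SUP x\<in>cylinder p w \<inter> X. \<Sum>k<length w. \<phi> ((shift_map ^^ k) x)))))"

definition pressure_limit ::
  "nat \<Rightarrow> (nat \<Rightarrow> nat) set \<Rightarrow> (nat \<Rightarrow> nat) set \<Rightarrow> real \<Rightarrow> ((nat \<Rightarrow> nat) \<Rightarrow> real) \<Rightarrow> ennreal" where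
  "pressure_limit p X Z t \<phi> = lim (\<lambda>N. pressure_sum p X Z t \<phi> N)"

definition pressure ::
  "nat \<Rightarrow> (nat \<Rightarrow> nat) set \<Rightarrow> (nat \<Rightarrow> nat) set \<Rightarrow> ((nat \<Rightarrow> nat) \<Rightarrow> real) \<Rightarrow> ereal" where
  "pressure p X Z \<phi> = (INF t\<in>{t. pressure_limit p X Z t \<phi> = 0}. ereal t)"

end

theory Submission
  imports Defs "HOL-Real_Asymp.Real_Asymp"
begin

text \<open>
  Both inequalities are proved by counting words. For \<open>\<mu> \<in> K\<close>, every point of the saturated set has
  infinitely many prefixes with block frequencies close to \<open>\<mu>\<close>. There are at most
  \<open>exp (n (h + \<epsilon>))\<close> such words of length \<open>n\<close>, \<open>h\<close> being the entropy of \<open>\<mu>\<close>, since a product measure on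
  blocks gives each of them mass at least \<open>exp (- n (h + \<epsilon>))\<close>; and on each of their cylinders the Birkhoff
  sums of \<open>\<phi>\<close> are at most \<open>n (\<integral>\<phi> d\<mu> + \<epsilon>)\<close>. Hence these cylinders form cheap covers.

  For the lower bound, fix \<open>m\<close> large and concatenate \<open>N\<close> words of length \<open>m\<close>, each word \<open>w\<close> occurring about
  \<open>N \<mu>[w]\<close> times. The law of large numbers yields about \<open>exp (N m h)\<close> such concatenations. This needs neither
  ergodicity of \<open>\<mu>\<close> nor the Shannon--McMillan theorem, but the Kolmogorov--Sinai theorem, to replace
  arbitrary partitions by the one into 1-cylinders. Edit approachability and the \<open>(W)\<close>-specification turn every concatenation
  into a word of \<open>G\<close> by few edits. Because \<open>K\<close> is compact and connected, there is a sequence of measures in \<open>K\<close>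
  with vanishing steps whose set of limit points is \<open>K\<close>; running through it slowly, and gluing such
  words, gives points of the saturated set.
  The gluing and editing need not be injective, but a word of length \<open>n\<close> has only \<open>exp (o(n))\<close> words within
  \<open>o(n)\<close> edits, so each cylinder receives little mass when the words are chosen independently and uniformly, and
  the mass distribution principle applies.
\<close>

section \<open>Words and edits\<close>

text \<open>An edit may shift all later letters, so letters cannot be compared position by position.
  Two quantities survive: the number of occurrences of a fixed short word changes by a bounded
  amount per edit, and the length by at most one. Measures therefore enter only through frequencies
  of words, as points of the metric space \<open>nat list \<Rightarrow> real\<close>, and a time
  \<open>n\<close> of a constructed point is located by the lengths of the unedited source blocks.
  The block length that achieves a given accuracy is not under control and may grow arbitrarily from
  one target measure to the next. Each stage is therefore repeated until the past and the first
  block of the next stage are negligible; weighted averages of any bounded, slowly varying quantity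
  then follow its current value. Entropy may jump along the sequence of measures. The lower bound
  keeps entropy and integral together: their sum is at least \<open>J\<close> for every measure of
  \<open>K\<close>, and this inequality survives averaging over the stages.\<close>

definition block :: "nat \<Rightarrow> nat \<Rightarrow> nat list set" where
  "block p n = {w \<in> words p. length w = n}"

lemma block_lists: "block p n = {w. set w \<subseteq> {1..p} \<and> length w = n}"
  by (auto simp: block_def words_def)

lemma finite_block [simp]: "finite (block p n)"
  unfolding block_lists by (rule finite_lists_length_eq) simp

lemma card_block: "card (block p n) = p ^ n"
  unfolding block_lists by (subst card_lists_length_eq) simp_all

lemma words_append [simp]: "u @ v \<in> words p \<longleftrightarrow> u \<in> words p \<and> v \<in> words p"
  by (auto simp: words_def)

lemma words_Cons [simp]: "a # v \<in> words p \<longleftrightarrow> a \<in> {1..p} \<and> v \<in> words p"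
  by (auto simp: words_def)

lemma words_Nil [simp]: "[] \<in> words p"
  by (auto simp: words_def)

lemma words_takeI: "w \<in> words p \<Longrightarrow> take n w \<in> words p"
  by (auto simp: words_def dest: in_set_takeD)

lemma words_dropI: "w \<in> words p \<Longrightarrow> drop n w \<in> words p"
  by (auto simp: words_def dest: in_set_dropD)

lemma words_concat: "concat ws \<in> words p \<longleftrightarrow> set ws \<subseteq> words p"
  by (induction ws) auto

lemma edit_context:
  assumes "edit p v w" "a \<in> words p" "b \<in> words p"
  shows "edit p (a @ v @ b) (a @ w @ b)"
  using assms(1)
proof cases
  case (substitution u1 u2 c c')
  then show ?thesis using edit.substitution[of "a @ u1" p "u2 @ b" c c'] assms by simp
next
  case (insertion u1 u2 c)
  then show ?thesis using edit.insertion[of "a @ u1" p "u2 @ b" c] assms by simp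
next
  case (deletion u1 u2 c)
  then show ?thesis using edit.deletion[of "a @ u1" p "u2 @ b" c] assms by simp
qed

lemma edit_sym: "edit p v w \<Longrightarrow> edit p w v"
  by (induction rule: edit.induct) (blast intro: edit.intros)+

lemma edits_sym: "(edit p ^^ m) v w \<Longrightarrow> (edit p ^^ m) w v"
proof (induction m arbitrary: w)
  case (Suc m)
  then obtain y where "(edit p ^^ m) v y" "edit p y w" by auto
  then show ?case using Suc.IH edit_sym relpowp_Suc_I2 by metis
qed auto

lemma edits_context:
  assumes "(edit p ^^ m) v w" "a \<in> words p" "b \<in> words p"
  shows "(edit p ^^ m) (a @ v @ b) (a @ w @ b)"
  using assms(1)
  by (induction m arbitrary: w) (auto intro: edit_context[OF _ assms(2,3)])

lemma edits_trans: "(edit p ^^ m) u v \<Longrightarrow> (edit p ^^ n) v w \<Longrightarrow> (edit p ^^ (m + n)) u w"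
  by (auto simp: relpowp_add)

lemma edits_append:
  assumes "(edit p ^^ m) v v'" "(edit p ^^ n) w w'"
    and "v' \<in> words p" "w \<in> words p"
  shows "(edit p ^^ (m + n)) (v @ w) (v' @ w')"
  using edits_trans[of m p "v @ w" "v' @ w" n "v' @ w'"]
    edits_context[OF assms(1), of "[]" w] edits_context[OF assms(2), of v' "[]"] assms by simp

lemma edits_delete:
  assumes "a \<in> words p" "b \<in> words p"
  shows "(edit p ^^ (length b)) (a @ b) a"
  using assms(2)
proof (induction b)
  case (Cons c b)
  have "edit p (a @ [c] @ b) (a @ b)" using Cons assms by (intro edit.deletion) auto
  moreover have "(edit p ^^ length b) (a @ b) a" using Cons by simp
  ultimately show ?case using relpowp_Suc_I2[of "edit p" "a @ c # b" "a @ b" "length b" a] by simp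
qed auto

lemma edits_insert:
  assumes "a \<in> words p" "b \<in> words p"
  shows "(edit p ^^ (length b)) a (a @ b)"
  using edits_sym[OF edits_delete[OF assms]] .

text \<open>\<open>LEAST\<close> is meaningful only if some number of edits works; deleting all of
  \<open>v\<close> and then inserting all of \<open>w\<close> provides one.\<close>

lemma edit_dist_edits:
  assumes "v \<in> words p" "w \<in> words p"
  shows "(edit p ^^ edit_dist p v w) v w"
  unfolding edit_dist_def
proof (rule LeastI)
  show "(edit p ^^ (length v + length w)) v w"
    using edits_trans[OF edits_delete[of "[]" p v] edits_insert[of "[]" p w]] assms by simp
qed

lemma edit_length: "edit p v w \<Longrightarrow> length w \<le> length v + 1 \<and> length v \<le> length w + 1"
  by (induction rule: edit.induct) auto

lemma edits_length: "(edit p ^^ m) v w \<Longrightarrow> length w \<le> length v + m \<and> length v \<le> length w + m"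
  by (induction m arbitrary: w) (force dest: edit_length)+


section \<open>The size of edit balls\<close>

text \<open>An alignment of cost \<open>r\<close> reads the source \<open>w\<close> and the target
  \<open>v\<close> once from left to right, whereas a sequence of edits may jump about. This order
  allows the recursion on \<open>w\<close> that counts the targets.\<close>

inductive align :: "nat \<Rightarrow> nat list \<Rightarrow> nat list \<Rightarrow> nat \<Rightarrow> bool" for p where
  align_Nil: "align p [] [] 0"
| align_keep: "align p w v r \<Longrightarrow> align p (a # w) (a # v) r"
| align_subst: "align p w v r \<Longrightarrow> b \<in> {1..p} \<Longrightarrow> align p (a # w) (b # v) (Suc r)"
| align_ins: "align p w v r \<Longrightarrow> b \<in> {1..p} \<Longrightarrow> align p w (b # v) (Suc r)"
| align_del: "align p w v r \<Longrightarrow> align p (a # w) v (Suc r)"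

lemma align_refl: "align p w w 0"
  by (induction w) (auto intro: align.intros)

lemma align_prepend: "align p v w r \<Longrightarrow> align p (u @ v) (u @ w) r"
  by (induction u) (auto intro: align.intros)

lemma edit_align: "edit p v w \<Longrightarrow> align p v w 1"
proof (induction rule: edit.induct)
  case (substitution u1 u2 a a')
  then show ?case using align_prepend[OF align_subst[OF align_refl]] by simp
next
  case (insertion u1 u2 a')
  then show ?case using align_prepend[OF align_ins[OF align_refl]] by simp
next
  case (deletion u1 u2 a)
  then show ?case using align_prepend[OF align_del[OF align_refl]] by simp
qed

text \<open>The first letter of the middle word links the two alignments: the second one keeps,
  replaces or deletes it, and the first one must have kept, replaced or inserted it, unless it
  deletes a letter of \<open>u\<close> before. An insertion of the second alignment or a deletion of
  the first one is peeled off alone, hence the induction on the total length.\<close>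

lemma align_trans:
  "align p u v r \<Longrightarrow> align p v w s \<Longrightarrow> \<exists>t\<le>r + s. align p u w t"
proof (induction "length u + length v + length w" arbitrary: u v w r s rule: less_induct)
  case less
  note IH = less.hyps
  show ?case
    using less.prems(2)
  proof cases
    case (align_ins v' s' b)
    then show ?thesis using IH[OF _ less.prems(1) align_ins(3)]
      by (force intro: align.align_ins)
  next
    case align_Nil
    then show ?thesis using less.prems(1) by auto
  next
    case 2: (align_keep v1 w1 a)
    show ?thesis using less.prems(1)
    proof cases
      case (align_del u' r' b)
      then show ?thesis using IH[OF _ align_del(3) less.prems(2)]
        by (force intro: align.align_del)
    next
      case (align_keep u1)
      then show ?thesis using 2 IH[of u1 v1 w1] by (force intro: align.intros)
    next
      case (align_subst u1 v1' r')
      then show ?thesis using 2 IH[of u1 v1 w1 r' s] by (force intro: align.align_subst)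
    next
      case (align_ins v1' r')
      then show ?thesis using 2 IH[of u v1 w1 r' s] by (force intro: align.align_ins)
    qed (use 2 in auto)
  next
    case 2: (align_subst v1 w1 s1 b)
    show ?thesis using less.prems(1)
    proof cases
      case (align_del u' r' b)
      then show ?thesis using IH[OF _ align_del(3) less.prems(2)]
        by (force intro: align.align_del)
    next
      case (align_keep u1)
      then show ?thesis using 2 IH[of u1 v1 w1 r s1] by (force intro: align.intros)
    next
      case (align_subst u1 v1' r')
      then have "\<exists>t\<le>r' + s1. align p u1 w1 t" using 2 IH[of u1 v1 w1 r' s1] by force
      then obtain t where "t \<le> r' + s1" "align p u1 w1 t" by auto
      then show ?thesis using 2 align_subst
        by (intro exI[of _ "Suc t"]) (auto intro: align.align_subst)
    next
      case (align_ins v1' r')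
      then have "\<exists>t\<le>r' + s1. align p u w1 t" using 2 IH[of u v1 w1 r' s1] by force
      then obtain t where "t \<le> r' + s1" "align p u w1 t" by auto
      then show ?thesis using 2 align_ins
        by (intro exI[of _ "Suc t"]) (auto intro: align.align_ins)
    qed (use 2 in auto)
  next
    case 2: (align_del v1 s1)
    show ?thesis using less.prems(1)
    proof cases
      case (align_del u' r' b)
      then show ?thesis using IH[OF _ align_del(3) less.prems(2)]
        by (force intro: align.align_del)
    next
      case (align_keep u1)
      then show ?thesis using 2 IH[of u1 v1 w r s1] by (force intro: align.intros)
    next
      case (align_subst u1 v1' r')
      then have "\<exists>t\<le>r' + s1. align p u1 w t" using 2 IH[of u1 v1 w r' s1] by force
      then obtain t where "t \<le> r' + s1" "align p u1 w t" by auto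
      then show ?thesis using 2 align_subst
        by (intro exI[of _ "Suc t"]) (auto intro: align.align_del)
    next
      \<comment> \<open>The letter inserted is the one deleted, so the composition saves both
        costs.\<close>
      case (align_ins v1' r')
      then have "\<exists>t\<le>r' + s1. align p u w t" using 2 IH[of u v1 w r' s1] by force
      then show ?thesis using 2 align_ins by (auto intro: le_SucI)
    qed (use 2 in auto)
  qed
qed

lemma edits_align: "(edit p ^^ m) v w \<Longrightarrow> \<exists>t\<le>m. align p v w t"
proof (induction m arbitrary: w)
  case 0
  then show ?case using align_refl by auto
next
  case (Suc m)
  then obtain y t where "edit p y w" "t \<le> m" "align p v y t" by (metis relpowp_Suc_E)
  then have "\<exists>s\<le>t + 1. align p v w s" by (intro align_trans[OF _ edit_align])
  then show ?case using \<open>t \<le> m\<close> by (metis Suc_eq_plus1 Suc_le_mono le_trans)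
qed

lemma align_Nil_iff: "align p [] v r \<longleftrightarrow> length v = r \<and> v \<in> words p"
proof
  assume "align p [] v r" then show "length v = r \<and> v \<in> words p"
    by (induction "[]::nat list" v r rule: align.induct) auto
next
  assume "length v = r \<and> v \<in> words p" then show "align p [] v r"
    by (induction v arbitrary: r) (auto intro: align.intros)
qed


text \<open>\<open>\<theta> ^ r\<close> is a weight in the generating function of the alignment cost: every letter
  of \<open>w\<close> contributes at most the factor \<open>C\<close>. Counting sequences of \<open>r\<close> single edits instead would
  cost a factor polynomial in \<open>length w\<close> per edit, too much for \<open>r = o(length w)\<close>.\<close>

lemma align_card:
  fixes \<theta> C :: real
  assumes "0 < \<theta>" "1 \<le> C" "1 + (real p + 1) * \<theta> + real p * \<theta> * C \<le> C"
  shows "finite {v. align p w v r} \<and> real (card {v. align p w v r}) * \<theta> ^ r \<le> C ^ Suc (length w)"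
proof (induction "length w + r" arbitrary: w r rule: less_induct)
  case less
  show ?case
  proof (cases w)
    case Nil
    \<comment> \<open>There are \<open>p ^ r\<close> words that grow out of the empty one; the
      condition on \<theta> and \<open>C\<close> forces \<open>p * \<theta> \<le> 1\<close>, so
      their weighted number stays below 1.\<close>
    have "real p * \<theta> * C \<le> 1 * C"
      using assms mult_nonneg_nonneg[of "real p + 1" \<theta>] by linarith
    then have "real p * \<theta> \<le> 1"
      by (rule mult_right_le_imp_le) (use assms(2) in linarith)
    then have "(real p * \<theta>) ^ r \<le> 1" using assms by (intro power_le_one) auto
    moreover have "{v. align p w v r} = block p r"
      using Nil by (auto simp: align_Nil_iff block_def)
    ultimately show ?thesis using assms Nil by (simp add: card_block power_mult_distrib)
  next
    case (Cons a w')
    define n where "n = Suc (length w')"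
    let ?A = "\<lambda>w r. {v. align p w v r}"
    have keep: "finite (?A w' r)" "real (card (?A w' r)) * \<theta> ^ r \<le> C ^ n"
      using less[of w' r] Cons by (auto simp: n_def)
    have sub1: "{v. align p w v 0} \<subseteq> (#) a ` ?A w' 0"
      using Cons by (auto elim: align.cases)
    show ?thesis
    proof (cases r)
      case 0
      have "card (?A w 0) \<le> card (?A w' 0)"
        using keep sub1 0 card_image_le[of "?A w' 0" "(#) a"] card_mono[OF _ sub1] by auto
      moreover have "C ^ n \<le> C ^ Suc n" using assms by (intro power_increasing) auto
      ultimately show ?thesis using keep 0 finite_subset[OF sub1] Cons by (auto simp: n_def)
    next
      case (Suc s)
      let ?cons = "\<lambda>(b, v). b # v"
      have 1: "finite (?A w' s)" "real (card (?A w' s)) * \<theta> ^ s \<le> C ^ n"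
        using less[of w' s] Cons Suc by (auto simp: n_def)
      have 2: "finite (?A w s)" "real (card (?A w s)) * \<theta> ^ s \<le> C ^ Suc n"
        using less[of w s] Cons Suc by (auto simp: n_def)
      \<comment> \<open>One set for each rule: keep, substitute, insert, delete. An insertion leaves
        \<open>w\<close> as it is and lowers only the cost, whence the induction on
        \<open>length w + r\<close>.\<close>
      have sub: "?A w r \<subseteq> (((#) a ` ?A w' r \<union> ?cons ` ({1..p} \<times> ?A w' s)) \<union>
          ?cons ` ({1..p} \<times> ?A w s)) \<union> ?A w' s" (is "_ \<subseteq> ((?B1 \<union> ?B2) \<union> ?B3) \<union> _")
      proof
        fix v assume "v \<in> ?A w r"
        then have "align p (a # w') v (Suc s)" using Cons Suc by simp
        then show "v \<in> ((?B1 \<union> ?B2) \<union> ?B3) \<union> ?A w' s"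
          by cases (use Cons Suc in \<open>auto simp: image_iff\<close>)
      qed
      have fin: "finite (((?B1 \<union> ?B2) \<union> ?B3) \<union> ?A w' s)" using keep 1 2 by auto
      have "card (?A w r) \<le> card (((?B1 \<union> ?B2) \<union> ?B3) \<union> ?A w' s)"
        by (rule card_mono[OF fin sub])
      also have "\<dots> \<le> card ?B1 + card ?B2 + card ?B3 + card (?A w' s)"
        by (meson add_le_mono card_Un_le le_trans order_refl)
      also have "\<dots> \<le> card (?A w' r) + p * card (?A w' s) + p * card (?A w s) + card (?A w' s)"
        using card_image_le[of "?A w' r" "(#) a"] card_image_le[of "{1..p} \<times> ?A w' s" ?cons]
          card_image_le[of "{1..p} \<times> ?A w s" ?cons] keep 1 2
        by (simp add: card_cartesian_product)
      finally have "real (card (?A w r)) \<le> real (card (?A w' r) + p * card (?A w' s) + p * card (?A w s) + card (?A w' s))"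
        by (simp only: of_nat_le_iff)
      then have "real (card (?A w r)) * \<theta> ^ r \<le>
          real (card (?A w' r) + p * card (?A w' s) + p * card (?A w s) + card (?A w' s)) * \<theta> ^ r"
        using assms by (intro mult_right_mono) auto
      also have "\<dots> = real (card (?A w' r)) * \<theta> ^ r + (real p + 1) * \<theta> * (real (card (?A w' s)) * \<theta> ^ s)
          + real p * \<theta> * (real (card (?A w s)) * \<theta> ^ s)"
        using Suc by (simp add: algebra_simps)
      also have "\<dots> \<le> C ^ n + (real p + 1) * \<theta> * C ^ n + real p * \<theta> * C ^ Suc n"
        using keep 1 2 assms by (intro add_mono mult_left_mono) auto
      \<comment> \<open>Origin of the condition on \<theta> and \<open>C\<close>: keeping
        contributes 1, the \<open>p\<close> substitutions and the deletion
        \<open>(p + 1) * \<theta>\<close>, and the \<open>p\<close> insertions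
        \<open>p * \<theta> * C\<close>, since they do not shorten \<open>w\<close>.\<close>
      also have "\<dots> = C ^ n * (1 + (real p + 1) * \<theta> + real p * \<theta> * C)" by (simp add: algebra_simps)
      also have "\<dots> \<le> C ^ n * C" using assms by (intro mult_left_mono) auto
      finally show ?thesis using finite_subset[OF sub fin] Cons by (simp add: n_def mult.commute)
    qed
  qed
qed

section \<open>Edit balls; the radii are real because they occur as small multiples of
  lengths\<close>

definition edit_ball :: "nat \<Rightarrow> real \<Rightarrow> nat list \<Rightarrow> nat list set" where
  "edit_ball p r w = {v. \<exists>t. real t \<le> r \<and> (edit p ^^ t) w v}"

lemma edit_ball_sym: "v \<in> edit_ball p r w \<longleftrightarrow> w \<in> edit_ball p r v"
  by (auto simp: edit_ball_def dest: edits_sym)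

lemma edit_ball_mono: "v \<in> edit_ball p r w \<Longrightarrow> r \<le> s \<Longrightarrow> v \<in> edit_ball p s w"
  by (force simp: edit_ball_def)

lemma edit_ball_trans: "v \<in> edit_ball p r w \<Longrightarrow> u \<in> edit_ball p s v \<Longrightarrow> u \<in> edit_ball p (r + s) w"
  unfolding edit_ball_def using edits_trans by force

lemma edit_ball_length: "v \<in> edit_ball p r w \<Longrightarrow> \<bar>real (length v) - real (length w)\<bar> \<le> r"
  unfolding edit_ball_def by (force dest: edits_length)

lemma edit_ball_append:
  assumes "v' \<in> edit_ball p r v" "w' \<in> edit_ball p s w" "v' \<in> words p" "w \<in> words p"
  shows "v' @ w' \<in> edit_ball p (r + s) (v @ w)"
  using assms edits_append unfolding edit_ball_def by force

lemma edit_ball_prefix: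
  assumes "v \<in> words p" "\<bar>real m - real n\<bar> \<le> r" "m \<le> length v" "n \<le> length v" 
  shows "take m v \<in> edit_ball p r (take n v)"
proof -
  have "take m v \<in> edit_ball p r (take n v)" if "m \<le> n" "\<bar>real m - real n\<bar> \<le> r" "n \<le> length v" for m n
  proof -
    have "take n v = take m v @ take (n - m) (drop m v)"
      using that by (metis le_add_diff_inverse take_add)
    moreover have "(edit p ^^ (n - m)) (take m v @ take (n - m) (drop m v)) (take m v)"
      using edits_delete[of "take m v" p "take (n - m) (drop m v)"] assms(1) that
      by (simp add: words_takeI words_dropI)
    ultimately show ?thesis using that by (auto simp: edit_ball_def intro!: exI[of _ "n - m"])
  qed
  from this[of m n] this[of n m] show ?thesis
    using assms edit_ball_sym by (cases "m \<le> n") (auto simp: abs_minus_commute)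
qed

lemma finite_edit_ball:
  shows "finite (edit_ball p r w)"
proof -
  \<comment> \<open>For \<open>C = 2\<close> the condition of \<open>align_card\<close> reads
    \<open>(3 * p + 1) * \<theta> \<le> 1\<close>; here the product is 1/2.\<close>
  let ?C = "2::real" and ?\<theta> = "1 / (2 * (3 * real p + 1))"
  have "edit_ball p r w \<subseteq> (\<Union>t\<in>{..nat \<lfloor>r\<rfloor>}. {v. align p w v t})"
  proof
    fix v assume "v \<in> edit_ball p r w"
    then obtain t where t: "real t \<le> r" "(edit p ^^ t) w v" by (auto simp: edit_ball_def)
    then obtain s where "s \<le> t" "align p w v s" using edits_align by blast
    moreover have "t \<le> nat \<lfloor>r\<rfloor>" using t by (simp add: le_nat_floor)
    ultimately show "v \<in> (\<Union>t\<in>{..nat \<lfloor>r\<rfloor>}. {v. align p w v t})" by auto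
  qed
  moreover have "finite {v. align p w v t}" for t
    using align_card[of ?\<theta> ?C p w t] by (simp add: divide_simps)
  ultimately show ?thesis by (meson finite_UN_I finite_atMost finite_subset)
qed

text \<open>Sum of the bounds of \<open>align_card\<close> over the integer costs up to
  \<open>r\<close>, each estimated by the largest power of \<open>1 / \<theta>\<close>.\<close>

lemma card_edit_ball:
  assumes "0 < \<theta>" "\<theta> \<le> 1" "1 \<le> C" "1 + (real p + 1) * \<theta> + real p * \<theta> * C \<le> C" "0 \<le> r"
  shows "real (card (edit_ball p r w)) \<le> (r + 1) * exp (r * ln (1 / \<theta>)) * C ^ Suc (length w)"
proof -
  define m where "m = nat \<lfloor>r\<rfloor>"
  have m: "real m \<le> r" using assms by (simp add: m_def)
  let ?A = "\<lambda>t. {v. align p w v t}"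
  have "edit_ball p r w \<subseteq> (\<Union>t\<in>{..m}. ?A t)"
  proof
    fix v assume "v \<in> edit_ball p r w"
    then obtain t where t: "real t \<le> r" "(edit p ^^ t) w v" by (auto simp: edit_ball_def)
    then obtain s where "s \<le> t" "align p w v s" using edits_align by blast
    moreover have "t \<le> m" using t by (simp add: le_nat_floor m_def)
    ultimately show "v \<in> (\<Union>t\<in>{..m}. ?A t)" by auto
  qed
  moreover have fin: "finite (?A t)" for t
    using align_card[OF assms(1,3,4)] by blast
  ultimately have "card (edit_ball p r w) \<le> card (\<Union>t\<in>{..m}. ?A t)"
    by (intro card_mono) auto
  also have "\<dots> \<le> (\<Sum>t\<in>{..m}. card (?A t))" by (rule card_UN_le) auto
  finally have "real (card (edit_ball p r w)) \<le> (\<Sum>t\<in>{..m}. real (card (?A t)))"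
    by (metis of_nat_le_iff of_nat_sum)
  also have "\<dots> \<le> (\<Sum>t\<in>{..m}. exp (r * ln (1 / \<theta>)) * C ^ Suc (length w))"
  proof (intro sum_mono)
    fix t assume "t \<in> {..m}"
    have "real (card (?A t)) * \<theta> ^ t \<le> C ^ Suc (length w)"
      using align_card[OF assms(1,3,4)] by blast
    then have "real (card (?A t)) \<le> (1 / \<theta>) ^ t * C ^ Suc (length w)"
      using assms(1) by (simp add: field_simps power_divide)
    also have "(1 / \<theta>) ^ t = exp (real t * ln (1 / \<theta>))"
      using assms(1) by (simp add: exp_of_nat_mult)
    also have "exp (real t * ln (1 / \<theta>)) \<le> exp (r * ln (1 / \<theta>))"
      using \<open>t \<in> {..m}\<close> m assms(1,2) by (intro exp_mono mult_right_mono) auto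
    finally show "real (card (?A t)) \<le> exp (r * ln (1 / \<theta>)) * C ^ Suc (length w)"
      using assms by (smt (verit) mult_right_mono zero_le_power)
  qed
  also have "\<dots> = (real m + 1) * exp (r * ln (1 / \<theta>)) * C ^ Suc (length w)" by simp
  also have "\<dots> \<le> (r + 1) * exp (r * ln (1 / \<theta>)) * C ^ Suc (length w)"
    using m assms by (intro mult_right_mono) auto
  finally show ?thesis .
qed

text \<open>The choices are made in the order \<open>C\<close>, \<theta>, \<eta>: \<open>C\<close>
  so close to 1 that \<open>C ^ n\<close> costs a quarter of \<delta>, then \<theta> admissible for
  this \<open>C\<close>, then \<eta> so small that \<open>(1 / \<theta>) ^ (\<eta> * n)\<close>
  costs another quarter. The remaining half absorbs the polynomial factor.\<close>

lemma edit_ball_subexponential: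
  assumes "\<delta> > (0::real)"
  obtains \<eta> where "0 < \<eta>" "\<eta> \<le> 1"
    "\<forall>\<^sub>F n in sequentially. \<forall>w. length w \<le> n \<longrightarrow> real (card (edit_ball p (\<eta> * real n) w)) \<le> exp (\<delta> * real n)"
proof -
  define C where "C = exp (\<delta> / 4)"
  \<comment> \<open>Solves the condition of \<open>align_card\<close> for \<theta>; the additional
    \<open>C\<close> in the denominator ensures \<open>\<theta> < 1\<close>.\<close>
  define \<theta> where "\<theta> = (C - 1) / (real p + 1 + real p * C + C)"
  have C: "C > 1" using assms by (simp add: C_def)
  have den: "real p + 1 + real p * C + C > 0" using C by (simp add: add_pos_nonneg)
  have \<theta>: "0 < \<theta>" "\<theta> < 1" using C den mult_nonneg_nonneg[of C "real p"]
    by (simp add: \<theta>_def, simp add: \<theta>_def divide_less_eq)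
      (use mult_nonneg_nonneg[of "real p" C] C in linarith)
  have "(real p + 1 + real p * C) * \<theta> \<le> (real p + 1 + real p * C + C) * \<theta>"
    using \<theta> C by (intro mult_right_mono) auto
  also have "\<dots> = C - 1" using den by (simp add: \<theta>_def)
  finally have cond: "1 + (real p + 1) * \<theta> + real p * \<theta> * C \<le> C" by (simp add: algebra_simps)
  define \<eta> where "\<eta> = min 1 (\<delta> / (4 * ln (1 / \<theta>)))"
  have lnt: "ln (1 / \<theta>) > 0" using \<theta> by simp
  have \<eta>: "0 < \<eta>" "\<eta> \<le> 1" "\<eta> * ln (1 / \<theta>) \<le> \<delta> / 4"
    using lnt assms by (auto simp: \<eta>_def min_def field_simps)
  have "\<forall>\<^sub>F n::nat in sequentially. (real n + 1) * exp (\<delta> / 4 * real n) * (exp (\<delta> / 4) * exp (\<delta> / 4 * real n)) \<le> exp (\<delta> * real n)"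
    using assms by real_asymp
  then have "\<forall>\<^sub>F n in sequentially. \<forall>w. length w \<le> n \<longrightarrow> real (card (edit_ball p (\<eta> * real n) w)) \<le> exp (\<delta> * real n)"
  proof eventually_elim
    case (elim n)
    show ?case
    proof (intro allI impI)
      fix w :: "nat list" assume w: "length w \<le> n"
      have "real (card (edit_ball p (\<eta> * real n) w)) \<le>
        (\<eta> * real n + 1) * exp (\<eta> * real n * ln (1 / \<theta>)) * C ^ Suc (length w)"
        using \<eta> \<theta> C cond by (intro card_edit_ball) auto
      also have "\<dots> \<le> (real n + 1) * exp (\<delta> / 4 * real n) * C ^ Suc n"
      proof (intro mult_mono)
        show "\<eta> * real n + 1 \<le> real n + 1" using \<eta> by (simp add: mult_left_le_one_le)
        have "\<eta> * ln (1 / \<theta>) * real n \<le> \<delta> / 4 * real n" using \<eta> by (intro mult_right_mono) auto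
        then show "exp (\<eta> * real n * ln (1 / \<theta>)) \<le> exp (\<delta> / 4 * real n)"
          by (simp add: algebra_simps)
        show "C ^ Suc (length w) \<le> C ^ Suc n" using C w by (intro power_increasing) auto
      qed (use C \<eta> in auto)
      also have "C ^ Suc n = exp (\<delta> / 4) * exp (\<delta> / 4 * real n)"
        by (simp add: C_def exp_of_nat_mult[symmetric] mult.commute)
      finally show "real (card (edit_ball p (\<eta> * real n) w)) \<le> exp (\<delta> * real n)"
        using elim by linarith
    qed
  qed
  then show ?thesis using that \<eta> by blast
qed

section \<open>Occurrences of subwords\<close>

text \<open>Near the end \<open>take\<close> returns a shorter word, so only windows that fit into
  \<open>w\<close> count. The empty word occurs \<open>length w\<close> times.\<close>

definition occ :: "nat list \<Rightarrow> nat list \<Rightarrow> nat" where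
  "occ u w = (\<Sum>i<length w. of_bool (take (length u) (drop i w) = u))"

lemma occ_Nil [simp]: "occ u [] = 0"
  by (simp add: occ_def)

lemma occ_Cons: "occ u (a # w) = of_bool (take (length u) (a # w) = u) + occ u w"
  unfolding occ_def by (simp only: length_Cons sum.lessThan_Suc_shift) simp

lemma occ_le_length: "occ u w \<le> length w"
  by (induction w) (auto simp: occ_Cons)

text \<open>An occurrence in \<open>x @ y\<close> that lies in neither part crosses the seam, so it
  starts among the last \<open>length u\<close> letters of \<open>x\<close>. The minimum with
  \<open>length x\<close> lets the induction on \<open>x\<close> close while \<open>x\<close> is
  shorter than \<open>u\<close>.\<close>

lemma occ_append:
  "occ u x + occ u y \<le> occ u (x @ y) \<and> occ u (x @ y) \<le> occ u x + occ u y + min (length x) (length u)"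
proof (induction x)
  case (Cons a x)
  have 1: "take (length u) (a # x @ y) = u" if "take (length u) (a # x) = u"
  proof -
    have "length u \<le> length (a # x)" using that by (metis length_take min.cobounded1)
    then show ?thesis using that by (metis append_Cons take_append append_Nil2 diff_is_0_eq take0)
  qed
  have 2: "take (length u) (a # x) = u" if "take (length u) (a # x @ y) = u" "length u \<le> length (a # x)"
    using that by (metis append_Cons take_append append_Nil2 diff_is_0_eq take0)
  show ?case
  proof (cases "length u \<le> length (a # x)")
    case True
    then have "take (length u) (a # x @ y) = u \<longleftrightarrow> take (length u) (a # x) = u" using 1 2 by blast
    then have "occ u ((a # x) @ y) + occ u x = occ u (a # x) + occ u (x @ y)"
      unfolding append_Cons occ_Cons by simp
    then show ?thesis using Cons by (auto simp: min_def split: if_splits)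
  next
    case False
    then have "take (length u) (a # x) \<noteq> u" by (metis length_take min.cobounded1)
    then have "occ u (a # x) = occ u x" unfolding occ_Cons by simp
    moreover have "occ u ((a # x) @ y) \<le> Suc (occ u (x @ y))" "occ u (x @ y) \<le> occ u ((a # x) @ y)"
      unfolding append_Cons occ_Cons by auto
    ultimately show ?thesis using Cons False by (auto simp: min_def split: if_splits)
  qed
qed auto

text \<open>Only windows that meet the edited place are affected. The proof removes the edited
  letter and pays for the seams with \<open>occ_append\<close>.\<close>

lemma edit_occ: "edit p v w \<Longrightarrow> \<bar>real (occ u v) - real (occ u w)\<bar> \<le> real (2 * length u + 1)"
proof (induction rule: edit.induct)
  case (substitution u1 u2 a a')
  show ?case using occ_append[of u u1 "a # u2"] occ_append[of u u1 "a' # u2"] 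
      occ_append[of u "[a]" u2] occ_append[of u "[a']" u2]
      occ_le_length[of u "[a]"] occ_le_length[of u "[a']"] by (simp add: min_def split: if_splits)
next
  case (insertion u1 u2 a')
  show ?case using occ_append[of u u1 u2] occ_append[of u u1 "a' # u2"] 
      occ_append[of u "[a']" u2] occ_le_length[of u "[a']"] by (simp add: min_def split: if_splits)
next
  case (deletion u1 u2 a)
  show ?case using occ_append[of u u1 u2] occ_append[of u u1 "a # u2"] 
      occ_append[of u "[a]" u2] occ_le_length[of u "[a]"] by (simp add: min_def split: if_splits)
qed

lemma edits_occ: "(edit p ^^ m) v w \<Longrightarrow> \<bar>real (occ u v) - real (occ u w)\<bar> \<le> real m * real (2 * length u + 1)"
proof (induction m arbitrary: w)
  case (Suc m)
  then obtain y where "(edit p ^^ m) v y" "edit p y w" by auto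
  then show ?case using Suc.IH[of y] edit_occ[of p y w u] by (simp add: algebra_simps)
qed auto

lemma edit_ball_occ:
  assumes "v \<in> edit_ball p r w"
  shows "\<bar>real (occ u v) - real (occ u w)\<bar> \<le> r * real (2 * length u + 1)"
proof -
  obtain t where t: "real t \<le> r" "(edit p ^^ t) w v" using assms by (auto simp: edit_ball_def)
  have "\<bar>real (occ u v) - real (occ u w)\<bar> \<le> real t * real (2 * length u + 1)"
    using edits_occ[OF t(2), of u] by (simp add: abs_minus_commute)
  also have "\<dots> \<le> r * real (2 * length u + 1)" using t by (intro mult_right_mono) auto
  finally show ?thesis .
qed

lemma occ_concat:
  "(\<Sum>w\<leftarrow>ws. occ u w) \<le> occ u (concat ws) \<and> occ u (concat ws) \<le> (\<Sum>w\<leftarrow>ws. occ u w) + length ws * length u"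
proof (induction ws)
  case (Cons w ws)
  then show ?case using occ_append[of u w "concat ws"] by (auto simp: min_def split: if_splits)
qed auto

section \<open>Prefixes of sequences and visits to cylinders\<close>

definition pre :: "(nat \<Rightarrow> nat) \<Rightarrow> nat \<Rightarrow> nat list" where
  "pre x n = map x [0..<n]"

lemma length_pre [simp]: "length (pre x n) = n"
  by (simp add: pre_def)

lemma take_pre: "take m (pre x n) = pre x (min m n)"
  by (simp add: pre_def take_map min_def)

lemma nth_pre: "i < n \<Longrightarrow> pre x n ! i = x i"
  by (simp add: pre_def)

lemma shift_funpow: "(shift_map ^^ i) x = (\<lambda>j. x (i + j))"
  by (induction i arbitrary: x) (auto simp: shift_map_def funpow_swap1)

lemma pre_words: "x \<in> full_shift p \<Longrightarrow> pre x n \<in> words p"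
  by (auto simp: pre_def words_def full_shift_def)

lemma pre_block: "x \<in> full_shift p \<Longrightarrow> pre x n \<in> block p n"
  by (simp add: block_def pre_words)

lemma cylinder_pre: "x \<in> cylinder p w \<longleftrightarrow> x \<in> full_shift p \<and> pre x (length w) = w"
  by (auto simp: cylinder_def list_eq_iff_nth_eq nth_pre)

text \<open>This is \<open>n\<close> times the empirical measure of the cylinder of
  \<open>u\<close>: the windows may reach beyond position \<open>n\<close>, which \<open>occ\<close>
  does not allow.\<close>

definition visits :: "nat list \<Rightarrow> (nat \<Rightarrow> nat) \<Rightarrow> nat \<Rightarrow> nat" where
  "visits u x n = (\<Sum>i<n. of_bool (pre ((shift_map ^^ i) x) (length u) = u))"

text \<open>The two counts differ only for windows that start among the last \<open>length u\<close>
  positions.\<close>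

lemma visits_occ: "occ u (pre x n) \<le> visits u x n \<and> visits u x n \<le> occ u (pre x n) + length u"
proof -
  have drop_pre: "drop i (pre x n) = pre ((shift_map ^^ i) x) (n - i)" for i
    by (auto simp: list_eq_iff_nth_eq nth_pre shift_funpow)
  have tk: "take (length u) (drop i (pre x n)) = pre ((shift_map ^^ i) x) (min (length u) (n - i))" for i
    by (simp add: drop_pre take_pre)
  have eq: "take (length u) (drop i (pre x n)) = u \<longleftrightarrow> pre ((shift_map ^^ i) x) (length u) = u \<and> length u \<le> n - i" for i
  proof (cases "length u \<le> n - i")
    case False
    then have "length (take (length u) (drop i (pre x n))) \<noteq> length u" by simp
    then show ?thesis using False by metis
  qed (simp add: tk min_def)
  have "visits u x n \<le> (\<Sum>i<n. of_bool (take (length u) (drop i (pre x n)) = u) + of_bool (\<not> length u \<le> n - i))"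
    unfolding visits_def by (intro sum_mono) (auto simp: eq)
  also have "\<dots> = occ u (pre x n) + (\<Sum>i<n. of_bool (\<not> length u \<le> n - i))"
    by (simp add: sum.distrib occ_def)
  also have "(\<Sum>i<n. of_bool (\<not> length u \<le> n - i)) = card {i\<in>{..<n}. \<not> length u \<le> n - i}"
    by (simp add: of_bool_def sum.If_cases Int_def)
  also have "\<dots> \<le> card {n - length u..<n}" by (intro card_mono) auto
  also have "\<dots> \<le> length u" by simp
  finally have "visits u x n \<le> occ u (pre x n) + length u" by simp
  moreover have "occ u (pre x n) \<le> visits u x n"
    unfolding visits_def occ_def length_pre by (intro sum_mono) (auto simp: eq)
  ultimately show ?thesis by simp
qed

section \<open>Typical lists\<close>

definition lists_of :: "'a set \<Rightarrow> nat \<Rightarrow> 'a list set" where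
  "lists_of A n = {s. set s \<subseteq> A \<and> length s = n}"

lemma finite_lists_of [simp]: "finite A \<Longrightarrow> finite (lists_of A n)"
  unfolding lists_of_def by (rule finite_lists_length_eq)

lemma sum_lists_of_Suc:
  assumes "finite A"
  shows "(\<Sum>s\<in>lists_of A (Suc n). f s) = (\<Sum>a\<in>A. \<Sum>s\<in>lists_of A n. f (a # s))"
proof -
  have "lists_of A (Suc n) = (\<lambda>(a, s). a # s) ` (A \<times> lists_of A n)"
    by (force simp: lists_of_def length_Suc_conv)
  moreover have "inj_on (\<lambda>(a, s). a # s) (A \<times> lists_of A n)" by (auto simp: inj_on_def)
  ultimately show ?thesis
    using assms by (simp add: sum.reindex sum.cartesian_product split_def)
qed

lemma lists_of_0 [simp]: "lists_of A 0 = {[]}"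
  by (auto simp: lists_of_def)

text \<open>The mass of the list \<open>s\<close> under independent draws with law
  \<open>q\<close>.\<close>

definition weight :: "('a \<Rightarrow> real) \<Rightarrow> 'a list \<Rightarrow> real" where
  "weight q s = prod_list (map q s)"

lemma weight_simps [simp]: "weight q [] = 1" "weight q (a # s) = q a * weight q s"
  by (simp_all add: weight_def)

lemma sum_weight:
  assumes "finite A" "(\<Sum>a\<in>A. q a) = 1"
  shows "(\<Sum>s\<in>lists_of A n. weight q s) = 1"
proof (induction n)
  case (Suc n)
  have "(\<Sum>s\<in>lists_of A (Suc n). weight q s) = (\<Sum>a\<in>A. q a * (\<Sum>s\<in>lists_of A n. weight q s))"
    using assms(1) by (simp add: sum_lists_of_Suc sum_distrib_left)
  then show ?case using Suc assms by simp
qed simp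

text \<open>Moments of a sum of independent centred variables. In the recursion for the square the
  mixed term contains the first moment of the tail, which vanishes.\<close>

lemma sum_weight_moments:
  assumes "finite A" "(\<Sum>a\<in>A. q a) = (1::real)" "(\<Sum>a\<in>A. q a * f a) = 0" "(\<Sum>a\<in>A. q a * (f a)\<^sup>2) \<le> V"
  shows "(\<Sum>s\<in>lists_of A n. weight q s * (\<Sum>a\<leftarrow>s. f a)) = 0"
    and "(\<Sum>s\<in>lists_of A n. weight q s * (\<Sum>a\<leftarrow>s. f a)\<^sup>2) \<le> real n * V"
proof -
  have 1: "(\<Sum>s\<in>lists_of A n. weight q s * (\<Sum>a\<leftarrow>s. f a)) = 0" for n
  proof (induction n)
    case (Suc n)
    have "(\<Sum>s\<in>lists_of A (Suc n). weight q s * (\<Sum>a\<leftarrow>s. f a)) =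
      (\<Sum>a\<in>A. q a * f a * (\<Sum>s\<in>lists_of A n. weight q s) +
              q a * (\<Sum>s\<in>lists_of A n. weight q s * (\<Sum>a\<leftarrow>s. f a)))"
      using assms(1) by (simp add: sum_lists_of_Suc sum_distrib_left sum.distrib[symmetric] algebra_simps)
    then show ?case using Suc sum_weight[OF assms(1,2)] assms(3) by simp
  qed simp
  show "(\<Sum>s\<in>lists_of A n. weight q s * (\<Sum>a\<leftarrow>s. f a)) = 0" by fact
  show "(\<Sum>s\<in>lists_of A n. weight q s * (\<Sum>a\<leftarrow>s. f a)\<^sup>2) \<le> real n * V"
  proof (induction n)
    case (Suc n)
    let ?S = "\<lambda>g. \<Sum>s\<in>lists_of A n. weight q s * g (\<Sum>a\<leftarrow>s. f a)"
    have "(\<Sum>s\<in>lists_of A (Suc n). weight q s * (\<Sum>a\<leftarrow>s. f a)\<^sup>2) =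
      (\<Sum>a\<in>A. q a * (f a)\<^sup>2 * (\<Sum>s\<in>lists_of A n. weight q s) +
              2 * q a * f a * ?S (\<lambda>x. x) + q a * ?S (\<lambda>x. x\<^sup>2))"
      using assms(1)
      by (simp add: sum_lists_of_Suc sum_distrib_left sum.distrib[symmetric] algebra_simps power2_eq_square)
    also have "\<dots> = (\<Sum>a\<in>A. q a * (f a)\<^sup>2) + ?S (\<lambda>x. x\<^sup>2)"
      using sum_weight[OF assms(1,2)] assms(2) 1[of n]
      by (simp add: sum.distrib sum_distrib_right[symmetric])
    finally show ?case using Suc assms(4) by (simp add: algebra_simps)
  qed simp
qed

lemma sum_UN_le:
  fixes f :: "'a \<Rightarrow> real"
  assumes "finite I" "\<And>i. i \<in> I \<Longrightarrow> finite (B i)" "\<And>i x. i \<in> I \<Longrightarrow> x \<in> B i \<Longrightarrow> 0 \<le> f x"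
  shows "(\<Sum>x\<in>(\<Union>i\<in>I. B i). f x) \<le> (\<Sum>i\<in>I. \<Sum>x\<in>B i. f x)"
  using assms
proof (induction I)
  case (insert i I)
  have "sum f (B i \<union> (\<Union>i\<in>I. B i)) + sum f (B i \<inter> (\<Union>i\<in>I. B i)) = sum f (B i) + sum f (\<Union>i\<in>I. B i)"
    using insert by (intro sum.union_inter) auto
  moreover have "0 \<le> sum f (B i \<inter> (\<Union>i\<in>I. B i))" using insert by (intro sum_nonneg) auto
  moreover have "sum f (\<Union>i\<in>I. B i) \<le> (\<Sum>i\<in>I. \<Sum>x\<in>B i. f x)" using insert by auto
  ultimately show ?case using insert by simp
qed simp

definition shannon :: "'a set \<Rightarrow> ('a \<Rightarrow> real) \<Rightarrow> real" where
  "shannon A q = - (\<Sum>a\<in>A. q a * ln (q a))"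

lemma sum_list_count:
  fixes g :: "'a \<Rightarrow> real"
  assumes "finite A" "set s \<subseteq> A"
  shows "(\<Sum>a\<leftarrow>s. g a) = (\<Sum>a\<in>A. real (count_list s a) * g a)"
  using assms(2)
proof (induction s)
  case (Cons b s)
  have "(\<Sum>a\<in>A. real (count_list (b # s) a) * g a) =
    (\<Sum>a\<in>A. real (count_list s a) * g a + (if b = a then g a else 0))"
    by (intro sum.cong) (auto simp: algebra_simps)
  also have "\<dots> = (\<Sum>a\<in>A. real (count_list s a) * g a) + g b"
    using assms Cons by (simp add: sum.distrib)
  finally show ?case using Cons by simp
qed simp

text \<open>Chebyshev's inequality, applied to each letter, leaves the lists with nearly correct
  counts at least half of the product mass. Their counts force each of them to have mass at most
  \<open>exp (- n * (shannon A q - \<epsilon> / 2))\<close>, so there must be many.\<close>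

lemma typical_lists:
  fixes q :: "'a \<Rightarrow> real"
  assumes "finite A" "\<And>a. a \<in> A \<Longrightarrow> 0 < q a" "(\<Sum>a\<in>A. q a) = 1" "\<epsilon> > 0"
  shows "\<forall>\<^sub>F n in sequentially. \<exists>T\<subseteq>lists_of A n.
    (\<forall>s\<in>T. \<forall>a\<in>A. \<bar>real (count_list s a) - real n * q a\<bar> \<le> \<epsilon> * real n) \<and>
    exp (real n * (shannon A q - \<epsilon>)) \<le> real (card T)"
proof -
  have A: "A \<noteq> {}" using assms(3) by auto
  have q1: "q a \<le> 1" if "a \<in> A" for a
    using assms that member_le_sum[of a A q] by (simp add: less_imp_le)
  \<comment> \<open>A deviation of \<open>\<delta> * n\<close> in every count changes the logarithm
    of the mass of a list by at most \<open>\<delta> * n * B\<close>.\<close>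
  define B where "B = (\<Sum>a\<in>A. - ln (q a))"
  have B: "B \<ge> 0" unfolding B_def using assms q1 by (intro sum_nonneg) auto
  define \<delta> where "\<delta> = min \<epsilon> (\<epsilon> / (2 * (B + 1)))"
  have \<delta>: "0 < \<delta>" "\<delta> \<le> \<epsilon>" "\<delta> * B \<le> \<epsilon> / 2"
  proof -
    show "0 < \<delta>" "\<delta> \<le> \<epsilon>" using B assms by (auto simp: \<delta>_def)
    have "\<delta> * B \<le> (\<epsilon> / (2 * (B + 1))) * B" using B by (intro mult_right_mono) (auto simp: \<delta>_def)
    also have "\<dots> \<le> (\<epsilon> / (2 * (B + 1))) * (B + 1)" using B assms by (intro mult_left_mono) auto
    also have "\<dots> = \<epsilon> / 2" using B by (simp add: field_simps)
    finally show "\<delta> * B \<le> \<epsilon> / 2" .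
  qed
  have ev1: "\<forall>\<^sub>F n::nat in sequentially. real (card A) * real n / (\<delta> * real n)\<^sup>2 \<le> 1 / 2"
    using \<delta>(1) by real_asymp
  \<comment> \<open>The second half of \<epsilon> absorbs the factor 1/2 lost by discarding the bad
    lists.\<close>
  have ev2: "\<forall>\<^sub>F n::nat in sequentially. exp (real n * (- \<epsilon> / 2)) \<le> 1 / 2"
    using assms(4) by real_asymp
  show ?thesis using ev1 ev2 eventually_gt_at_top[of 0]
  proof eventually_elim
    case (elim n)
    define bad where "bad a = {s \<in> lists_of A n. \<bar>real (count_list s a) - real n * q a\<bar> > \<delta> * real n}" for a
    define T where "T = lists_of A n - (\<Union>a\<in>A. bad a)"
    have wpos: "0 \<le> weight q s" if "s \<in> lists_of A n" for s
      unfolding weight_def using that assms(2) by (intro prod_list_nonneg) (auto simp: lists_of_def less_imp_le)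
    have bad: "(\<Sum>s\<in>bad a. weight q s) \<le> real n / (\<delta> * real n)\<^sup>2" if a: "a \<in> A" for a
    proof -
      \<comment> \<open>The centred indicator of the letter \<open>a\<close>: its sum over a list is
        the deviation of the count of \<open>a\<close>, and its variance is at most 1.\<close>
      let ?f = "\<lambda>b. of_bool (b = a) - q a :: real"
      have "(\<Sum>b\<in>A. q b * of_bool (b = a)) = q a"
        using a assms(1) by (simp add: of_bool_def if_distrib[of "(*) _"] cong: if_cong)
      then have f0: "(\<Sum>b\<in>A. q b * ?f b) = 0"
        using assms(3) by (simp add: algebra_simps sum_subtractf sum_distrib_right[symmetric])
      have fle: "(?f b)\<^sup>2 \<le> 1" if "b \<in> A" for b
        using q1[OF a] assms(2)[OF a] by (auto simp: of_bool_def power2_le_iff_abs_le abs_square_le_1)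
      have "(\<Sum>b\<in>A. q b * (?f b)\<^sup>2) \<le> (\<Sum>b\<in>A. q b * 1)"
        using fle assms(2) by (intro sum_mono mult_left_mono) (auto simp: less_imp_le)
      then have f2: "(\<Sum>b\<in>A. q b * (?f b)\<^sup>2) \<le> 1" using assms(3) by simp
      have fs: "(\<Sum>b\<leftarrow>s. ?f b) = real (count_list s a) - real (length s) * q a" for s
        by (induction s) (auto simp: algebra_simps)
      have "(\<Sum>s\<in>bad a. weight q s) * (\<delta> * real n)\<^sup>2 = (\<Sum>s\<in>bad a. weight q s * (\<delta> * real n)\<^sup>2)"
        by (simp add: sum_distrib_right)
      also have "\<dots> \<le> (\<Sum>s\<in>bad a. weight q s * (\<Sum>b\<leftarrow>s. ?f b)\<^sup>2)"
      proof (intro sum_mono mult_left_mono)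
        fix s assume "s \<in> bad a"
        then show "(\<delta> * real n)\<^sup>2 \<le> (\<Sum>b\<leftarrow>s. ?f b)\<^sup>2" unfolding fs using \<delta>
          by (subst abs_le_square_iff[symmetric]) (auto simp: bad_def lists_of_def)
      qed (auto simp: bad_def wpos)
      also have "\<dots> \<le> (\<Sum>s\<in>lists_of A n. weight q s * (\<Sum>b\<leftarrow>s. ?f b)\<^sup>2)"
        using assms(1) wpos by (intro sum_mono2) (auto simp: bad_def)
      also have "\<dots> \<le> real n * 1" by (rule sum_weight_moments(2)[OF assms(1,3) f0 f2])
      finally show ?thesis using elim \<delta> by (simp add: field_simps)
    qed
    have "1 = (\<Sum>s\<in>lists_of A n. weight q s)" using sum_weight[OF assms(1,3)] by simp
    also have "\<dots> = (\<Sum>s\<in>T. weight q s) + (\<Sum>s\<in>(\<Union>a\<in>A. bad a). weight q s)"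
      unfolding T_def using assms(1) by (intro sum.subset_diff) (auto simp: bad_def)
    also have "(\<Sum>s\<in>(\<Union>a\<in>A. bad a). weight q s) \<le> (\<Sum>a\<in>A. \<Sum>s\<in>bad a. weight q s)"
      using assms(1) wpos by (intro sum_UN_le) (auto simp: bad_def)
    also have "\<dots> \<le> (\<Sum>a\<in>A. real n / (\<delta> * real n)\<^sup>2)" by (intro sum_mono bad)
    also have "\<dots> \<le> 1 / 2" using elim by simp
    finally have half: "1 / 2 \<le> (\<Sum>s\<in>T. weight q s)" by simp
    have cnt: "\<bar>real (count_list s a) - real n * q a\<bar> \<le> \<delta> * real n" if "s \<in> T" "a \<in> A" for s a
      using that by (auto simp: T_def bad_def not_less)
    have w: "weight q s \<le> exp (real n * (- shannon A q + \<epsilon> / 2))" if s: "s \<in> T" for s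
    proof -
      have sA: "set s \<subseteq> A" using s by (auto simp: T_def lists_of_def)
      have "weight q s = exp (\<Sum>a\<leftarrow>s. ln (q a))"
        using sA by (induction s) (auto simp: exp_add assms(2))
      also have "(\<Sum>a\<leftarrow>s. ln (q a)) = (\<Sum>a\<in>A. real (count_list s a) * ln (q a))"
        by (rule sum_list_count[OF assms(1) sA])
      also have "\<dots> \<le> (\<Sum>a\<in>A. real n * (q a * ln (q a)) + \<delta> * real n * (- ln (q a)))"
      proof (intro sum_mono)
        fix a assume a: "a \<in> A"
        have "(real n * q a - real (count_list s a)) * (- ln (q a)) \<le> (\<delta> * real n) * (- ln (q a))"
          using cnt[OF s a] q1[OF a] assms(2)[OF a] by (intro mult_right_mono) auto
        then show "real (count_list s a) * ln (q a) \<le> real n * (q a * ln (q a)) + \<delta> * real n * (- ln (q a))"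
          by (simp add: algebra_simps)
      qed
      also have "\<dots> = real n * (- shannon A q + \<delta> * B)"
        by (simp add: sum.distrib sum_subtractf sum_negf shannon_def B_def sum_distrib_left algebra_simps)
      also have "\<dots> \<le> real n * (- shannon A q + \<epsilon> / 2)" using \<delta> by (intro mult_left_mono) auto
      finally show ?thesis by simp
    qed
    have "1 / 2 \<le> (\<Sum>s\<in>T. exp (real n * (- shannon A q + \<epsilon> / 2)))"
      using half sum_mono[of T "weight q" "\<lambda>s. exp (real n * (- shannon A q + \<epsilon> / 2))"] w by fastforce
    then have "1 / 2 \<le> real (card T) * exp (real n * (- shannon A q + \<epsilon> / 2))" by simp
    then have "1 / 2 * exp (real n * (shannon A q - \<epsilon> / 2)) \<le>
      real (card T) * exp (real n * (- shannon A q + \<epsilon> / 2)) * exp (real n * (shannon A q - \<epsilon> / 2))"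
      by (intro mult_right_mono) auto
    also have "\<dots> = real (card T)" by (simp add: mult.assoc exp_add[symmetric] algebra_simps)
    finally have c: "1 / 2 * exp (real n * (shannon A q - \<epsilon> / 2)) \<le> real (card T)" .
    have "exp (real n * (shannon A q - \<epsilon>)) = exp (real n * (- \<epsilon> / 2)) * exp (real n * (shannon A q - \<epsilon> / 2))"
      by (simp add: exp_add[symmetric] algebra_simps)
    also have "\<dots> \<le> 1 / 2 * exp (real n * (shannon A q - \<epsilon> / 2))" using elim by (intro mult_right_mono) auto
    finally have "exp (real n * (shannon A q - \<epsilon>)) \<le> real (card T)" using c by linarith
    moreover have "\<bar>real (count_list s a) - real n * q a\<bar> \<le> \<epsilon> * real n" if "s \<in> T" "a \<in> A" for s a
      using cnt[OF that] \<delta>(2) by (smt (verit) mult_right_mono of_nat_0_le_iff)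
    moreover have "T \<subseteq> lists_of A n" by (auto simp: T_def)
    ultimately show ?case by blast
  qed
qed

section \<open>Counting words with given block frequencies\<close>

text \<open>Mass of \<open>w\<close> under the product measure with block law \<nu>, when
  \<open>w\<close> is cut into consecutive blocks of length \<open>k\<close>. An incomplete last
  block has factor 1.\<close>

fun parse_weight :: "nat \<Rightarrow> (nat list \<Rightarrow> real) \<Rightarrow> nat list \<Rightarrow> real" where
  "parse_weight k \<nu> w = (if k = 0 \<or> length w < k then 1 else \<nu> (take k w) * parse_weight k \<nu> (drop k w))"

declare parse_weight.simps [simp del]

lemma sum_block_add:
  fixes f :: "nat list \<Rightarrow> real"
  shows "(\<Sum>w\<in>block p (m + n). f w) = (\<Sum>u\<in>block p m. \<Sum>w\<in>block p n. f (u @ w))"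
proof -
  have "block p (m + n) = (\<lambda>(u, w). u @ w) ` (block p m \<times> block p n)"
  proof (intro set_eqI iffI)
    fix w assume "w \<in> block p (m + n)"
    then have "(take m w, drop m w) \<in> block p m \<times> block p n"
      by (auto simp: block_def words_takeI words_dropI)
    then show "w \<in> (\<lambda>(u, w). u @ w) ` (block p m \<times> block p n)"
      by (intro image_eqI[of _ _ "(take m w, drop m w)"]) auto
  qed (auto simp: block_def)
  moreover have "inj_on (\<lambda>(u, w). u @ w) (block p m \<times> block p n)"
    by (auto simp: inj_on_def block_def)
  ultimately show ?thesis by (simp add: sum.reindex sum.cartesian_product split_def)
qed

lemma block_0 [simp]: "block p 0 = {[]}"
  by (auto simp: block_def)


text \<open>Summing over a full block gives the factor 1, so only the incomplete last block
  contributes, with fewer than \<open>k\<close> free letters.\<close>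

lemma sum_parse_weight:
  assumes "k > 0" "p \<ge> 1" "(\<Sum>u\<in>block p k. \<nu> u) = 1"
  shows "(\<Sum>w\<in>block p n. parse_weight k \<nu> w) \<le> real p ^ k"
proof (induction n rule: less_induct)
  case (less n)
  show ?case
  proof (cases "n < k")
    case True
    have "(\<Sum>w\<in>block p n. parse_weight k \<nu> w) = (\<Sum>w\<in>block p n. 1)"
      using True by (intro sum.cong) (auto simp: block_def parse_weight.simps)
    also have "\<dots> = real p ^ n" by (simp add: card_block)
    also have "\<dots> \<le> real p ^ k" using True assms by (intro power_increasing) auto
    finally show ?thesis .
  next
    case False
    then have "(\<Sum>w\<in>block p n. parse_weight k \<nu> w) =
      (\<Sum>u\<in>block p k. \<Sum>w\<in>block p (n - k). parse_weight k \<nu> (u @ w))"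
      using sum_block_add[of _ p k "n - k"] by simp
    also have "\<dots> = (\<Sum>u\<in>block p k. \<Sum>w\<in>block p (n - k). \<nu> u * parse_weight k \<nu> w)"
      using assms by (intro sum.cong refl) (subst parse_weight.simps, auto simp: block_def)
    also have "\<dots> = (\<Sum>w\<in>block p (n - k). parse_weight k \<nu> w)"
      using assms by (simp add: sum_product[symmetric])
    finally show ?thesis using less[of "n - k"] False assms by simp
  qed
qed

lemma sum_parse_weight_drop:
  assumes "k > 0" "p \<ge> 1" "(\<Sum>u\<in>block p k. \<nu> u) = 1" "j < k"
  shows "(\<Sum>w\<in>block p n. parse_weight k \<nu> (drop j w)) \<le> real p ^ (2 * k)"
proof (cases "j \<le> n")
  case True
  then have "(\<Sum>w\<in>block p n. parse_weight k \<nu> (drop j w)) =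
      (\<Sum>u\<in>block p j. \<Sum>w\<in>block p (n - j). parse_weight k \<nu> (drop j (u @ w)))"
    using sum_block_add[of _ p j "n - j"] by simp
  also have "\<dots> = (\<Sum>u\<in>block p j. \<Sum>w\<in>block p (n - j). parse_weight k \<nu> w)"
    by (intro sum.cong refl) (auto simp: block_def)
  also have "\<dots> = real p ^ j * (\<Sum>w\<in>block p (n - j). parse_weight k \<nu> w)" by (simp add: card_block)
  also have "\<dots> \<le> real p ^ j * real p ^ k"
    using sum_parse_weight[OF assms(1-3)] by (intro mult_left_mono) auto
  also have "\<dots> \<le> real p ^ k * real p ^ k"
    using assms by (intro mult_right_mono power_increasing) auto
  finally show ?thesis by (simp add: power_add[symmetric] mult_2)
next
  case False
  have "(\<Sum>w\<in>block p n. parse_weight k \<nu> (drop j w)) = (\<Sum>w\<in>block p n. 1)"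
    using False assms by (intro sum.cong) (auto simp: block_def parse_weight.simps)
  also have "\<dots> = real p ^ n" by (simp add: card_block)
  also have "\<dots> \<le> real p ^ (2 * k)" using False assms by (intro power_increasing) auto
  finally show ?thesis .
qed

text \<open>Every window of length \<open>k\<close> is a parsing block for exactly one of the \<open>k\<close> offsets.\<close>

lemma prod_parse_weight:
  assumes "k > 0"
  shows "(\<Prod>j<k. parse_weight k \<nu> (drop j w)) =
    (\<Prod>i<length w. if k \<le> length w - i then \<nu> (take k (drop i w)) else 1)"
proof (induction w)
  case Nil
  then show ?case using assms by (simp add: parse_weight.simps)
next
  case (Cons a w)
  obtain k' where k: "k = Suc k'" using assms by (cases k) auto
  let ?G = "parse_weight k \<nu>"
  \<comment> \<open>Prepending a letter shifts every offset by one. The new offset 0 is the old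
    offset \<open>k - 1\<close> preceded by one more window, so exactly one factor is added.\<close>
  have G: "?G (a # w) = (if k \<le> length (a # w) then \<nu> (take k (a # w)) else 1) * ?G (drop k' w)"
    using k by (subst parse_weight.simps) (auto simp: parse_weight.simps)
  have "(\<Prod>j<k. ?G (drop j (a # w))) = ?G (a # w) * (\<Prod>j<k'. ?G (drop j w))"
    unfolding k prod.lessThan_Suc_shift by simp
  also have "\<dots> = (if k \<le> length (a # w) then \<nu> (take k (a # w)) else 1) * (\<Prod>j<k. ?G (drop j w))"
    unfolding k prod.lessThan_Suc G[unfolded k] by (simp add: mult_ac)
  finally show ?case unfolding Cons length_Cons prod.lessThan_Suc_shift by (simp cong: if_cong)
qed

lemma occ_sum:
  fixes f :: "nat list \<Rightarrow> real"
  assumes "w \<in> words p" "k > 0"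
  shows "(\<Sum>i<length w. if k \<le> length w - i then f (take k (drop i w)) else 0) =
    (\<Sum>u\<in>block p k. real (occ u w) * f u)"
proof -
  have "(\<Sum>u\<in>block p k. real (occ u w) * f u) =
    (\<Sum>u\<in>block p k. \<Sum>i<length w. of_bool (take (length u) (drop i w) = u) * f u)"
    by (simp add: occ_def sum_distrib_right)
  also have "\<dots> = (\<Sum>i<length w. \<Sum>u\<in>block p k. of_bool (take (length u) (drop i w) = u) * f u)"
    by (rule sum.swap)
  also have "\<dots> = (\<Sum>i<length w. \<Sum>u\<in>block p k. if u = take k (drop i w) then f u else 0)"
    by (intro sum.cong refl) (auto simp: block_def)
  also have "\<dots> = (\<Sum>i<length w. if k \<le> length w - i then f (take k (drop i w)) else 0)"
  proof (intro sum.cong refl)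
    fix i assume "i \<in> {..<length w}"
    have "take k (drop i w) \<in> block p k \<longleftrightarrow> k \<le> length w - i"
      using assms by (auto simp: block_def words_takeI words_dropI min_def)
    then show "(\<Sum>u\<in>block p k. if u = take k (drop i w) then f u else 0) =
      (if k \<le> length w - i then f (take k (drop i w)) else 0)" by simp
  qed
  finally show ?thesis ..
qed

text \<open>The product of the parse weights over all \<open>k\<close> offsets depends only on the
  counts of the \<open>k\<close>-blocks and is governed by a cross entropy. Hence for each word some
  offset has at least the geometric mean as its weight, and for each offset the total weight is
  bounded. This produces the factors \<open>k\<close> and \<open>p ^ (2 * k)\<close>.\<close>

lemma card_frequent_words:
  fixes q :: "nat list \<Rightarrow> real"
  assumes "k > 0" "p \<ge> 1" "\<And>u. u \<in> block p k \<Longrightarrow> 0 \<le> q u" "(\<Sum>u\<in>block p k. q u) = 1" "\<epsilon> > 0"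
  obtains \<delta> where "\<delta> > 0" "\<And>n. real (card {w \<in> block p n. \<forall>u\<in>block p k. \<bar>real (occ u w) - real n * q u\<bar> \<le> \<delta> * real n})
    \<le> real k * real p ^ (2 * k) * exp (real n * (shannon (block p k) q / real k + \<epsilon>))"
proof -
  let ?W = "block p k"
  define M where "M = real (card ?W)"
  have M: "M > 0" unfolding M_def card_block using assms by simp
  \<comment> \<open>\<nu> is \<open>q\<close> smoothed by \<theta>, so that blocks of mass zero keep
    a positive weight. The normalising constant is \<open>exp (\<epsilon> / 2)\<close>, so the
    smoothing raises the cross entropy by at most \<open>\<epsilon> / 2\<close>.\<close>
  define \<theta> where "\<theta> = (exp (\<epsilon> / 2) - 1) / M"
  have \<theta>: "\<theta> > 0" "1 + \<theta> * M = exp (\<epsilon> / 2)" using M assms by (auto simp: \<theta>_def)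
  define \<nu> where "\<nu> u = (max 0 (q u) + \<theta>) / (1 + \<theta> * M)" for u
  have \<nu>pos: "\<nu> u > 0" for u using \<theta> by (auto simp: \<nu>_def intro!: divide_pos_pos add_nonneg_pos)
  have \<nu>eq: "\<nu> u = (q u + \<theta>) / (1 + \<theta> * M)" if "u \<in> ?W" for u using that assms(3) by (simp add: \<nu>_def)
  have "(\<Sum>u\<in>?W. \<nu> u) = (\<Sum>u\<in>?W. (q u + \<theta>) / (1 + \<theta> * M))" using \<nu>eq by (rule sum.cong[OF refl])
  also have "\<dots> = 1"
    using assms(4) \<theta> by (simp add: sum_divide_distrib[symmetric] sum.distrib M_def mult.commute)
  finally have \<nu>1: "(\<Sum>u\<in>?W. \<nu> u) = 1" .
  define B where "B = (\<Sum>u\<in>?W. \<bar>ln (\<nu> u)\<bar>)"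
  have B: "B \<ge> 0" by (simp add: B_def sum_nonneg)
  \<comment> \<open>Block counts that are off by \<open>\<delta> * n\<close> change the cross
    entropy sum by at most \<open>\<delta> * n * B\<close>; this is the other half of
    \<epsilon>.\<close>
  define \<delta> where "\<delta> = \<epsilon> / (2 * (B + 1))"
  have \<delta>: "\<delta> > 0" "\<delta> * B \<le> \<epsilon> / 2" using B assms by (auto simp: \<delta>_def field_simps)
  have cross: "(\<Sum>u\<in>?W. q u * - ln (\<nu> u)) \<le> shannon ?W q + \<epsilon> / 2"
  proof -
    have "q u * - ln (\<nu> u) \<le> - (q u * ln (q u)) + q u * (\<epsilon> / 2)" if u: "u \<in> ?W" for u
    proof (cases "q u = 0")
      case False
      then have "q u > 0" using assms(3)[OF u] by simp
      moreover have "ln (\<nu> u) = ln (q u + \<theta>) - \<epsilon> / 2"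
        using \<open>q u > 0\<close> \<theta> by (simp add: \<nu>eq[OF u] ln_div)
      moreover have "ln (q u) \<le> ln (q u + \<theta>)" using \<open>q u > 0\<close> \<theta> by simp
      ultimately have "q u * - ln (\<nu> u) \<le> q u * (- ln (q u) + \<epsilon> / 2)" by (intro mult_left_mono) auto
      then show ?thesis by (simp add: algebra_simps)
    qed simp
    then have "(\<Sum>u\<in>?W. q u * - ln (\<nu> u)) \<le> (\<Sum>u\<in>?W. - (q u * ln (q u)) + q u * (\<epsilon> / 2))"
      by (intro sum_mono)
    also have "\<dots> = shannon ?W q + \<epsilon> / 2"
      using assms(4) by (simp only: sum.distrib sum_negf shannon_def sum_distrib_right[symmetric] mult_1)
    finally show ?thesis .
  qed
  show ?thesis
  proof (rule that[OF \<delta>(1)])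
    fix n
    define F where "F = {w \<in> block p n. \<forall>u\<in>?W. \<bar>real (occ u w) - real n * q u\<bar> \<le> \<delta> * real n}"
    define s where "s = real n * (shannon ?W q / real k + \<epsilon>)"
    define Fj where "Fj j = {w \<in> block p n. exp (- s) \<le> parse_weight k \<nu> (drop j w)}" for j
    have Gpos: "0 < parse_weight k \<nu> w" for w
    proof (induction "length w" arbitrary: w rule: less_induct)
      case less
      show ?case
      proof (cases "length w < k")
        case False
        then have "0 < parse_weight k \<nu> (drop k w)" using assms(1) by (intro less) auto
        then show ?thesis using \<nu>pos by (subst parse_weight.simps) auto
      qed (simp add: parse_weight.simps)
    qed
    have Gne: "parse_weight k \<nu> w \<noteq> 0" for w using Gpos[of w] by simp
    have sub: "F \<subseteq> (\<Union>j<k. Fj j)"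
    proof
      fix w assume w: "w \<in> F"
      have wb: "w \<in> words p" "length w = n" using w by (auto simp: F_def block_def)
      have "(\<Sum>j<k. - ln (parse_weight k \<nu> (drop j w))) = - ln (\<Prod>j<k. parse_weight k \<nu> (drop j w))"
        by (subst ln_prod) (auto simp: sum_negf Gpos Gne)
      also have "\<dots> = (\<Sum>i<length w. - ln (if k \<le> length w - i then \<nu> (take k (drop i w)) else 1))"
        unfolding prod_parse_weight[OF assms(1)]
        by (subst ln_prod) (auto simp: sum_negf \<nu>pos less_imp_neq[OF \<nu>pos, symmetric])
      also have "\<dots> = (\<Sum>i<length w. if k \<le> length w - i then - ln (\<nu> (take k (drop i w))) else 0)"
        by (intro sum.cong) auto
      also have "\<dots> = (\<Sum>u\<in>?W. real (occ u w) * - ln (\<nu> u))"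
        by (rule occ_sum[OF wb(1) assms(1)])
      also have "\<dots> \<le> (\<Sum>u\<in>?W. real n * (q u * - ln (\<nu> u)) + \<delta> * real n * \<bar>ln (\<nu> u)\<bar>)"
      proof (intro sum_mono)
        fix u assume u: "u \<in> ?W"
        have "(real (occ u w) - real n * q u) * - ln (\<nu> u) \<le> \<bar>real (occ u w) - real n * q u\<bar> * \<bar>ln (\<nu> u)\<bar>"
          by (metis abs_ge_self abs_minus_cancel abs_mult)
        also have "\<dots> \<le> \<delta> * real n * \<bar>ln (\<nu> u)\<bar>" using w u by (intro mult_right_mono) (auto simp: F_def)
        finally show "real (occ u w) * - ln (\<nu> u) \<le> real n * (q u * - ln (\<nu> u)) + \<delta> * real n * \<bar>ln (\<nu> u)\<bar>"
          by (simp add: algebra_simps)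
      qed
      also have "\<dots> = real n * ((\<Sum>u\<in>?W. q u * - ln (\<nu> u)) + \<delta> * B)"
        by (simp only: sum.distrib sum_distrib_left[symmetric] B_def) (simp add: algebra_simps)
      also have "\<dots> \<le> real n * (shannon ?W q + \<epsilon> / 2 + \<epsilon> / 2)"
        using cross \<delta> by (intro mult_left_mono) auto
      also have "\<dots> \<le> real n * (shannon ?W q + \<epsilon> * real k)"
        using assms by (intro mult_left_mono) auto
      also have "\<dots> = real k * s" using assms by (simp add: s_def field_simps)
      finally have le: "(\<Sum>j<k. - ln (parse_weight k \<nu> (drop j w))) \<le> real k * s" .
      have "\<exists>j<k. - ln (parse_weight k \<nu> (drop j w)) \<le> s"
      proof (rule ccontr)
        assume "\<not> ?thesis"
        then have "(\<Sum>j<k. s) < (\<Sum>j<k. - ln (parse_weight k \<nu> (drop j w)))"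
          using assms(1) by (intro sum_strict_mono) auto
        then show False using le by simp
      qed
      then obtain j where j: "j < k" "- s \<le> ln (parse_weight k \<nu> (drop j w))" by auto
      then have "exp (- s) \<le> parse_weight k \<nu> (drop j w)"
        using Gpos by (metis exp_le_cancel_iff exp_ln)
      then show "w \<in> (\<Union>j<k. Fj j)" using j w by (auto simp: Fj_def F_def)
    qed
    have cFj: "real (card (Fj j)) \<le> real p ^ (2 * k) * exp s" if "j < k" for j
    proof -
      have "real (card (Fj j)) * exp (- s) = (\<Sum>w\<in>Fj j. exp (- s))" by simp
      also have "\<dots> \<le> (\<Sum>w\<in>Fj j. parse_weight k \<nu> (drop j w))" by (intro sum_mono) (auto simp: Fj_def)
      also have "\<dots> \<le> (\<Sum>w\<in>block p n. parse_weight k \<nu> (drop j w))"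
        using Gpos by (intro sum_mono2) (auto simp: Fj_def less_imp_le)
      also have "\<dots> \<le> real p ^ (2 * k)" by (rule sum_parse_weight_drop[OF assms(1,2) \<nu>1 that])
      finally show ?thesis by (simp add: exp_minus field_simps)
    qed
    have "card F \<le> card (\<Union>j<k. Fj j)"
      using sub by (intro card_mono) (auto simp: Fj_def)
    also have "\<dots> \<le> (\<Sum>j<k. card (Fj j))" by (rule card_UN_le) auto
    finally have "real (card F) \<le> (\<Sum>j<k. real (card (Fj j)))" by (metis of_nat_le_iff of_nat_sum)
    also have "\<dots> \<le> (\<Sum>j<k. real p ^ (2 * k) * exp s)" using cFj by (intro sum_mono) auto
    finally show "real (card {w \<in> block p n. \<forall>u\<in>?W. \<bar>real (occ u w) - real n * q u\<bar> \<le> \<delta> * real n})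
      \<le> real k * real p ^ (2 * k) * exp (real n * (shannon ?W q / real k + \<epsilon>))"
      by (simp add: F_def s_def mult.assoc)
  qed
qed

section \<open>Entropy of finite-valued functions\<close>

text \<open>Entropy of the partition into the fibres of \<open>f\<close>. With functions in place of
  partitions, joins become pairs and pullbacks become compositions.\<close>

definition entropy_of :: "'a measure \<Rightarrow> ('a \<Rightarrow> 'b) \<Rightarrow> real" where
  "entropy_of M f = shannon (f ` space M) (\<lambda>b. measure M (f -` {b} \<inter> space M))"

lemma shannon_superset:
  assumes "finite B" "A \<subseteq> B" "\<And>b. b \<in> B - A \<Longrightarrow> q b = 0"
  shows "shannon A q = shannon B q"
  unfolding shannon_def using assms by (intro arg_cong[where f = uminus] sum.mono_neutral_left) auto

lemma shannon_cong: "(\<And>a. a \<in> A \<Longrightarrow> q a = r a) \<Longrightarrow> shannon A q = shannon A r"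
  by (simp add: shannon_def)

lemma entropy_of_superset:
  assumes "finite B" "f ` space M \<subseteq> B"
  shows "entropy_of M f = shannon B (\<lambda>b. measure M (f -` {b} \<inter> space M))"
  unfolding entropy_of_def
proof (rule shannon_superset[OF assms])
  fix b assume "b \<in> B - f ` space M"
  then have "f -` {b} \<inter> space M = {}" by auto
  then show "measure M (f -` {b} \<inter> space M) = 0" by simp
qed

context prob_space
begin

lemma sum_fibres:
  assumes "simple_function M f" "finite B" "f ` space M \<subseteq> B" "E \<in> events"
  shows "(\<Sum>b\<in>B. prob (f -` {b} \<inter> E)) = prob E"
proof -
  have E: "E \<subseteq> space M" using assms(4) sets.sets_into_space by blast
  have m: "f -` {b} \<inter> E \<in> events" for b
  proof -
    have "f -` {b} \<inter> space M \<in> events"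
      by (rule simple_functionD(2)[OF assms(1)])
    then have "(f -` {b} \<inter> space M) \<inter> E \<in> events" using assms(4) by blast
    moreover have "(f -` {b} \<inter> space M) \<inter> E = f -` {b} \<inter> E" using E by auto
    ultimately show ?thesis by simp
  qed
  have "prob (\<Union>b\<in>B. f -` {b} \<inter> E) = (\<Sum>b\<in>B. prob (f -` {b} \<inter> E))"
    using assms(2) m by (intro finite_measure_finite_Union) (auto simp: disjoint_family_on_def)
  moreover have "(\<Union>b\<in>B. f -` {b} \<inter> E) = E" using assms(3) E by auto
  ultimately show ?thesis by simp
qed

text \<open>A fibre of \<open>g\<close> lies inside the fibre of \<open>f\<close> that it meets, so
  on the joint distribution the mass of the former is at most the mass of the latter.\<close>

lemma entropy_of_mono:
  assumes "simple_function M f" "simple_function M g"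
    and det: "\<And>x y. x \<in> space M \<Longrightarrow> y \<in> space M \<Longrightarrow> g x = g y \<Longrightarrow> f x = f y"
  shows "entropy_of M f \<le> entropy_of M g"
proof -
  define A where "A = f ` space M"
  define B where "B = g ` space M"
  have fin: "finite A" "finite B"
    unfolding A_def B_def by (rule simple_functionD(1)[OF assms(1)] simple_functionD(1)[OF assms(2)])+
  let ?p = "\<lambda>a. prob (f -` {a} \<inter> space M)" and ?q = "\<lambda>b. prob (g -` {b} \<inter> space M)"
  let ?r = "\<lambda>a b. prob (g -` {b} \<inter> (f -` {a} \<inter> space M))"
  have fm: "f -` {a} \<inter> space M \<in> events" for a by (rule simple_functionD(2)[OF assms(1)])
  have gm: "g -` {b} \<inter> space M \<in> events" for b by (rule simple_functionD(2)[OF assms(2)])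
  have p: "?p a = (\<Sum>b\<in>B. ?r a b)" for a
    using sum_fibres[OF assms(2) fin(2) _ fm] by (simp add: B_def)
  have q: "?q b = (\<Sum>a\<in>A. ?r a b)" for b
    using sum_fibres[OF assms(1) fin(1) _ gm, of b] by (simp add: A_def Int_left_commute Int_commute)
  have le: "?r a b * ln (?q b) \<le> ?r a b * ln (?p a)" if "a \<in> A" "b \<in> B" for a b
  proof (cases "g -` {b} \<inter> (f -` {a} \<inter> space M) = {}")
    case False
    then obtain x where x: "x \<in> space M" "g x = b" "f x = a" by auto
    have sub: "g -` {b} \<inter> space M \<subseteq> f -` {a} \<inter> space M"
    proof
      fix y assume "y \<in> g -` {b} \<inter> space M"
      then have y: "y \<in> space M" "g y = g x" using x by auto
      show "y \<in> f -` {a} \<inter> space M" using det[OF y(1) x(1) y(2)] x(3) y(1) by simp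
    qed
    then have "g -` {b} \<inter> (f -` {a} \<inter> space M) = g -` {b} \<inter> space M" by auto
    then have "?r a b = ?q b" by simp
    moreover have "?q b \<le> ?p a" using sub fm by (intro finite_measure_mono)
    ultimately show ?thesis
    proof (cases "?q b = 0")
      case False
      assume eq: "?r a b = ?q b" and le: "?q b \<le> ?p a"
      have pos: "0 < ?q b" using False measure_nonneg[of M "g -` {b} \<inter> space M"] by linarith
      then have "ln (?q b) \<le> ln (?p a)" using le by simp
      then show ?thesis unfolding eq using pos by (intro mult_left_mono) auto
    qed simp
  qed simp
  have "(\<Sum>b\<in>B. ?q b * ln (?q b)) = (\<Sum>b\<in>B. \<Sum>a\<in>A. ?r a b * ln (?q b))"
    by (intro sum.cong refl) (metis q sum_distrib_right)
  also have "\<dots> \<le> (\<Sum>b\<in>B. \<Sum>a\<in>A. ?r a b * ln (?p a))" using le by (intro sum_mono)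
  also have "\<dots> = (\<Sum>a\<in>A. \<Sum>b\<in>B. ?r a b * ln (?p a))" by (rule sum.swap)
  also have "\<dots> = (\<Sum>a\<in>A. ?p a * ln (?p a))"
    by (intro sum.cong refl) (metis p sum_distrib_right)
  finally show ?thesis by (simp add: entropy_of_def shannon_def A_def B_def)
qed

lemma entropy_of_cong:
  assumes "simple_function M f" "simple_function M g"
    and "\<And>x y. x \<in> space M \<Longrightarrow> y \<in> space M \<Longrightarrow> f x = f y \<longleftrightarrow> g x = g y"
  shows "entropy_of M f = entropy_of M g"
  using assms by (intro antisym entropy_of_mono) auto

lemma simple_function_pair:
  "simple_function M f \<Longrightarrow> simple_function M g \<Longrightarrow> simple_function M (\<lambda>x. (f x, g x))"
  by (rule simple_function_Pair)

text \<open>Conditional mutual information is nonnegative: apply \<open>ln x \<le> x - 1\<close> to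
  the ratio of \<open>pac a c * pbc b c\<close> to \<open>pc c * p a b c\<close> and
  average.\<close>

lemma entropy_of_submodular:
  assumes "simple_function M f" "simple_function M g" "simple_function M h"
  shows "entropy_of M (\<lambda>x. (f x, g x, h x)) + entropy_of M h
    \<le> entropy_of M (\<lambda>x. (f x, h x)) + entropy_of M (\<lambda>x. (g x, h x))"
proof -
  define A where "A = f ` space M"
  define B where "B = g ` space M"
  define C where "C = h ` space M"
  have fin: "finite A" "finite B" "finite C"
    unfolding A_def B_def C_def
    by (rule simple_functionD(1)[OF assms(1)] simple_functionD(1)[OF assms(2)] simple_functionD(1)[OF assms(3)])+
  define p where "p a b c = prob ((\<lambda>x. (f x, g x, h x)) -` {(a, b, c)} \<inter> space M)" for a b c
  define pac where "pac a c = prob ((\<lambda>x. (f x, h x)) -` {(a, c)} \<inter> space M)" for a c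
  define pbc where "pbc b c = prob ((\<lambda>x. (g x, h x)) -` {(b, c)} \<inter> space M)" for b c
  define pc where "pc c = prob (h -` {c} \<inter> space M)" for c
  have m1: "(\<lambda>x. (f x, h x)) -` {(a, c)} \<inter> space M \<in> events" for a c
    using simple_functionD(2)[OF simple_function_pair[OF assms(1,3)]] .
  have m2: "(\<lambda>x. (g x, h x)) -` {(b, c)} \<inter> space M \<in> events" for b c
    using simple_functionD(2)[OF simple_function_pair[OF assms(2,3)]] .
  have m3: "h -` {c} \<inter> space M \<in> events" for c using simple_functionD(2)[OF assms(3)] .
  have ac: "pac a c = (\<Sum>b\<in>B. p a b c)" for a c
  proof -
    have "g -` {b} \<inter> ((\<lambda>x. (f x, h x)) -` {(a, c)} \<inter> space M) =
      (\<lambda>x. (f x, g x, h x)) -` {(a, b, c)} \<inter> space M" for b by auto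
    then show ?thesis
      unfolding pac_def p_def using sum_fibres[OF assms(2) fin(2) _ m1, of a c] by (simp add: B_def)
  qed
  have bc: "pbc b c = (\<Sum>a\<in>A. p a b c)" for b c
  proof -
    have "f -` {a} \<inter> ((\<lambda>x. (g x, h x)) -` {(b, c)} \<inter> space M) =
      (\<lambda>x. (f x, g x, h x)) -` {(a, b, c)} \<inter> space M" for a by auto
    then show ?thesis
      unfolding pbc_def p_def using sum_fibres[OF assms(1) fin(1) _ m2, of b c] by (simp add: A_def)
  qed
  have c1: "pc c = (\<Sum>a\<in>A. pac a c)" for c
  proof -
    have "f -` {a} \<inter> (h -` {c} \<inter> space M) = (\<lambda>x. (f x, h x)) -` {(a, c)} \<inter> space M" for a by auto
    then show ?thesis
      unfolding pc_def pac_def using sum_fibres[OF assms(1) fin(1) _ m3, of c] by (simp add: A_def)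
  qed
  have c2: "pc c = (\<Sum>b\<in>B. pbc b c)" for c
  proof -
    have "g -` {b} \<inter> (h -` {c} \<inter> space M) = (\<lambda>x. (g x, h x)) -` {(b, c)} \<inter> space M" for b by auto
    then show ?thesis
      unfolding pc_def pbc_def using sum_fibres[OF assms(2) fin(2) _ m3, of c] by (simp add: B_def)
  qed
  have nn: "0 \<le> p a b c" "0 \<le> pac a c" "0 \<le> pbc b c" "0 \<le> pc c" for a b c
    by (auto simp: p_def pac_def pbc_def pc_def)
  have le: "p a b c \<le> pac a c" "p a b c \<le> pbc b c" "pac a c \<le> pc c"
    if "a \<in> A" "b \<in> B" for a b c
    using that fin nn by (auto simp: ac bc c1 intro: member_le_sum)
  have key: "p a b c - pac a c * pbc b c / pc c
      \<le> p a b c * ln (p a b c) + p a b c * ln (pc c) - p a b c * ln (pac a c) - p a b c * ln (pbc b c)"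
    if "a \<in> A" "b \<in> B" for a b c
  proof (cases "p a b c = 0")
    case False
    then have pos: "0 < p a b c" "0 < pac a c" "0 < pbc b c" "0 < pc c"
      using nn le[OF that, of c] by (smt (verit))+
    have "ln (pac a c * pbc b c / (pc c * p a b c)) \<le> pac a c * pbc b c / (pc c * p a b c) - 1"
      using pos by (intro ln_le_minus_one) auto
    then have "ln (pac a c) + ln (pbc b c) - ln (pc c) - ln (p a b c) \<le> pac a c * pbc b c / (pc c * p a b c) - 1"
      using pos by (simp add: ln_mult ln_div)
    then have "p a b c * (ln (pac a c) + ln (pbc b c) - ln (pc c) - ln (p a b c)) \<le>
      p a b c * (pac a c * pbc b c / (pc c * p a b c) - 1)" using pos by (intro mult_left_mono) auto
    also have "\<dots> = pac a c * pbc b c / pc c - p a b c" using pos by (simp add: field_simps)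
    finally show ?thesis by (simp add: algebra_simps)
  qed (use nn in auto)
  \<comment> \<open>The conditionally independent masses have the same total as \<open>p\<close>; a
    cell with \<open>pc c = 0\<close> is consistent with this because
    \<open>x / 0 = 0\<close>.\<close>
  have "(\<Sum>c\<in>C. \<Sum>a\<in>A. \<Sum>b\<in>B. pac a c * pbc b c / pc c) = (\<Sum>c\<in>C. pc c * pc c / pc c)"
    by (intro sum.cong refl) (simp add: sum_product[symmetric] sum_divide_distrib[symmetric] c1[symmetric] c2[symmetric])
  also have "\<dots> = (\<Sum>c\<in>C. \<Sum>a\<in>A. \<Sum>b\<in>B. p a b c)"
    by (intro sum.cong refl) (simp add: c1 ac)
  finally have "0 = (\<Sum>c\<in>C. \<Sum>a\<in>A. \<Sum>b\<in>B. p a b c - pac a c * pbc b c / pc c)"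
    by (simp add: sum_subtractf)
  also have "\<dots> \<le> (\<Sum>c\<in>C. \<Sum>a\<in>A. \<Sum>b\<in>B. p a b c * ln (p a b c) + p a b c * ln (pc c)
      - p a b c * ln (pac a c) - p a b c * ln (pbc b c))"
    using key by (intro sum_mono)
  also have "\<dots> = (\<Sum>c\<in>C. \<Sum>a\<in>A. \<Sum>b\<in>B. p a b c * ln (p a b c)) + (\<Sum>c\<in>C. \<Sum>a\<in>A. \<Sum>b\<in>B. p a b c * ln (pc c))
      - (\<Sum>c\<in>C. \<Sum>a\<in>A. \<Sum>b\<in>B. p a b c * ln (pac a c)) - (\<Sum>c\<in>C. \<Sum>a\<in>A. \<Sum>b\<in>B. p a b c * ln (pbc b c))"
    by (simp add: sum.distrib sum_subtractf)
  also have "(\<Sum>c\<in>C. \<Sum>a\<in>A. \<Sum>b\<in>B. p a b c * ln (pc c)) = (\<Sum>c\<in>C. pc c * ln (pc c))"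
    by (simp add: c1 ac sum_distrib_right)
  also have "(\<Sum>c\<in>C. \<Sum>a\<in>A. \<Sum>b\<in>B. p a b c * ln (pac a c)) = (\<Sum>c\<in>C. \<Sum>a\<in>A. pac a c * ln (pac a c))"
    by (simp add: ac sum_distrib_right)
  also have "(\<Sum>c\<in>C. \<Sum>a\<in>A. \<Sum>b\<in>B. p a b c * ln (pbc b c)) = (\<Sum>c\<in>C. \<Sum>b\<in>B. pbc b c * ln (pbc b c))"
  proof (intro sum.cong refl)
    fix c
    have "(\<Sum>a\<in>A. \<Sum>b\<in>B. p a b c * ln (pbc b c)) = (\<Sum>b\<in>B. \<Sum>a\<in>A. p a b c * ln (pbc b c))"
      by (rule sum.swap)
    also have "\<dots> = (\<Sum>b\<in>B. pbc b c * ln (pbc b c))" by (simp add: bc sum_distrib_right)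
    finally show "(\<Sum>a\<in>A. \<Sum>b\<in>B. p a b c * ln (pbc b c)) = (\<Sum>b\<in>B. pbc b c * ln (pbc b c))" .
  qed
  finally have main: "(\<Sum>c\<in>C. \<Sum>a\<in>A. pac a c * ln (pac a c)) + (\<Sum>c\<in>C. \<Sum>b\<in>B. pbc b c * ln (pbc b c))
    \<le> (\<Sum>c\<in>C. \<Sum>a\<in>A. \<Sum>b\<in>B. p a b c * ln (p a b c)) + (\<Sum>c\<in>C. pc c * ln (pc c))" by simp
  have "entropy_of M (\<lambda>x. (f x, g x, h x)) = - (\<Sum>c\<in>C. \<Sum>a\<in>A. \<Sum>b\<in>B. p a b c * ln (p a b c))"
  proof -
    have "entropy_of M (\<lambda>x. (f x, g x, h x)) = shannon (A \<times> B \<times> C) (\<lambda>(a, b, c). p a b c)"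
      using fin by (subst entropy_of_superset[of "A \<times> B \<times> C"])
        (auto simp: A_def B_def C_def p_def intro!: shannon_cong)
    also have "\<dots> = - (\<Sum>a\<in>A. \<Sum>b\<in>B. \<Sum>c\<in>C. p a b c * ln (p a b c))"
      by (simp add: shannon_def sum.cartesian_product split_def)
    also have "(\<Sum>a\<in>A. \<Sum>b\<in>B. \<Sum>c\<in>C. p a b c * ln (p a b c)) = (\<Sum>a\<in>A. \<Sum>c\<in>C. \<Sum>b\<in>B. p a b c * ln (p a b c))"
      by (intro sum.cong refl sum.swap)
    also have "\<dots> = (\<Sum>c\<in>C. \<Sum>a\<in>A. \<Sum>b\<in>B. p a b c * ln (p a b c))" by (rule sum.swap)
    finally show ?thesis .
  qed
  moreover have "entropy_of M (\<lambda>x. (f x, h x)) = - (\<Sum>c\<in>C. \<Sum>a\<in>A. pac a c * ln (pac a c))"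
  proof -
    have "entropy_of M (\<lambda>x. (f x, h x)) = shannon (A \<times> C) (\<lambda>(a, c). pac a c)"
      using fin by (subst entropy_of_superset[of "A \<times> C"])
        (auto simp: A_def C_def pac_def intro!: shannon_cong)
    also have "\<dots> = - (\<Sum>a\<in>A. \<Sum>c\<in>C. pac a c * ln (pac a c))"
      by (simp add: shannon_def sum.cartesian_product split_def)
    also have "(\<Sum>a\<in>A. \<Sum>c\<in>C. pac a c * ln (pac a c)) = (\<Sum>c\<in>C. \<Sum>a\<in>A. pac a c * ln (pac a c))"
      by (rule sum.swap)
    finally show ?thesis .
  qed
  moreover have "entropy_of M (\<lambda>x. (g x, h x)) = - (\<Sum>c\<in>C. \<Sum>b\<in>B. pbc b c * ln (pbc b c))"
  proof -
    have "entropy_of M (\<lambda>x. (g x, h x)) = shannon (B \<times> C) (\<lambda>(b, c). pbc b c)"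
      using fin by (subst entropy_of_superset[of "B \<times> C"])
        (auto simp: B_def C_def pbc_def intro!: shannon_cong)
    also have "\<dots> = - (\<Sum>b\<in>B. \<Sum>c\<in>C. pbc b c * ln (pbc b c))"
      by (simp add: shannon_def sum.cartesian_product split_def)
    also have "(\<Sum>b\<in>B. \<Sum>c\<in>C. pbc b c * ln (pbc b c)) = (\<Sum>c\<in>C. \<Sum>b\<in>B. pbc b c * ln (pbc b c))"
      by (rule sum.swap)
    finally show ?thesis .
  qed
  moreover have "entropy_of M h = - (\<Sum>c\<in>C. pc c * ln (pc c))"
    by (simp add: entropy_of_def shannon_def C_def pc_def)
  ultimately show ?thesis using main by simp
qed

lemma entropy_of_nonneg: "0 \<le> entropy_of M f"
proof -
  have "(\<Sum>b\<in>f ` space M. prob (f -` {b} \<inter> space M) * ln (prob (f -` {b} \<inter> space M))) \<le> 0"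
  proof (intro sum_nonpos)
    fix b
    have "ln (prob (f -` {b} \<inter> space M)) \<le> 0 \<or> prob (f -` {b} \<inter> space M) = 0"
      using prob_le_1 measure_nonneg by (metis less_eq_real_def ln_le_zero_iff)
    then show "prob (f -` {b} \<inter> space M) * ln (prob (f -` {b} \<inter> space M)) \<le> 0"
      by (auto intro: mult_nonneg_nonpos)
  qed
  then show ?thesis by (simp add: entropy_of_def shannon_def)
qed

text \<open>Submodularity with a constant third function.\<close>

lemma entropy_of_subadditive:
  assumes "simple_function M f" "simple_function M g"
  shows "entropy_of M (\<lambda>x. (f x, g x)) \<le> entropy_of M f + entropy_of M g"
proof -
  have h: "simple_function M (\<lambda>x. ())" by simp
  have "entropy_of M (\<lambda>x. (f x, g x)) = entropy_of M (\<lambda>x. (f x, g x, ()))"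
    using assms by (intro entropy_of_cong simple_function_pair) auto
  moreover have "entropy_of M f = entropy_of M (\<lambda>x. (f x, ()))"
    using assms by (intro entropy_of_cong simple_function_pair) auto
  moreover have "entropy_of M g = entropy_of M (\<lambda>x. (g x, ()))"
    using assms by (intro entropy_of_cong simple_function_pair) auto
  ultimately show ?thesis
    using entropy_of_submodular[OF assms h] entropy_of_nonneg[of "\<lambda>x. ()"] by linarith
qed

text \<open>\<open>H(f, g | h, k) \<le> H(f | h) + H(g | k)\<close>, without conditional entropies.\<close>

lemma entropy_of_conditional_subadditive:
  assumes "simple_function M f" "simple_function M g" "simple_function M h" "simple_function M k"
  shows "entropy_of M (\<lambda>x. (f x, g x, h x, k x)) + entropy_of M h + entropy_of M k
    \<le> entropy_of M (\<lambda>x. (f x, h x)) + entropy_of M (\<lambda>x. (g x, k x)) + entropy_of M (\<lambda>x. (h x, k x))"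
proof -
  note sf = assms simple_function_pair
  have "entropy_of M (\<lambda>x. (f x, g x, h x, k x)) + entropy_of M (\<lambda>x. (h x, k x))
    \<le> entropy_of M (\<lambda>x. (f x, h x, k x)) + entropy_of M (\<lambda>x. (g x, h x, k x))"
    using entropy_of_submodular[of f g "\<lambda>x. (h x, k x)"] sf by blast
  moreover have "entropy_of M (\<lambda>x. (f x, k x, h x)) + entropy_of M h
    \<le> entropy_of M (\<lambda>x. (f x, h x)) + entropy_of M (\<lambda>x. (k x, h x))"
    using entropy_of_submodular[of f k h] sf by blast
  moreover have "entropy_of M (\<lambda>x. (g x, h x, k x)) + entropy_of M k
    \<le> entropy_of M (\<lambda>x. (g x, k x)) + entropy_of M (\<lambda>x. (h x, k x))"
    using entropy_of_submodular[of g h k] sf by blast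
  moreover have "entropy_of M (\<lambda>x. (f x, k x, h x)) = entropy_of M (\<lambda>x. (f x, h x, k x))"
    by (intro entropy_of_cong sf) auto
  moreover have "entropy_of M (\<lambda>x. (k x, h x)) = entropy_of M (\<lambda>x. (h x, k x))"
    by (intro entropy_of_cong sf) auto
  ultimately show ?thesis by linarith
qed

lemma simple_function_map:
  assumes "\<And>i. i \<in> set is \<Longrightarrow> simple_function M (f i)"
  shows "simple_function M (\<lambda>x. map (\<lambda>i. f i x) is)"
  using assms
proof (induction "is")
  case (Cons i "is")
  have "simple_function M ((\<lambda>(a, l). a # l) \<circ> (\<lambda>x. (f i x, map (\<lambda>i. f i x) is)))"
    using Cons by (intro simple_function_compose simple_function_pair) auto
  then show ?case by (simp add: comp_def)
qed simp

end

lemma fekete: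
  fixes a :: "nat \<Rightarrow> real"
  assumes "\<And>m n. a (m + n) \<le> a m + a n" "\<And>n. 0 \<le> a n"
  obtains L where "(\<lambda>n. a n / real n) \<longlonglongrightarrow> L" "\<And>n. n > 0 \<Longrightarrow> L \<le> a n / real n"
proof -
  define L where "L = (INF n\<in>{0<..}. a n / real n)"
  have bdd: "bdd_below ((\<lambda>n. a n / real n) ` {0<..})"
    using assms(2) by (intro bdd_belowI[of _ 0]) auto
  have lower: "L \<le> a n / real n" if "n > 0" for n
    unfolding L_def using that bdd by (intro cINF_lower) auto
  have mult: "a (q * k + r) \<le> real q * a k + real r * a 1 + a 0" for q k r
  proof (induction q)
    case 0
    show ?case
    proof (induction r)
      case (Suc r)
      then show ?case using assms(1)[of r 1] by (simp add: algebra_simps)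
    qed simp
  next
    case (Suc q)
    then show ?case using assms(1)[of k "q * k + r"] by (simp add: algebra_simps)
  qed
  have "(\<lambda>n. a n / real n) \<longlonglongrightarrow> L"
  proof (rule LIMSEQ_I)
    fix e :: real assume e: "e > 0"
    have "\<exists>n\<in>{0<..}. a n / real n < L + e / 2"
      unfolding L_def using e bdd by (subst cINF_less_iff[symmetric]) auto
    then obtain k where k: "k > 0" "a k / real k < L + e / 2" by auto
    define C where "C = real k * a 1 + a 0"
    have C: "C \<ge> 0" using assms(2) by (simp add: C_def)
    obtain N where N: "real N > 2 * C / e" using reals_Archimedean2 by blast
    show "\<exists>no. \<forall>n\<ge>no. norm (a n / real n - L) < e"
    proof (intro exI[of _ "Suc N"] allI impI)
      fix n assume n: "n \<ge> Suc N"
      have "a n \<le> real (n div k) * a k + real (n mod k) * a 1 + a 0"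
        using mult[of "n div k" k "n mod k"] by simp
      also have "\<dots> \<le> real n / real k * a k + C"
      proof -
        have "real (n div k) \<le> real n / real k" by (rule of_nat_div_le_of_nat)
        moreover have "real (n mod k) \<le> real k" using k by (simp add: less_imp_le)
        ultimately show ?thesis unfolding C_def using assms(2)
          by (smt (verit) mult_right_mono)
      qed
      finally have "a n / real n \<le> (real n / real k * a k + C) / real n"
        by (intro divide_right_mono) auto
      also have "\<dots> = a k / real k + C / real n" using n by (simp add: add_divide_distrib)
      also have "C / real n < e / 2"
      proof -
        have "2 * C / e < real n" using N n by linarith
        then show ?thesis using e n by (simp add: field_simps)
      qed
      finally have "a n / real n < L + e" using k by linarith
      then show "norm (a n / real n - L) < e" using lower[of n] n by auto
    qed
  qed
  then show ?thesis using that lower by blast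
qed

section \<open>Partitions and itineraries\<close>

lemma partition_entropy_eq:
  "partition_entropy M ((\<lambda>b. f -` {b} \<inter> space M) ` (f ` space M)) = entropy_of M f"
proof -
  have "inj_on (\<lambda>b. f -` {b} \<inter> space M) (f ` space M)"
    by (intro inj_onI) blast
  then show ?thesis
    by (simp add: partition_entropy_def entropy_of_def shannon_def sum.reindex)
qed

text \<open>Turns a partition into the function that has its cells as fibres.\<close>

definition cell_of :: "'a set set \<Rightarrow> 'a \<Rightarrow> 'a set" where
  "cell_of P x = (THE A. A \<in> P \<and> x \<in> A)"

lemma cell_of_eq:
  assumes "partition_on S P" "A \<in> P" "x \<in> A"
  shows "cell_of P x = A"
  unfolding cell_of_def
proof (rule the_equality)
  show "A \<in> P \<and> x \<in> A" using assms by simp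
  show "B = A" if "B \<in> P \<and> x \<in> B" for B
    using that assms(2,3) partition_onD2[OF assms(1)] by (auto simp: disjoint_def)
qed

lemma cell_of_in:
  assumes "partition_on S P" "x \<in> S"
  shows "cell_of P x \<in> P" "x \<in> cell_of P x"
proof -
  obtain A where "A \<in> P" "x \<in> A" using assms by (auto simp: partition_on_def)
  then show "cell_of P x \<in> P" "x \<in> cell_of P x" using cell_of_eq[OF assms(1)] by auto
qed

lemma cell_of_iff:
  assumes "partition_on S P" "x \<in> S" "A \<in> P"
  shows "cell_of P x = A \<longleftrightarrow> x \<in> A"
  using cell_of_in[OF assms(1,2)] cell_of_eq[OF assms(1,3)] by metis

lemma simple_function_cell_of:
  assumes "finite P" "P \<subseteq> sets M" "partition_on (space M) P"
  shows "simple_function M (cell_of P)"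
  unfolding simple_function_def
proof (intro conjI ballI)
  have "cell_of P ` space M \<subseteq> P" using cell_of_in[OF assms(3)] by auto
  then show "finite (cell_of P ` space M)" using assms(1) finite_subset by blast
  fix A assume "A \<in> cell_of P ` space M"
  then have A: "A \<in> P" using cell_of_in[OF assms(3)] by auto
  have "cell_of P -` {A} \<inter> space M = A"
  proof (intro set_eqI iffI)
    fix x assume "x \<in> cell_of P -` {A} \<inter> space M"
    then show "x \<in> A" using cell_of_in(2)[OF assms(3), of x] by auto
  next
    fix x assume x: "x \<in> A"
    then have "x \<in> space M" using A partition_onD1[OF assms(3)] by blast
    then show "x \<in> cell_of P -` {A} \<inter> space M" using cell_of_eq[OF assms(3) A x] by simp
  qed
  then show "cell_of P -` {A} \<inter> space M \<in> sets M" using A assms(2) by auto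
qed

definition itinerary :: "('a \<Rightarrow> 'b) \<Rightarrow> ('a \<Rightarrow> 'a) \<Rightarrow> nat \<Rightarrow> 'a \<Rightarrow> 'b list" where
  "itinerary f T n x = map (\<lambda>i. f ((T ^^ i) x)) [0..<n]"

lemma length_itinerary [simp]: "length (itinerary f T n x) = n"
  by (simp add: itinerary_def)

lemma itinerary_eq_iff:
  "itinerary f T n x = itinerary g T n y \<longleftrightarrow> (\<forall>i<n. f ((T ^^ i) x) = g ((T ^^ i) y))"
  by (auto simp: itinerary_def)

lemma itinerary_add: "itinerary f T (m + n) x = itinerary f T m x @ itinerary f T n ((T ^^ m) x)"
proof (rule nth_equalityI)
  have "(T ^^ i) ((T ^^ m) x) = (T ^^ (m + i)) x" for i
    by (metis add.commute comp_apply funpow_add)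
  then show "itinerary f T (m + n) x ! i = (itinerary f T m x @ itinerary f T n ((T ^^ m) x)) ! i"
    if "i < length (itinerary f T (m + n) x)" for i
    using that by (auto simp: itinerary_def nth_append)
qed simp

lemma funpow_space:
  assumes "T \<in> S \<rightarrow> S" "x \<in> S" shows "(T ^^ i) x \<in> S"
  using assms by (induction i) auto

text \<open>Two points share a cell of the join exactly if they visit the same cells of
  \<open>P\<close> up to time \<open>n\<close>. For \<open>n = 0\<close> the empty common refinement
  is \<open>{UNIV}\<close>, which need not partition \<open>space M\<close>.\<close>

lemma iterated_join_itinerary:
  assumes P: "partition_on (space M) P" and T: "T \<in> space M \<rightarrow> space M" and n: "n > 0"
  shows "iterated_join M T P n = (\<lambda>b. itinerary (cell_of P) T n -` {b} \<inter> space M) ` (itinerary (cell_of P) T n ` space M)"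
    (is "_ = (\<lambda>b. ?F -` {b} \<inter> space M) ` _")
proof -
  define R where "R i = (\<lambda>A. (T ^^ i) -` A \<inter> space M) ` P" for i
  have cell: "?F -` {?F x} \<inter> space M = (\<Inter>i<n. (T ^^ i) -` cell_of P ((T ^^ i) x) \<inter> space M)"
    if x: "x \<in> space M" for x
  proof -
    have "y \<in> ?F -` {?F x} \<longleftrightarrow> (\<forall>i<n. (T ^^ i) y \<in> cell_of P ((T ^^ i) x))" if y: "y \<in> space M" for y
    proof -
      have "cell_of P ((T ^^ i) y) = cell_of P ((T ^^ i) x) \<longleftrightarrow> (T ^^ i) y \<in> cell_of P ((T ^^ i) x)" for i
        by (rule cell_of_iff[OF P funpow_space[OF T y] cell_of_in(1)[OF P funpow_space[OF T x]]])
      then show ?thesis by (simp add: itinerary_eq_iff)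
    qed
    then show ?thesis using n by auto
  qed
  have ij: "iterated_join M T P n = (\<Union>f \<in> (\<Pi> Q\<in>R ` {..<n}. Q). {\<Inter> (f ` R ` {..<n})}) - {{}}"
    by (simp add: iterated_join_def common_refinement R_def)
  show ?thesis
  proof (intro set_eqI iffI)
    fix C assume "C \<in> iterated_join M T P n"
    then obtain f where f: "f \<in> (\<Pi> Q\<in>R ` {..<n}. Q)" "C = \<Inter> (f ` R ` {..<n})" "C \<noteq> {}"
      unfolding ij by blast
    then obtain x where x: "x \<in> C" by auto
    have fi: "\<exists>A\<in>P. f (R i) = (T ^^ i) -` A \<inter> space M" if "i < n" for i
    proof -
      have "f (R i) \<in> R i" using f(1) that by auto
      moreover have "\<forall>C\<in>R i. \<exists>A\<in>P. C = (T ^^ i) -` A \<inter> space M" by (auto simp: R_def)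
      ultimately show ?thesis by blast
    qed
    have xS: "x \<in> space M"
    proof -
      have "x \<in> f (R 0)" using x f(2) n by auto
      then show ?thesis using fi[OF n] by auto
    qed
    have "f (R i) = (T ^^ i) -` cell_of P ((T ^^ i) x) \<inter> space M" if i: "i < n" for i
    proof -
      obtain A where A: "A \<in> P" "f (R i) = (T ^^ i) -` A \<inter> space M" using fi[OF i] by auto
      have "x \<in> f (R i)" using x f(2) i by auto
      then have "cell_of P ((T ^^ i) x) = A" using A cell_of_eq[OF P] by auto
      then show ?thesis using A by simp
    qed
    then have "C = ?F -` {?F x} \<inter> space M" unfolding cell[OF xS] f(2) by auto
    then show "C \<in> (\<lambda>b. ?F -` {b} \<inter> space M) ` (?F ` space M)" using xS by blast
  next
    fix C assume "C \<in> (\<lambda>b. ?F -` {b} \<inter> space M) ` (?F ` space M)"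
    then obtain x where x: "x \<in> space M" "C = ?F -` {?F x} \<inter> space M" by auto
    \<comment> \<open>The choice has to be a function of the partition, not of the time
      \<open>i\<close>, because equal pullbacks at different times are one element of the
      family.\<close>
    define f where "f Q = (THE B. B \<in> Q \<and> x \<in> B)" for Q :: "'a set set"
    have f: "f (R i) = (T ^^ i) -` cell_of P ((T ^^ i) x) \<inter> space M" for i
      unfolding f_def
    proof (rule the_equality)
      show "(T ^^ i) -` cell_of P ((T ^^ i) x) \<inter> space M \<in> R i \<and> x \<in> (T ^^ i) -` cell_of P ((T ^^ i) x) \<inter> space M"
        using cell_of_in[OF P funpow_space[OF T x(1)]] x(1) by (auto simp: R_def)
      fix B assume "B \<in> R i \<and> x \<in> B"
      then obtain A where "A \<in> P" "B = (T ^^ i) -` A \<inter> space M" "(T ^^ i) x \<in> A" by (auto simp: R_def)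
      then show "B = (T ^^ i) -` cell_of P ((T ^^ i) x) \<inter> space M" using cell_of_eq[OF P] by simp
    qed
    have "f \<in> (\<Pi> Q\<in>R ` {..<n}. Q)"
      using cell_of_in(1)[OF P funpow_space[OF T x(1)]] by (auto simp: f) (auto simp: R_def)
    moreover have "C = \<Inter> (f ` R ` {..<n})" unfolding x(2) cell[OF x(1)] by (simp add: f image_image)
    moreover have "C \<noteq> {}" using x by auto
    ultimately show "C \<in> iterated_join M T P n" unfolding ij by blast
  qed
qed

lemma entropy_wrt_partition_itinerary:
  assumes "partition_on (space M) P" "T \<in> space M \<rightarrow> space M"
    "(\<lambda>n. entropy_of M (itinerary (cell_of P) T n) / real n) \<longlonglongrightarrow> L"
  shows "entropy_wrt_partition M T P = L"
  unfolding entropy_wrt_partition_def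
proof (rule limI)
  have "\<forall>\<^sub>F n in sequentially. entropy_of M (itinerary (cell_of P) T n) / real n =
      partition_entropy M (iterated_join M T P n) / real n"
    using eventually_gt_at_top[of 0]
    by eventually_elim (simp add: iterated_join_itinerary[OF assms(1,2)] partition_entropy_eq)
  then show "(\<lambda>n. partition_entropy M (iterated_join M T P n) / real n) \<longlonglongrightarrow> L"
    using assms(3) by (rule Lim_transform_eventually[rotated])
qed

section \<open>Probability measure preserving transformations\<close>

locale pmpt = prob_space M for M :: "'a measure" +
  fixes T :: "'a \<Rightarrow> 'a"
  assumes T_meas [measurable]: "T \<in> measurable M M" and T_inv: "distr M M T = M"
begin

lemma T_space: "T \<in> space M \<rightarrow> space M"
  using measurable_space[OF T_meas] by auto

lemma funpow_meas: "T ^^ i \<in> measurable M M"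
  by (induction i) (auto intro: measurable_comp)

lemma prob_T:
  assumes "A \<in> events" shows "prob (T -` A \<inter> space M) = prob A"
  using measure_distr[OF T_meas assms] T_inv by simp

lemma prob_funpow:
  assumes "A \<in> events" shows "prob ((T ^^ i) -` A \<inter> space M) = prob A"
proof (induction i)
  case 0
  then show ?case using sets.sets_into_space[OF assms] by (simp add: Int_absorb2)
next
  case (Suc i)
  have "(T ^^ Suc i) -` A \<inter> space M = T -` ((T ^^ i) -` A \<inter> space M) \<inter> space M"
    using T_space by (auto simp: funpow_Suc_right simp del: funpow.simps)
  then show ?case using prob_T[OF measurable_sets[OF funpow_meas assms]] Suc by (simp del: funpow.simps)
qed

lemma simple_function_funpow:
  assumes "simple_function M f" shows "simple_function M (\<lambda>x. f ((T ^^ i) x))"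
  unfolding simple_function_def
proof (intro conjI ballI)
  have S: "(T ^^ i) x \<in> space M" if "x \<in> space M" for x using funpow_space[OF T_space that] .
  then show "finite ((\<lambda>x. f ((T ^^ i) x)) ` space M)"
    using simple_functionD(1)[OF assms] by (auto intro: finite_subset[of _ "f ` space M"])
  fix b
  have "(\<lambda>x. f ((T ^^ i) x)) -` {b} \<inter> space M = (T ^^ i) -` (f -` {b} \<inter> space M) \<inter> space M"
    using S by auto
  then show "(\<lambda>x. f ((T ^^ i) x)) -` {b} \<inter> space M \<in> events"
    using measurable_sets[OF funpow_meas simple_functionD(2)[OF assms]] by simp
qed

lemma simple_function_itinerary:
  "simple_function M f \<Longrightarrow> simple_function M (itinerary f T n)"
  unfolding itinerary_def[abs_def] by (intro simple_function_map simple_function_funpow)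

lemma entropy_of_funpow:
  assumes "simple_function M f"
  shows "entropy_of M (\<lambda>x. f ((T ^^ i) x)) = entropy_of M f"
proof -
  have S: "(T ^^ i) x \<in> space M" if "x \<in> space M" for x using funpow_space[OF T_space that] .
  have "entropy_of M (\<lambda>x. f ((T ^^ i) x)) =
    shannon (f ` space M) (\<lambda>b. prob ((\<lambda>x. f ((T ^^ i) x)) -` {b} \<inter> space M))"
    using S simple_functionD(1)[OF assms] by (intro entropy_of_superset) auto
  also have "\<dots> = entropy_of M f" unfolding entropy_of_def
  proof (rule shannon_cong)
    fix b
    have "(\<lambda>x. f ((T ^^ i) x)) -` {b} \<inter> space M = (T ^^ i) -` (f -` {b} \<inter> space M) \<inter> space M"
      using S by auto
    then show "prob ((\<lambda>x. f ((T ^^ i) x)) -` {b} \<inter> space M) = prob (f -` {b} \<inter> space M)"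
      using prob_funpow[OF simple_functionD(2)[OF assms]] by simp
  qed
  finally show ?thesis .
qed

lemma entropy_of_itinerary_add:
  assumes "simple_function M f"
  shows "entropy_of M (itinerary f T (m + n)) \<le> entropy_of M (itinerary f T m) + entropy_of M (itinerary f T n)"
proof -
  note sf = simple_function_itinerary[OF assms]
  have "entropy_of M (itinerary f T (m + n)) =
    entropy_of M (\<lambda>x. (itinerary f T m x, itinerary f T n ((T ^^ m) x)))"
    by (intro entropy_of_cong simple_function_pair simple_function_funpow[of "itinerary f T n"] sf)
      (auto simp: itinerary_add)
  also have "\<dots> \<le> entropy_of M (itinerary f T m) + entropy_of M (\<lambda>x. itinerary f T n ((T ^^ m) x))"
    by (intro entropy_of_subadditive simple_function_funpow[of "itinerary f T n"] sf)
  also have "entropy_of M (\<lambda>x. itinerary f T n ((T ^^ m) x)) = entropy_of M (itinerary f T n)"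
    by (rule entropy_of_funpow[OF sf])
  finally show ?thesis .
qed

lemma entropy_rate:
  assumes "simple_function M f"
  obtains L where "(\<lambda>n. entropy_of M (itinerary f T n) / real n) \<longlonglongrightarrow> L"
    "\<And>n. n > 0 \<Longrightarrow> L \<le> entropy_of M (itinerary f T n) / real n"
  by (rule fekete[of "\<lambda>n. entropy_of M (itinerary f T n)"])
    (use entropy_of_itinerary_add[OF assms] entropy_of_nonneg that in auto)

text \<open>The estimate \<open>h(f) \<le> h(g) + H(f | g)\<close>, with the conditional entropy
  written as a difference. By conditional subadditivity each time step adds at most
  \<open>H(f | g)\<close>, which invariance makes independent of the time.\<close>

lemma entropy_of_itinerary_le:
  assumes "simple_function M f" "simple_function M g"
  shows "entropy_of M (itinerary f T n) \<le>
    entropy_of M (itinerary g T n) + real n * (entropy_of M (\<lambda>x. (f x, g x)) - entropy_of M g)"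
proof -
  note sf = simple_function_itinerary[OF assms(1)] simple_function_itinerary[OF assms(2)]
    simple_function_funpow[OF assms(1)] simple_function_funpow[OF assms(2)]
  let ?c = "entropy_of M (\<lambda>x. (f x, g x)) - entropy_of M g"
  have "entropy_of M (\<lambda>x. (itinerary f T n x, itinerary g T n x)) \<le> entropy_of M (itinerary g T n) + real n * ?c"
  proof (induction n)
    case 0
    have "entropy_of M (\<lambda>x. (itinerary f T 0 x, itinerary g T 0 x)) = entropy_of M (itinerary g T 0)"
      by (intro entropy_of_cong simple_function_pair sf) (auto simp: itinerary_def)
    then show ?case by simp
  next
    case (Suc n)

    have "entropy_of M (\<lambda>x. (itinerary f T (Suc n) x, itinerary g T (Suc n) x)) =
      entropy_of M (\<lambda>x. (itinerary f T n x, f ((T ^^ n) x), itinerary g T n x, g ((T ^^ n) x)))"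
      by (intro entropy_of_cong simple_function_pair sf) (auto simp: itinerary_def)
    moreover have "entropy_of M (\<lambda>x. (itinerary f T n x, f ((T ^^ n) x), itinerary g T n x, g ((T ^^ n) x)))
      + entropy_of M (itinerary g T n) + entropy_of M (\<lambda>x. g ((T ^^ n) x)) \<le>
      entropy_of M (\<lambda>x. (itinerary f T n x, itinerary g T n x)) + entropy_of M (\<lambda>x. (f ((T ^^ n) x), g ((T ^^ n) x)))
      + entropy_of M (\<lambda>x. (itinerary g T n x, g ((T ^^ n) x)))"
      by (intro entropy_of_conditional_subadditive sf)
    moreover have "entropy_of M (\<lambda>x. (itinerary g T n x, g ((T ^^ n) x))) = entropy_of M (itinerary g T (Suc n))"
      by (intro entropy_of_cong simple_function_pair sf) (auto simp: itinerary_def)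
    moreover have "entropy_of M (\<lambda>x. g ((T ^^ n) x)) = entropy_of M g"
      by (rule entropy_of_funpow[OF assms(2)])
    moreover have "entropy_of M (\<lambda>x. (f ((T ^^ n) x), g ((T ^^ n) x))) = entropy_of M (\<lambda>x. (f x, g x))"
      using entropy_of_funpow[OF simple_function_pair[OF assms]] .
    ultimately show ?case using Suc by (simp add: algebra_simps)
  qed
  moreover have "entropy_of M (itinerary f T n) \<le> entropy_of M (\<lambda>x. (itinerary f T n x, itinerary g T n x))"
    by (intro entropy_of_mono simple_function_pair sf) auto
  ultimately show ?thesis by linarith
qed

end

section \<open>Cylinders and Borel sets\<close>

lemma pre_eq_mono: "pre x n = pre y n \<Longrightarrow> m \<le> n \<Longrightarrow> pre x m = pre y m"
  by (metis min.absorb1 take_pre)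

lemma open_prefix:
  assumes "open U" "x \<in> U"
  obtains k where "\<And>y :: nat \<Rightarrow> nat. pre y k = pre x k \<Longrightarrow> y \<in> U"
proof -
  obtain V where V: "finite {i. V i \<noteq> UNIV}" "x \<in> Pi\<^sub>E UNIV V" "Pi\<^sub>E UNIV V \<subseteq> U"
    using assms unfolding open_fun_def openin_product_topology_alt by auto
  obtain k where k: "\<And>i. V i \<noteq> UNIV \<Longrightarrow> i < k"
    using V(1) finite_nat_set_iff_bounded by auto
  have "y \<in> U" if eq: "pre y k = pre x k" for y
  proof -
    have "y i \<in> V i" for i
    proof (cases "V i = UNIV")
      case False
      then have "y i = x i" using k[of i] eq nth_pre[of i k x] nth_pre[of i k y] by simp
      then show ?thesis using V(2) by auto
    qed simp
    then show ?thesis using V(3) by auto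
  qed
  then show ?thesis using that by blast
qed

lemma open_prefix_set: "open {x :: nat \<Rightarrow> nat. pre x n \<in> S}"
proof -
  have "open {x :: nat \<Rightarrow> nat. x i = c}" for i c
  proof -
    have "open ((\<lambda>x :: nat \<Rightarrow> nat. x i) -` {c})"
      by (rule open_vimage) (rule Topological_Spaces.open_discrete, rule continuous_on_product_coordinates)
    then show ?thesis by (simp add: vimage_def)
  qed
  then have "open (\<Inter>i\<in>{..<n}. {x :: nat \<Rightarrow> nat. x i = w ! i})" for w :: "nat list" by (intro open_INT) auto
  then have "open {x :: nat \<Rightarrow> nat. pre x n = w}" for w
  proof (cases "length w = n")
    case True
    then have "{x :: nat \<Rightarrow> nat. pre x n = w} = (\<Inter>i\<in>{..<n}. {x. x i = w ! i})"
      by (auto simp: list_eq_iff_nth_eq nth_pre)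
    then show ?thesis using \<open>\<And>w. open (\<Inter>i\<in>{..<n}. {x :: nat \<Rightarrow> nat. x i = w ! i})\<close> by simp
  next
    case False
    then have "{x :: nat \<Rightarrow> nat. pre x n = w} = {}" by auto
    then show ?thesis by simp
  qed
  then have "open (\<Union>w\<in>S. {x :: nat \<Rightarrow> nat. pre x n = w})" by auto
  moreover have "(\<Union>w\<in>S. {x :: nat \<Rightarrow> nat. pre x n = w}) = {x. pre x n \<in> S}" by auto
  ultimately show ?thesis by simp
qed

lemma sets_prefix: "{x \<in> X. pre x n \<in> S} \<in> sets (restrict_space borel X)"
proof -
  have "{x \<in> X. pre x n \<in> S} = X \<inter> {x. pre x n \<in> S}" by auto
  then show ?thesis using open_prefix_set by (auto simp: sets_restrict_space)
qed

text \<open>The empty set is included for stability under intersections.\<close>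

definition cyls :: "nat \<Rightarrow> (nat \<Rightarrow> nat) set \<Rightarrow> (nat \<Rightarrow> nat) set set" where
  "cyls p X = insert {} ((\<lambda>w. cylinder p w \<inter> X) ` words p)"

lemma cylinder_Int:
  assumes "X \<subseteq> full_shift p"
  shows "cylinder p w \<inter> X = {x \<in> X. pre x (length w) = w}"
  using assms by (auto simp: cylinder_pre)

lemma sets_cylinder:
  assumes "X \<subseteq> full_shift p"
  shows "cylinder p w \<inter> X \<in> sets (restrict_space borel X)"
  unfolding cylinder_Int[OF assms] using sets_prefix[of X "length w" "{w}"] by simp

text \<open>There are only countably many words, so every open set is a countable union of
  cylinders.\<close>

lemma sets_eq_cyls:
  assumes X: "X \<subseteq> full_shift p"
  shows "sets (restrict_space borel X) = sigma_sets X (cyls p X)"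
proof
  have "A \<inter> X \<in> sigma_sets X (cyls p X)" if "A \<in> sigma_sets UNIV {S. open S}" for A
    using that
  proof induction
    case (Basic U)
    then have U: "open U" by simp
    have "U \<inter> X = \<Union> {cylinder p w \<inter> X | w. w \<in> words p \<and> cylinder p w \<inter> X \<subseteq> U}"
    proof (intro set_eqI iffI)
      fix x assume x: "x \<in> U \<inter> X"
      then obtain k where k: "\<And>y. pre y k = pre x k \<Longrightarrow> y \<in> U" using open_prefix[OF U] by blast
      then have "cylinder p (pre x k) \<inter> X \<subseteq> U" unfolding cylinder_Int[OF X] by auto
      moreover have "x \<in> cylinder p (pre x k) \<inter> X" "pre x k \<in> words p"
        using x X by (auto simp: cylinder_Int pre_words)
      ultimately show "x \<in> \<Union> {cylinder p w \<inter> X | w. w \<in> words p \<and> cylinder p w \<inter> X \<subseteq> U}" by blast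
    qed auto
    moreover have "countable {cylinder p w \<inter> X | w. w \<in> words p \<and> cylinder p w \<inter> X \<subseteq> U}"
      by (rule countable_subset[of _ "range (\<lambda>w. cylinder p w \<inter> X)"]) auto
    moreover have "b \<in> sigma_sets X (cyls p X)"
      if "b \<in> {cylinder p w \<inter> X | w. w \<in> words p \<and> cylinder p w \<inter> X \<subseteq> U}" for b
      using that by (auto simp: cyls_def)
    ultimately show ?case by (auto intro!: sigma_sets_UNION)
  next
    case (Compl A)
    have "(UNIV - A) \<inter> X = X - (A \<inter> X)" by auto
    then show ?case using sigma_sets.Compl[OF Compl.IH] by simp
  next
    case (Union A)
    have "(\<Union>i. A i) \<inter> X = (\<Union>i. A i \<inter> X)" by auto
    then show ?case using sigma_sets.Union[OF Union.IH] by simp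
  qed (auto intro: sigma_sets.Empty)
  moreover have "sets (borel :: (nat \<Rightarrow> nat) measure) = sigma_sets UNIV {S. open S}"
    by (simp add: borel_def)
  ultimately show "sets (restrict_space borel X) \<subseteq> sigma_sets X (cyls p X)"
    by (auto simp: sets_restrict_space Int_commute)
  show "sigma_sets X (cyls p X) \<subseteq> sets (restrict_space borel X)"
    using sets.sigma_sets_subset[of "cyls p X" "restrict_space borel X"] sets_cylinder[OF X]
    by (auto simp: cyls_def space_restrict_space)
qed

text \<open>Two cylinders are nested or disjoint.\<close>

lemma Int_stable_cyls:
  assumes X: "X \<subseteq> full_shift p"
  shows "Int_stable (cyls p X)"
proof (rule Int_stableI)
  have *: "(cylinder p v \<inter> X) \<inter> (cylinder p w \<inter> X) \<in> cyls p X"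
    if "v \<in> words p" "w \<in> words p" "length v \<le> length w" for v w
  proof (cases "take (length v) w = v")
    case True
    have "(cylinder p v \<inter> X) \<inter> (cylinder p w \<inter> X) = cylinder p w \<inter> X"
      unfolding cylinder_Int[OF X] using True that(3) by (auto) (metis take_pre min.absorb1)
    then show ?thesis using that by (auto simp: cyls_def)
  next
    case False
    have "(cylinder p v \<inter> X) \<inter> (cylinder p w \<inter> X) = {}"
      unfolding cylinder_Int[OF X] using False that(3) by (auto) (metis take_pre min.absorb1)
    then show ?thesis by (auto simp: cyls_def)
  qed
  fix A B assume "A \<in> cyls p X" "B \<in> cyls p X"
  then consider "A = {} \<or> B = {}" | v w where "v \<in> words p" "w \<in> words p"
      "A = cylinder p v \<inter> X" "B = cylinder p w \<inter> X"
    unfolding cyls_def by blast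
  then show "A \<inter> B \<in> cyls p X"
  proof cases
    case 1
    then show ?thesis by (auto simp: cyls_def)
  next
    case 2
    then show ?thesis using *[of v w] *[of w v] Int_commute[of A B] by (metis linear)
  qed
qed

text \<open>The vector of cylinder measures turns the weak* topology into the product topology on
  \<open>nat list \<Rightarrow> real\<close>, which is metrizable.\<close>

definition cyl_meas :: "nat \<Rightarrow> (nat \<Rightarrow> nat) set \<Rightarrow> (nat \<Rightarrow> nat) measure \<Rightarrow> nat list \<Rightarrow> real" where
  "cyl_meas p X \<mu> w = measure \<mu> (cylinder p w \<inter> X)"

lemma space_borel_probs: "\<mu> \<in> borel_probs X \<Longrightarrow> space \<mu> = X"
  using sets_eq_imp_space_eq[of \<mu> "restrict_space borel X"] by (auto simp: borel_probs_def space_restrict_space)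

lemma borel_probs_eqI:
  assumes X: "X \<subseteq> full_shift p" and "\<mu> \<in> borel_probs X" "\<nu> \<in> borel_probs X"
    and "\<And>w. w \<in> words p \<Longrightarrow> cyl_meas p X \<mu> w = cyl_meas p X \<nu> w"
  shows "\<mu> = \<nu>"
proof (rule measure_eqI_generator_eq[OF Int_stable_cyls[OF X], where A = "\<lambda>_. X"])
  interpret \<mu>: prob_space \<mu> using assms by (simp add: borel_probs_def)
  interpret \<nu>: prob_space \<nu> using assms by (simp add: borel_probs_def)
  show "cyls p X \<subseteq> Pow X" by (auto simp: cyls_def)
  show "emeasure \<mu> A = emeasure \<nu> A" if "A \<in> cyls p X" for A
    using that assms(4) by (auto simp: cyls_def cyl_meas_def \<mu>.emeasure_eq_measure \<nu>.emeasure_eq_measure)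
  show "sets \<mu> = sigma_sets X (cyls p X)" "sets \<nu> = sigma_sets X (cyls p X)"
    using assms sets_eq_cyls[OF X] by (auto simp: borel_probs_def)
  have "cylinder p [] \<inter> X = X" using X by (auto simp: cylinder_def)
  then show "range (\<lambda>_. X) \<subseteq> cyls p X" by (auto simp: cyls_def intro!: image_eqI[of _ _ "[]"])
  show "emeasure \<mu> X \<noteq> \<infinity>" for i :: nat by simp
qed simp

text \<open>The sets that finite-prefix sets approximate in measure contain the cylinders and are
  closed under complements, finite unions and, by continuity of the measure along increasing unions,
  countable unions.\<close>

lemma prefix_approx:
  assumes X: "X \<subseteq> full_shift p" and \<mu>: "\<mu> \<in> borel_probs X" and "A \<in> sets \<mu>" "\<delta> > 0"
  shows "\<exists>k S. measure \<mu> (sym_diff A {x \<in> X. pre x k \<in> S}) < \<delta>"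
proof -
  interpret \<mu>: prob_space \<mu> using \<mu> by (simp add: borel_probs_def)
  have sets: "sets \<mu> = sigma_sets X (cyls p X)" "sets \<mu> = sets (restrict_space borel X)"
    using \<mu> sets_eq_cyls[OF X] by (auto simp: borel_probs_def)
  have clop [simp]: "{x \<in> X. pre x k \<in> S} \<in> sets \<mu>" for k S using sets_prefix sets(2) by simp
  define Q where "Q A \<longleftrightarrow> (\<forall>\<delta>>0. \<exists>k S. measure \<mu> (sym_diff A {x \<in> X. pre x k \<in> S}) < \<delta>)" for A
  have QD: "\<exists>k S. measure \<mu> (sym_diff A {x \<in> X. pre x k \<in> S}) < \<delta>" if "Q A" "\<delta> > 0" for A \<delta>
    using that by (simp add: Q_def)
  have Q0: "Q {x \<in> X. pre x k \<in> S}" for k S unfolding Q_def by (auto intro!: exI[of _ k] exI[of _ S])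
  have Un: "Q (A \<union> B)" if qa: "Q A" and qb: "Q B" and "A \<in> sets \<mu>" "B \<in> sets \<mu>" for A B
    unfolding Q_def
  proof (intro allI impI)
    fix \<delta> :: real assume "\<delta> > 0"
    then have "\<delta> / 2 > 0" by simp
    obtain k S where kS: "measure \<mu> (sym_diff A {x \<in> X. pre x k \<in> S}) < \<delta> / 2"
      using QD[OF qa \<open>\<delta> / 2 > 0\<close>] by auto
    obtain l T where lT: "measure \<mu> (sym_diff B {x \<in> X. pre x l \<in> T}) < \<delta> / 2"
      using QD[OF qb \<open>\<delta> / 2 > 0\<close>] by auto
    define m where "m = max k l"
    have eq: "{x \<in> X. pre x m \<in> {w. take k w \<in> S \<or> take l w \<in> T}} = {x \<in> X. pre x k \<in> S} \<union> {x \<in> X. pre x l \<in> T}"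
      by (auto simp: take_pre m_def min_def max_def)
    have "measure \<mu> (sym_diff (A \<union> B) ({x \<in> X. pre x k \<in> S} \<union> {x \<in> X. pre x l \<in> T}))
      \<le> measure \<mu> (sym_diff A {x \<in> X. pre x k \<in> S} \<union> sym_diff B {x \<in> X. pre x l \<in> T})"
      using that by (intro \<mu>.finite_measure_mono) (blast, auto intro!: sets.Un sets.Diff)
    also have "\<dots> \<le> measure \<mu> (sym_diff A {x \<in> X. pre x k \<in> S}) + measure \<mu> (sym_diff B {x \<in> X. pre x l \<in> T})"
      using that by (intro measure_Un_le) (auto intro!: sets.Un sets.Diff)
    also have "\<dots> < \<delta>" using kS lT by simp
    finally show "\<exists>k S. measure \<mu> (sym_diff (A \<union> B) {x \<in> X. pre x k \<in> S}) < \<delta>"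
      unfolding eq[symmetric] by blast
  qed
  have "Q A" using assms(3) unfolding sets(1)
  proof induction
    case (Basic A)
    then consider "A = {}" | w where "w \<in> words p" "A = cylinder p w \<inter> X" by (auto simp: cyls_def)
    then show ?case
    proof cases
      case 1
      then show ?thesis using Q0[of 0 "{}"] by simp
    next
      case 2
      then show ?thesis using Q0[of "length w" "{w}"] by (simp add: cylinder_Int[OF X])
    qed
  next
    case Empty
    show ?case using Q0[of 0 "{}"] by simp
  next
    case (Compl A)
    show ?case unfolding Q_def
    proof (intro allI impI)
      fix \<delta> :: real assume "\<delta> > 0"
      then obtain k S where kS: "measure \<mu> (sym_diff A {x \<in> X. pre x k \<in> S}) < \<delta>"
        using QD[OF Compl.IH] by blast
      have "A \<subseteq> X" using Compl(1) sets(1) sets.sets_into_space[of A \<mu>] space_borel_probs[OF \<mu>] by auto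
      then have "sym_diff (X - A) {x \<in> X. pre x k \<in> - S} = sym_diff A {x \<in> X. pre x k \<in> S}" by auto
      then have "measure \<mu> (sym_diff (X - A) {x \<in> X. pre x k \<in> - S}) < \<delta>" using kS by (simp only:)
      then show "\<exists>k S. measure \<mu> (sym_diff (X - A) {x \<in> X. pre x k \<in> S}) < \<delta>" by blast
    qed
  next
    case (Union A)
    have Am: "A i \<in> sets \<mu>" for i using Union(1) sets(1) by simp
    define B where "B n = (\<Union>i<n. A i)" for n
    have Bm: "B n \<in> sets \<mu>" for n using Am by (auto simp: B_def)
    have QB: "Q (B n)" for n
    proof (induction n)
      case 0
      then show ?case using Q0[of 0 "{}"] by (simp add: B_def)
    next
      case (Suc n)
      have "B (Suc n) = B n \<union> A n" by (auto simp: B_def lessThan_Suc)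
      then show ?case using Un[OF Suc Union.IH Bm Am] by simp
    qed
    have BU: "(\<Union>n. B n) = (\<Union>i. A i)" by (auto simp: B_def)
    have lim: "(\<lambda>n. measure \<mu> (B n)) \<longlonglongrightarrow> measure \<mu> (\<Union>n. B n)"
      using Bm by (intro \<mu>.finite_Lim_measure_incseq) (auto simp: incseq_def B_def, force)
    show ?case unfolding Q_def
    proof (intro allI impI)
      fix \<delta> :: real assume d: "\<delta> > 0"
      then obtain n where n: "\<bar>measure \<mu> (B n) - measure \<mu> (\<Union>n. B n)\<bar> < \<delta> / 2"
        using LIMSEQ_D[OF lim, of "\<delta> / 2"] by auto
      obtain k S where kS: "measure \<mu> (sym_diff (B n) {x \<in> X. pre x k \<in> S}) < \<delta> / 2"
        using QD[OF QB[of n] half_gt_zero[OF d]] by auto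
      have Um: "(\<Union>n. B n) \<in> sets \<mu>" using Bm by auto
      have "measure \<mu> (sym_diff (\<Union>n. B n) {x \<in> X. pre x k \<in> S}) \<le>
        measure \<mu> (((\<Union>n. B n) - B n) \<union> sym_diff (B n) {x \<in> X. pre x k \<in> S})"
        using Bm Um by (intro \<mu>.finite_measure_mono) (blast, auto intro!: sets.Un sets.Diff)
      also have "\<dots> \<le> measure \<mu> ((\<Union>n. B n) - B n) + measure \<mu> (sym_diff (B n) {x \<in> X. pre x k \<in> S})"
        using Bm Um by (intro measure_Un_le) (auto intro!: sets.Un sets.Diff)
      also have "measure \<mu> ((\<Union>n. B n) - B n) = measure \<mu> (\<Union>n. B n) - measure \<mu> (B n)"
        using Bm Um by (intro \<mu>.finite_measure_Diff) auto
      finally have "measure \<mu> (sym_diff (\<Union>n. B n) {x \<in> X. pre x k \<in> S}) < \<delta>" using n kS by linarith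
      then show "\<exists>k S. measure \<mu> (sym_diff (\<Union>i. A i) {x \<in> X. pre x k \<in> S}) < \<delta>" unfolding BU by blast
    qed
  qed
  then show ?thesis using QD assms(4) by blast
qed

text \<open>Uniform continuity on the compact \<open>X\<close>, expressed by prefixes;
  \<open>b\<close> samples \<phi> at one point of each cylinder.\<close>

lemma locally_constant_approx:
  fixes \<phi> :: "(nat \<Rightarrow> nat) \<Rightarrow> real"
  assumes "compact X" "continuous_on X \<phi>" "\<delta> > 0"
  obtains k b where "k > 0" "\<And>x. x \<in> X \<Longrightarrow> \<bar>\<phi> x - b (pre x k)\<bar> \<le> \<delta>"
proof -
  have "\<exists>k. \<forall>y\<in>X. pre y k = pre x k \<longrightarrow> dist (\<phi> y) (\<phi> x) < \<delta> / 2" if x: "x \<in> X" for x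
  proof -
    obtain U where U: "open U" "\<phi> -` ball (\<phi> x) (\<delta> / 2) \<inter> X = U \<inter> X"
      using assms(2) open_ball unfolding continuous_on_open_invariant by metis
    have "x \<in> \<phi> -` ball (\<phi> x) (\<delta> / 2) \<inter> X" using x assms(3) by simp
    then have "x \<in> U" using U(2) by auto
    then obtain k where k: "\<And>y. pre y k = pre x k \<Longrightarrow> y \<in> U" using open_prefix[OF U(1)] by blast
    have "dist (\<phi> y) (\<phi> x) < \<delta> / 2" if "y \<in> X" "pre y k = pre x k" for y
    proof -
      have "y \<in> \<phi> -` ball (\<phi> x) (\<delta> / 2) \<inter> X" using U(2) k[OF that(2)] that(1) by auto
      then show ?thesis by (simp add: dist_commute)
    qed
    then show ?thesis by blast
  qed
  then obtain K where K: "\<And>x y. x \<in> X \<Longrightarrow> y \<in> X \<Longrightarrow> pre y (K x) = pre x (K x) \<Longrightarrow> dist (\<phi> y) (\<phi> x) < \<delta> / 2"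
    by metis
  define V where "V x = {y. pre y (K x) \<in> {pre x (K x)}}" for x
  have "open (V x)" for x unfolding V_def by (rule open_prefix_set)
  moreover have "X \<subseteq> (\<Union>x\<in>X. V x)" by (auto simp: V_def)
  ultimately obtain F where F: "F \<subseteq> X" "finite F" "X \<subseteq> (\<Union>x\<in>F. V x)"
    using compactE_image[OF assms(1), of X V] by metis
  obtain k where k: "\<And>x. x \<in> F \<Longrightarrow> K x \<le> k"
    using F(2) by (metis finite_imageI finite_nat_set_iff_bounded_le imageI)
  have close: "dist (\<phi> y) (\<phi> x) < \<delta>" if "x \<in> X" "y \<in> X" "pre y (Suc k) = pre x (Suc k)" for x y
  proof -
    have "x \<in> (\<Union>x\<in>F. V x)" using F(3) that(1) by blast
    then obtain z where z: "z \<in> F" "pre x (K z) = pre z (K z)" by (auto simp: V_def)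
    have "pre y (K z) = pre x (K z)" by (rule pre_eq_mono[OF that(3)]) (use k[OF z(1)] in simp)
    then have "dist (\<phi> x) (\<phi> z) < \<delta> / 2" "dist (\<phi> y) (\<phi> z) < \<delta> / 2"
      using K[of z x] K[of z y] z F(1) that by auto
    then show ?thesis by (metis dist_triangle_half_l dist_commute)
  qed
  define b where "b w = \<phi> (SOME x. x \<in> X \<and> pre x (Suc k) = w)" for w
  have "\<bar>\<phi> x - b (pre x (Suc k))\<bar> \<le> \<delta>" if x: "x \<in> X" for x
  proof -
    define y where "y = (SOME y. y \<in> X \<and> pre y (Suc k) = pre x (Suc k))"
    have "y \<in> X \<and> pre y (Suc k) = pre x (Suc k)"
    proof -
      have "\<exists>y. y \<in> X \<and> pre y (Suc k) = pre x (Suc k)" using x by blast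
      then show ?thesis unfolding y_def by (rule someI_ex)
    qed
    then have "dist (\<phi> y) (\<phi> x) < \<delta>" using close[OF x] by blast
    then show ?thesis by (simp add: b_def y_def dist_real_def)
  qed
  then show ?thesis using that by blast
qed

section \<open>The Kolmogorov--Sinai entropy of the shift\<close>

lemma uniformly_continuous_xlnx:
  "uniformly_continuous_on {0..1} (\<lambda>x :: real. x * ln x)"
proof (rule compact_uniformly_continuous)
  have "isCont (\<lambda>x :: real. x * ln x) x" if "x > 0" for x using that by (intro continuous_intros) auto
  moreover have "((\<lambda>x :: real. x * ln x) \<longlongrightarrow> 0 * ln 0) (at 0 within {0..1})"
  proof -
    have "((\<lambda>x :: real. x * ln x) \<longlongrightarrow> 0) (at_right 0)" by real_asymp
    then show ?thesis by (simp add: at_within_Icc_at_right)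
  qed
  ultimately show "continuous_on {0..1} (\<lambda>x :: real. x * ln x)"
    unfolding continuous_on_def
    by (metis atLeastAtMost_iff continuous_at_imp_continuous_at_within continuous_within le_less)
qed simp

text \<open>If \<open>f\<close> and \<open>f'\<close> rarely differ, their joint law is nearly
  diagonal: the masses off the diagonal are close to 0, those on it close to the law of
  \<open>f'\<close>. Uniform continuity of \<open>x * ln x\<close> bounds the error of each of the
  \<open>(card B)\<^sup>2\<close> terms, by a \<delta> that is chosen before \<open>f\<close> and
  \<open>f'\<close>.\<close>

lemma (in prob_space) entropy_of_close:
  fixes B :: "'b set"
  assumes "finite B" "\<epsilon> > 0"
  shows "\<exists>\<delta>>0. \<forall>f f'. simple_function M f \<longrightarrow> simple_function M f' \<longrightarrow> f ` space M \<subseteq> B \<longrightarrow>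
    f' ` space M \<subseteq> B \<longrightarrow> prob {x \<in> space M. f x \<noteq> f' x} \<le> \<delta> \<longrightarrow>
    entropy_of M (\<lambda>x. (f x, f' x)) \<le> entropy_of M f' + \<epsilon>"
proof -
  define N where "N = real (card B) + 1"
  define \<epsilon>' where "\<epsilon>' = \<epsilon> / N\<^sup>2"
  have N: "N > 0" "real (card B) \<le> N" by (auto simp: N_def)
  have "\<epsilon>' > 0" using N assms by (simp add: \<epsilon>'_def)
  then obtain \<delta>' where \<delta>': "\<delta>' > 0" "\<And>x y :: real. x \<in> {0..1} \<Longrightarrow> y \<in> {0..1} \<Longrightarrow> dist y x < \<delta>' \<Longrightarrow>
      dist (y * ln y) (x * ln x) < \<epsilon>'"
    using uniformly_continuous_xlnx unfolding uniformly_continuous_on_def by blast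
  show ?thesis
  proof (intro exI[of _ "\<delta>' / 2"] conjI allI impI)
    show "\<delta>' / 2 > 0" using \<delta>' by simp
    fix f f' :: "'a \<Rightarrow> 'b"
    assume sf: "simple_function M f" "simple_function M f'" and B: "f ` space M \<subseteq> B" "f' ` space M \<subseteq> B"
      and d: "prob {x \<in> space M. f x \<noteq> f' x} \<le> \<delta>' / 2"
    define q where "q b c = prob ((\<lambda>x. (f x, f' x)) -` {(b, c)} \<inter> space M)" for b c
    define r where "r c = prob (f' -` {c} \<inter> space M)" for c
    have m1: "(\<lambda>x. (f x, f' x)) -` {(b, c)} \<inter> space M \<in> events" for b c
      using simple_functionD(2)[OF simple_function_pair[OF sf]] .
    have m2: "f' -` {c} \<inter> space M \<in> events" for c using simple_functionD(2)[OF sf(2)] .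
    have ne: "{x \<in> space M. f x \<noteq> f' x} \<in> events"
    proof -
      have "{x \<in> space M. f x \<noteq> f' x} = (\<lambda>x. (f x, f' x)) -` {z. fst z \<noteq> snd z} \<inter> space M" by auto
      then show ?thesis using simple_functionD(2)[OF simple_function_pair[OF sf], of "{z. fst z \<noteq> snd z}"]
        by (simp only:)
    qed
    have rng: "q b c \<in> {0..1}" "r c \<in> {0..1}" for b c
      unfolding q_def r_def using prob_le_1 measure_nonneg by (simp_all only: atLeastAtMost_iff simp_thms)
    have offdiag: "- (q b c * ln (q b c)) \<le> \<epsilon>'" if "b \<noteq> c" for b c
    proof -
      have "q b c \<le> prob {x \<in> space M. f x \<noteq> f' x}"
        unfolding q_def using ne that by (intro finite_measure_mono) auto
      then have "dist (q b c) 0 < \<delta>'" using d \<delta>' rng(1)[of b c] by (simp add: dist_real_def)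
      then have "dist (q b c * ln (q b c)) (0 * ln 0) < \<epsilon>'" using rng by (intro \<delta>'(2)) auto
      then show ?thesis by (simp add: dist_real_def)
    qed
    have diag: "- (q c c * ln (q c c)) \<le> - (r c * ln (r c)) + \<epsilon>'" for c
    proof -
      have le: "q c c \<le> r c" unfolding q_def r_def using m2 by (intro finite_measure_mono) auto
      have "r c - q c c = prob ((f' -` {c} \<inter> space M) - ((\<lambda>x. (f x, f' x)) -` {(c, c)} \<inter> space M))"
        unfolding q_def r_def using m1 m2 by (subst finite_measure_Diff) auto
      also have "\<dots> \<le> prob {x \<in> space M. f x \<noteq> f' x}"
        using ne by (intro finite_measure_mono) auto
      finally have "dist (q c c) (r c) < \<delta>'" using d \<delta>' le by (simp add: dist_real_def)
      then have "dist (q c c * ln (q c c)) (r c * ln (r c)) < \<epsilon>'" using rng by (intro \<delta>'(2)) auto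
      then show ?thesis by (simp add: dist_real_def abs_if split: if_splits)
    qed
    have "entropy_of M (\<lambda>x. (f x, f' x)) = shannon (B \<times> B) (\<lambda>(b, c). q b c)"
      using B assms(1) by (subst entropy_of_superset[of "B \<times> B"]) (auto simp: q_def intro!: shannon_cong)
    also have "\<dots> = (\<Sum>b\<in>B. \<Sum>c\<in>B. - (q b c * ln (q b c)))"
      by (simp add: shannon_def sum.cartesian_product split_def sum_negf)
    also have "\<dots> = (\<Sum>c\<in>B. \<Sum>b\<in>B. - (q b c * ln (q b c)))" by (rule sum.swap)
    also have "\<dots> \<le> (\<Sum>c\<in>B. \<Sum>b\<in>B. \<epsilon>' + (if b = c then - (r c * ln (r c)) else 0))"
      using offdiag diag by (intro sum_mono) (auto simp: add.commute)
    also have "\<dots> = (\<Sum>c\<in>B. real (card B) * \<epsilon>' + - (r c * ln (r c)))"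
      using assms(1) by (simp add: sum.distrib sum.delta cong: if_cong)
    also have "\<dots> = (real (card B))\<^sup>2 * \<epsilon>' + shannon B r"
      by (simp add: sum.distrib sum_subtractf shannon_def power2_eq_square)
    also have "shannon B r = entropy_of M f'"
      unfolding r_def using B assms(1) by (subst entropy_of_superset[of B]) auto
    also have "(real (card B))\<^sup>2 * \<epsilon>' \<le> N\<^sup>2 * \<epsilon>'"
      using N \<open>\<epsilon>' > 0\<close> by (intro mult_right_mono power_mono) auto
    also have "N\<^sup>2 * \<epsilon>' = \<epsilon>" using N by (simp add: \<epsilon>'_def)
    finally show "entropy_of M (\<lambda>x. (f x, f' x)) \<le> entropy_of M f' + \<epsilon>" by simp
  qed
qed

lemma shift_measurable:
  assumes "shift_map ` X \<subseteq> X"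
  shows "shift_map \<in> measurable (restrict_space borel X) (restrict_space borel X)"
proof (rule measurable_restrict_space3)
  have "continuous_on UNIV shift_map" unfolding shift_map_def
    by (rule continuous_on_coordinatewise_then_product) (rule continuous_on_product_coordinates)
  then show "shift_map \<in> measurable borel borel" by (rule borel_measurable_continuous_onI)
qed (use assms in auto)

lemma pmpt_shift:
  assumes "shift_map ` X \<subseteq> X" "\<mu> \<in> invariant_measures X"
  shows "pmpt \<mu> shift_map"
proof -
  interpret prob_space \<mu> using assms by (simp add: invariant_measures_def borel_probs_def)
  have "sets \<mu> = sets (restrict_space borel X)" using assms by (simp add: invariant_measures_def borel_probs_def)
  then have "shift_map \<in> measurable \<mu> \<mu>"
    using shift_measurable[OF assms(1)] by (simp cong: measurable_cong_sets)
  then show ?thesis using assms by unfold_locales (auto simp: invariant_measures_def)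
qed

lemma pre_image_subset: "X \<subseteq> full_shift p \<Longrightarrow> (\<lambda>x. pre x n) ` X \<subseteq> block p n"
  by (auto intro: pre_block)

lemma simple_function_pre:
  assumes "X \<subseteq> full_shift p" "\<mu> \<in> borel_probs X"
  shows "simple_function \<mu> (\<lambda>x. h (pre x n))"
proof -
  have "simple_function \<mu> (\<lambda>x. pre x n)"
    unfolding simple_function_def
  proof (intro conjI ballI)
    show "finite ((\<lambda>x. pre x n) ` space \<mu>)"
      using pre_image_subset[OF assms(1)] space_borel_probs[OF assms(2)] finite_subset[OF _ finite_block] by metis
    fix w
    have "(\<lambda>x. pre x n) -` {w} \<inter> space \<mu> = {x \<in> X. pre x n \<in> {w}}" using space_borel_probs[OF assms(2)] by auto
    then show "(\<lambda>x. pre x n) -` {w} \<inter> space \<mu> \<in> sets \<mu>"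
      using sets_prefix[of X n "{w}"] assms(2) by (simp add: borel_probs_def)
  qed
  then show ?thesis using simple_function_compose[of \<mu> "\<lambda>x. pre x n" h] by (simp add: comp_def)
qed

lemma entropy_of_pre:
  assumes "X \<subseteq> full_shift p" "\<mu> \<in> borel_probs X"
  shows "entropy_of \<mu> (\<lambda>x. pre x n) = shannon (block p n) (cyl_meas p X \<mu>)"
proof -
  have sp: "space \<mu> = X" by (rule space_borel_probs[OF assms(2)])
  have "entropy_of \<mu> (\<lambda>x. pre x n) = shannon (block p n) (\<lambda>w. measure \<mu> ((\<lambda>x. pre x n) -` {w} \<inter> space \<mu>))"
    using pre_image_subset[OF assms(1)] sp by (intro entropy_of_superset) auto
  also have "\<dots> = shannon (block p n) (cyl_meas p X \<mu>)"
  proof (rule shannon_cong)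
    fix w assume "w \<in> block p n"
    then have "(\<lambda>x. pre x n) -` {w} \<inter> space \<mu> = cylinder p w \<inter> X"
      using sp by (auto simp: cylinder_Int[OF assms(1)] block_def)
    then show "measure \<mu> ((\<lambda>x. pre x n) -` {w} \<inter> space \<mu>) = cyl_meas p X \<mu> w" by (simp add: cyl_meas_def)
  qed
  finally show ?thesis .
qed

text \<open>Heart of the Kolmogorov--Sinai theorem: prefixes eventually determine any finite
  partition up to small conditional entropy. A function \<open>f'\<close> of a prefix is built that
  agrees with the cell function outside a small set; conditioning on the whole prefix is then at
  least as good as conditioning on \<open>f'\<close>.\<close>

lemma conditional_entropy_pre_small:
  assumes X: "X \<subseteq> full_shift p" and \<mu>: "\<mu> \<in> borel_probs X"
    and P: "finite P" "P \<subseteq> sets \<mu>" "partition_on (space \<mu>) P" and "\<epsilon> > 0"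
  shows "\<exists>k. entropy_of \<mu> (\<lambda>x. (cell_of P x, pre x k)) - entropy_of \<mu> (\<lambda>x. pre x k) \<le> \<epsilon>"
proof -
  interpret prob_space \<mu> using \<mu> by (simp add: borel_probs_def)
  have sp: "space \<mu> = X" by (rule space_borel_probs[OF \<mu>])
  obtain x0 where x0: "x0 \<in> space \<mu>" using not_empty by auto
  obtain \<delta> where \<delta>: "\<delta> > 0"
    "\<forall>f f'. simple_function \<mu> f \<longrightarrow> simple_function \<mu> f' \<longrightarrow> f ` space \<mu> \<subseteq> P \<longrightarrow> f' ` space \<mu> \<subseteq> P \<longrightarrow>
      prob {x \<in> space \<mu>. f x \<noteq> f' x} \<le> \<delta> \<longrightarrow>
      entropy_of \<mu> (\<lambda>x. (f x, f' x)) \<le> entropy_of \<mu> f' + \<epsilon>"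
    using entropy_of_close[OF P(1) \<open>\<epsilon> > 0\<close>] by auto
  define N where "N = real (card P) + 1"
  have N: "N > 0" by (simp add: N_def)
  have "\<forall>A\<in>P. \<exists>z. prob (sym_diff A {x \<in> X. pre x (fst z) \<in> snd z}) < \<delta> / N"
  proof
    fix A assume "A \<in> P"
    then have "\<exists>k S. prob (sym_diff A {x \<in> X. pre x k \<in> S}) < \<delta> / N"
      using \<delta>(1) N P(2) by (intro prefix_approx[OF X \<mu>]) auto
    then obtain k S where "prob (sym_diff A {x \<in> X. pre x k \<in> S}) < \<delta> / N" by blast
    then show "\<exists>z. prob (sym_diff A {x \<in> X. pre x (fst z) \<in> snd z}) < \<delta> / N"
      by (intro exI[of _ "(k, S)"]) (simp only: fst_conv snd_conv)
  qed
  from bchoice[OF this] obtain z where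
    z: "\<forall>A\<in>P. prob (sym_diff A {x \<in> X. pre x (fst (z A)) \<in> snd (z A)}) < \<delta> / N" by blast
  define k S where "k A = fst (z A)" and "S A = snd (z A)" for A
  have kS: "\<And>A. A \<in> P \<Longrightarrow> prob (sym_diff A {x \<in> X. pre x (k A) \<in> S A}) < \<delta> / N"
    unfolding k_def S_def by (rule z[rule_format])
  obtain m where m: "\<And>A. A \<in> P \<Longrightarrow> k A \<le> m"
    using P(1) by (metis finite_imageI finite_nat_set_iff_bounded_le imageI)
  \<comment> \<open>The approximating prefix sets of different cells may overlap or leave gaps;
    there an arbitrary fixed cell is chosen.\<close>
  define h where "h w = (if \<exists>!A. A \<in> P \<and> take (k A) w \<in> S A then THE A. A \<in> P \<and> take (k A) w \<in> S A
    else cell_of P x0)" for w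
  define f' where "f' x = h (pre x m)" for x
  let ?f = "cell_of P" and ?g = "\<lambda>x. pre x m"
  have sf: "simple_function \<mu> ?f" "simple_function \<mu> f'" "simple_function \<mu> ?g"
    using simple_function_cell_of[OF P] simple_function_pre[OF X \<mu>, of h m]
      simple_function_pre[OF X \<mu>, of "\<lambda>x. x" m] by (auto simp: f'_def[abs_def])
  have "h w \<in> P" for w
  proof (cases "\<exists>!A. A \<in> P \<and> take (k A) w \<in> S A")
    case True
    then show ?thesis unfolding h_def using theI'[OF True] by simp
  qed (use cell_of_in(1)[OF P(3) x0] in \<open>simp add: h_def\<close>)
  then have im': "f' ` space \<mu> \<subseteq> P" by (auto simp: f'_def)
  have im: "?f ` space \<mu> \<subseteq> P" using cell_of_in(1)[OF P(3)] by auto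
  have sm: "sym_diff A {x \<in> X. pre x (k A) \<in> S A} \<in> events" if "A \<in> P" for A
    using that P(2) sets_prefix[of X "k A" "S A"] \<mu> by (auto simp: borel_probs_def)
  have "{x \<in> space \<mu>. ?f x \<noteq> f' x} \<subseteq> (\<Union>A\<in>P. sym_diff A {x \<in> X. pre x (k A) \<in> S A})"
  proof (rule subsetI, rule ccontr)
    fix x assume x: "x \<in> {x \<in> space \<mu>. ?f x \<noteq> f' x}"
      and no: "x \<notin> (\<Union>A\<in>P. sym_diff A {x \<in> X. pre x (k A) \<in> S A})"
    have xs: "x \<in> space \<mu>" using x by simp
    have iff: "x \<in> A \<longleftrightarrow> take (k A) (pre x m) \<in> S A" if "A \<in> P" for A
      using no that m[OF that] xs sp by (auto simp: take_pre min_def)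
    have uniq: "A \<in> P \<and> take (k A) (pre x m) \<in> S A \<longleftrightarrow> A = ?f x" for A
      using iff cell_of_in[OF P(3) xs] cell_of_eq[OF P(3), of A x] by metis
    have "f' x = ?f x" unfolding f'_def h_def uniq by simp
    then show False using x by simp
  qed
  then have "prob {x \<in> space \<mu>. ?f x \<noteq> f' x} \<le> prob (\<Union>A\<in>P. sym_diff A {x \<in> X. pre x (k A) \<in> S A})"
    using sm P(1) by (intro finite_measure_mono) auto
  also have "\<dots> \<le> (\<Sum>A\<in>P. prob (sym_diff A {x \<in> X. pre x (k A) \<in> S A}))"
    using sm P(1) by (intro finite_measure_subadditive_finite) auto
  also have "\<dots> \<le> (\<Sum>A\<in>P. \<delta> / N)" using kS by (intro sum_mono) (auto simp: less_imp_le)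
  also have "\<dots> \<le> \<delta>" using \<delta>(1) N by (simp add: N_def field_simps)
  finally have close: "entropy_of \<mu> (\<lambda>x. (?f x, f' x)) \<le> entropy_of \<mu> f' + \<epsilon>"
    using \<delta>(2)[rule_format, OF sf(1,2) im im'] by simp
  \<comment> \<open>Since \<open>f'\<close> is a function of the prefix \<open>?g\<close>,
    submodularity gives \<open>H(?f | ?g) \<le> H(?f | f')\<close>.\<close>
  have "entropy_of \<mu> (\<lambda>x. (?f x, ?g x, f' x)) + entropy_of \<mu> f' \<le>
    entropy_of \<mu> (\<lambda>x. (?f x, f' x)) + entropy_of \<mu> (\<lambda>x. (?g x, f' x))"
    by (rule entropy_of_submodular[OF sf(1,3,2)])
  moreover have "entropy_of \<mu> (\<lambda>x. (?f x, ?g x, f' x)) = entropy_of \<mu> (\<lambda>x. (?f x, ?g x))"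
    by (intro entropy_of_cong simple_function_pair sf) (auto simp: f'_def)
  moreover have "entropy_of \<mu> (\<lambda>x. (?g x, f' x)) = entropy_of \<mu> ?g"
    by (intro entropy_of_cong simple_function_pair sf) (auto simp: f'_def)
  ultimately have "entropy_of \<mu> (\<lambda>x. (?f x, ?g x)) - entropy_of \<mu> ?g \<le> \<epsilon>" using close by linarith
  then show ?thesis by blast
qed

lemma tendsto_shifted_ratio:
  fixes a :: "nat \<Rightarrow> real"
  assumes "(\<lambda>n. a n / real n) \<longlonglongrightarrow> h"
  shows "(\<lambda>n. a (n + k) / real n) \<longlonglongrightarrow> h"
proof -
  have "(\<lambda>n. a (n + k) / real (n + k)) \<longlonglongrightarrow> h" by (rule LIMSEQ_ignore_initial_segment[OF assms])
  moreover have "(\<lambda>n. real (n + k) / real n) \<longlonglongrightarrow> 1" by real_asymp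
  ultimately have "(\<lambda>n. a (n + k) / real (n + k) * (real (n + k) / real n)) \<longlonglongrightarrow> h * 1" by (rule tendsto_mult)
  moreover have "\<forall>\<^sub>F n in sequentially. a (n + k) / real (n + k) * (real (n + k) / real n) = a (n + k) / real n"
    using eventually_gt_at_top[of 0] by eventually_elim simp
  ultimately show ?thesis by (simp add: Lim_transform_eventually)
qed

text \<open>The sequence of \<open>k\<close>-prefixes seen along an orbit of length \<open>n\<close>
  is contained in one prefix of length \<open>n + k\<close>, whose entropy has the same growth rate
  for every fixed \<open>k\<close>. Hence the entropy rate of the prefixes bounds the rate of every
  partition.\<close>

lemma ks_entropy_shift:
  assumes X: "X \<subseteq> full_shift p" "shift_map ` X \<subseteq> X" and \<mu>: "\<mu> \<in> invariant_measures X"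
  obtains h where "(\<lambda>n. entropy_of \<mu> (\<lambda>x. pre x n) / real n) \<longlonglongrightarrow> h"
    "\<And>n. n > 0 \<Longrightarrow> h \<le> entropy_of \<mu> (\<lambda>x. pre x n) / real n"
    "ks_entropy \<mu> shift_map = ereal h"
proof -
  interpret pmpt \<mu> shift_map by (rule pmpt_shift[OF X(2) \<mu>])
  have \<mu>': "\<mu> \<in> borel_probs X" using \<mu> by (simp add: invariant_measures_def)
  have sp: "space \<mu> = X" by (rule space_borel_probs[OF \<mu>'])
  let ?g = "\<lambda>x :: nat \<Rightarrow> nat. x 0"
  have itg: "itinerary ?g shift_map n x = pre x n" for n x
    by (simp add: itinerary_def pre_def shift_funpow)
  have sf_pre: "simple_function \<mu> (\<lambda>x. pre x n)" for n using simple_function_pre[OF X(1) \<mu>', of "\<lambda>x. x"] by simp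
  have sfg: "simple_function \<mu> ?g"
    using simple_function_pre[OF X(1) \<mu>', of hd 1] by (simp add: pre_def)
  obtain h where h: "(\<lambda>n. entropy_of \<mu> (\<lambda>x. pre x n) / real n) \<longlonglongrightarrow> h"
    "\<And>n. n > 0 \<Longrightarrow> h \<le> entropy_of \<mu> (\<lambda>x. pre x n) / real n"
    using entropy_rate[OF sfg] unfolding itg[abs_def] by metis
  have le: "entropy_wrt_partition \<mu> shift_map P \<le> h"
    if P: "finite P" "P \<subseteq> events" "partition_on (space \<mu>) P" for P
  proof -
    have sfP: "simple_function \<mu> (cell_of P)" by (rule simple_function_cell_of[OF P])
    obtain L where L: "(\<lambda>n. entropy_of \<mu> (itinerary (cell_of P) shift_map n) / real n) \<longlonglongrightarrow> L"
      using entropy_rate[OF sfP] by metis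
    have "L \<le> h + \<epsilon>" if "\<epsilon> > 0" for \<epsilon>
    proof -
      obtain k where k: "entropy_of \<mu> (\<lambda>x. (cell_of P x, pre x k)) - entropy_of \<mu> (\<lambda>x. pre x k) \<le> \<epsilon>"
        using conditional_entropy_pre_small[OF X(1) \<mu>' P \<open>\<epsilon> > 0\<close>] by blast
      have bound: "entropy_of \<mu> (itinerary (cell_of P) shift_map n) / real n
        \<le> entropy_of \<mu> (\<lambda>x. pre x (n + k)) / real n + \<epsilon>" if n: "n > 0" for n
      proof -
        have "entropy_of \<mu> (itinerary (\<lambda>x. pre x k) shift_map n) \<le> entropy_of \<mu> (\<lambda>x. pre x (n + k))"
        proof (rule entropy_of_mono)
          show "itinerary (\<lambda>x. pre x k) shift_map n x = itinerary (\<lambda>x. pre x k) shift_map n y"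
            if "pre x (n + k) = pre y (n + k)" for x y
          proof -
            have "x i = y i" if "i < n + k" for i using \<open>pre x (n + k) = pre y (n + k)\<close> nth_pre[OF that] by metis
            then show ?thesis by (auto simp: itinerary_eq_iff pre_def shift_funpow)
          qed
        qed (rule simple_function_itinerary[OF sf_pre] sf_pre)+
        moreover have "entropy_of \<mu> (itinerary (cell_of P) shift_map n) \<le>
          entropy_of \<mu> (itinerary (\<lambda>x. pre x k) shift_map n) + real n * \<epsilon>"
          using entropy_of_itinerary_le[OF sfP sf_pre, of n k] mult_left_mono[OF k, of "real n"] by simp
        ultimately have "entropy_of \<mu> (itinerary (cell_of P) shift_map n) \<le> entropy_of \<mu> (\<lambda>x. pre x (n + k)) + real n * \<epsilon>"
          by linarith
        then show ?thesis using n by (simp add: field_simps)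
      qed
      have "(\<lambda>n. entropy_of \<mu> (\<lambda>x. pre x (n + k)) / real n + \<epsilon>) \<longlonglongrightarrow> h + \<epsilon>"
        by (intro tendsto_intros tendsto_shifted_ratio[where a = "\<lambda>n. entropy_of \<mu> (\<lambda>x. pre x n)"] h)
      then show ?thesis
      proof (rule tendsto_le[OF sequentially_bot _ L])
        show "\<forall>\<^sub>F n in sequentially. entropy_of \<mu> (itinerary (cell_of P) shift_map n) / real n
          \<le> entropy_of \<mu> (\<lambda>x. pre x (n + k)) / real n + \<epsilon>"
          using eventually_gt_at_top[of 0] by eventually_elim (rule bound)
      qed
    qed
    then have "L \<le> h" by (rule field_le_epsilon)
    then show ?thesis
      using entropy_wrt_partition_itinerary[OF P(3) T_space L] by simp
  qed
  \<comment> \<open>The partition by the first letter, which attains the supremum.\<close>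
  define P0 where "P0 = (\<lambda>b. ?g -` {b} \<inter> space \<mu>) ` (?g ` space \<mu>)"
  have P0: "finite P0" "P0 \<subseteq> events" "partition_on (space \<mu>) P0"
    using simple_functionD[OF sfg] by (auto simp: P0_def partition_on_def disjoint_def)
  have cell0: "cell_of P0 x = ?g -` {?g x} \<inter> space \<mu>" if "x \<in> space \<mu>" for x
    using that by (intro cell_of_eq[OF P0(3)]) (auto simp: P0_def)
  have "entropy_of \<mu> (itinerary (cell_of P0) shift_map n) = entropy_of \<mu> (\<lambda>x. pre x n)" for n
  proof (rule entropy_of_cong)
    show "simple_function \<mu> (itinerary (cell_of P0) shift_map n)"
      by (rule simple_function_itinerary[OF simple_function_cell_of[OF P0]])
    fix x y assume xy: "x \<in> space \<mu>" "y \<in> space \<mu>"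
    have "cell_of P0 ((shift_map ^^ i) x) = cell_of P0 ((shift_map ^^ i) y) \<longleftrightarrow>
      ?g ((shift_map ^^ i) x) = ?g ((shift_map ^^ i) y)" for i
      using cell0 funpow_space[OF T_space xy(1), of i] funpow_space[OF T_space xy(2), of i] by auto
    then show "itinerary (cell_of P0) shift_map n x = itinerary (cell_of P0) shift_map n y \<longleftrightarrow> pre x n = pre y n"
      unfolding itg[symmetric] itinerary_eq_iff by simp
  qed (rule sf_pre)
  then have "entropy_wrt_partition \<mu> shift_map P0 = h"
    using entropy_wrt_partition_itinerary[OF P0(3) T_space] h(1) by simp
  then have "ks_entropy \<mu> shift_map = ereal h"
    unfolding ks_entropy_def using le P0
    by (intro antisym SUP_least) (auto intro!: SUP_upper2[of P0])
  then show ?thesis using that h by blast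
qed

section \<open>The weak* topology\<close>

lemma integral_cyl:
  assumes X: "X \<subseteq> full_shift p" and \<mu>: "\<mu> \<in> borel_probs X"
  shows "integrable \<mu> (\<lambda>x. h (pre x k) :: real)"
    and "(\<integral>x. h (pre x k) \<partial>\<mu>) = (\<Sum>u\<in>block p k. h u * cyl_meas p X \<mu> u)"
proof -
  interpret prob_space \<mu> using \<mu> by (simp add: borel_probs_def)
  have sp: "space \<mu> = X" by (rule space_borel_probs[OF \<mu>])
  have m: "cylinder p u \<inter> X \<in> events" for u
    using sets_cylinder[OF X] \<mu> by (simp add: borel_probs_def)
  have eq: "h (pre x k) = (\<Sum>u\<in>block p k. h u * indicator (cylinder p u \<inter> X) x)" if "x \<in> space \<mu>" for x
  proof -
    have x: "x \<in> X" using that sp by simp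
    have "(\<Sum>u\<in>block p k. h u * indicator (cylinder p u \<inter> X) x) = (\<Sum>u\<in>block p k. if u = pre x k then h u else 0)"
      using x by (intro sum.cong) (auto simp: cylinder_Int[OF X] block_def indicator_def)
    also have "\<dots> = h (pre x k)" using x X pre_block[of x p k] by auto
    finally show ?thesis by simp
  qed
  have int: "integrable \<mu> (\<lambda>x. h u * indicator (cylinder p u \<inter> X) x)" for u
    using m by (intro integrable_mult_right) (simp add: less_top[symmetric])
  have "integrable \<mu> (\<lambda>x. \<Sum>u\<in>block p k. h u * indicator (cylinder p u \<inter> X) x)"
    using int by (intro Bochner_Integration.integrable_sum) auto
  then show "integrable \<mu> (\<lambda>x. h (pre x k))"
    by (subst Bochner_Integration.integrable_cong[OF refl eq])
  have "(\<integral>x. h (pre x k) \<partial>\<mu>) = (\<integral>x. (\<Sum>u\<in>block p k. h u * indicator (cylinder p u \<inter> X) x) \<partial>\<mu>)"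
    by (intro Bochner_Integration.integral_cong refl eq)
  also have "\<dots> = (\<Sum>u\<in>block p k. \<integral>x. h u * indicator (cylinder p u \<inter> X) x \<partial>\<mu>)"
    using int by (intro Bochner_Integration.integral_sum)
  also have "\<dots> = (\<Sum>u\<in>block p k. h u * cyl_meas p X \<mu> u)"
    using m by (simp add: cyl_meas_def)
  finally show "(\<integral>x. h (pre x k) \<partial>\<mu>) = (\<Sum>u\<in>block p k. h u * cyl_meas p X \<mu> u)" .
qed

lemma sum_cyl_meas:
  assumes X: "X \<subseteq> full_shift p" and \<mu>: "\<mu> \<in> borel_probs X"
  shows "(\<Sum>u\<in>block p k. cyl_meas p X \<mu> u) = 1"
proof -
  interpret prob_space \<mu> using \<mu> by (simp add: borel_probs_def)
  show ?thesis using integral_cyl(2)[OF assms, of "\<lambda>_. 1" k] prob_space by simp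
qed

lemma cyl_meas_nonneg: "0 \<le> cyl_meas p X \<mu> u"
  by (simp add: cyl_meas_def)

lemma cyl_meas_le_1: "\<mu> \<in> borel_probs X \<Longrightarrow> cyl_meas p X \<mu> u \<le> 1"
  using prob_space.prob_le_1 by (auto simp: cyl_meas_def borel_probs_def)

lemma integrable_continuous:
  fixes \<phi> :: "(nat \<Rightarrow> nat) \<Rightarrow> real"
  assumes "compact X" "continuous_on X \<phi>" and \<mu>: "\<mu> \<in> borel_probs X"
  shows "integrable \<mu> \<phi>"
proof -
  interpret prob_space \<mu> using \<mu> by (simp add: borel_probs_def)
  have "compact (\<phi> ` X)" using assms compact_continuous_image by blast
  then obtain B where B: "\<And>x. x \<in> X \<Longrightarrow> norm (\<phi> x) \<le> B"
    using compact_imp_bounded bounded_iff by (metis imageI)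
  have "\<phi> \<in> borel_measurable \<mu>"
    using borel_measurable_continuous_on_restrict[OF assms(2)] \<mu>
    by (simp add: borel_probs_def cong: measurable_cong_sets)
  moreover have "AE x in \<mu>. norm (\<phi> x) \<le> B"
    using B space_borel_probs[OF \<mu>] by (intro AE_I2) auto
  ultimately show ?thesis by (intro integrable_const_bound)
qed

lemma integral_approx:
  fixes \<phi> :: "(nat \<Rightarrow> nat) \<Rightarrow> real"
  assumes X: "X \<subseteq> full_shift p" and "compact X" "continuous_on X \<phi>" and \<mu>: "\<mu> \<in> borel_probs X"
    and b: "\<And>x. x \<in> X \<Longrightarrow> \<bar>\<phi> x - b (pre x k)\<bar> \<le> \<delta>"
  shows "\<bar>(\<integral>x. \<phi> x \<partial>\<mu>) - (\<Sum>u\<in>block p k. b u * cyl_meas p X \<mu> u)\<bar> \<le> \<delta>"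
proof -
  interpret prob_space \<mu> using \<mu> by (simp add: borel_probs_def)
  have sp: "space \<mu> = X" by (rule space_borel_probs[OF \<mu>])
  have i1: "integrable \<mu> \<phi>" by (rule integrable_continuous[OF assms(2,3) \<mu>])
  have i2: "integrable \<mu> (\<lambda>x. b (pre x k))" by (rule integral_cyl(1)[OF X \<mu>])
  have "(\<integral>x. \<phi> x \<partial>\<mu>) - (\<Sum>u\<in>block p k. b u * cyl_meas p X \<mu> u) = (\<integral>x. \<phi> x - b (pre x k) \<partial>\<mu>)"
    unfolding integral_cyl(2)[OF X \<mu>, symmetric] using i1 i2 by simp
  also have "\<bar>\<dots>\<bar> \<le> (\<integral>x. \<bar>\<phi> x - b (pre x k)\<bar> \<partial>\<mu>)" by (rule integral_abs_bound)
  also have "\<dots> \<le> (\<integral>x. \<delta> \<partial>\<mu>)"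
    using i1 i2 b sp by (intro integral_mono) auto
  also have "\<dots> = \<delta>" using prob_space by simp
  finally show ?thesis .
qed

lemma sum_visits:
  fixes b :: "nat list \<Rightarrow> real"
  assumes "\<And>i. i < n \<Longrightarrow> (shift_map ^^ i) x \<in> full_shift p"
  shows "(\<Sum>i<n. b (pre ((shift_map ^^ i) x) k)) = (\<Sum>u\<in>block p k. b u * real (visits u x n))"
proof -
  have "(\<Sum>u\<in>block p k. b u * real (visits u x n)) =
    (\<Sum>u\<in>block p k. \<Sum>i<n. b u * of_bool (pre ((shift_map ^^ i) x) (length u) = u))"
    by (simp only: visits_def of_nat_sum sum_distrib_left of_nat_of_bool)
  also have "\<dots> = (\<Sum>i<n. \<Sum>u\<in>block p k. b u * of_bool (pre ((shift_map ^^ i) x) (length u) = u))"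
    by (rule sum.swap)
  also have "\<dots> = (\<Sum>i<n. \<Sum>u\<in>block p k. if u = pre ((shift_map ^^ i) x) k then b u else 0)"
    by (intro sum.cong refl) (auto simp: block_def)
  also have "\<dots> = (\<Sum>i<n. b (pre ((shift_map ^^ i) x) k))"
    using assms pre_block by (intro sum.cong refl) auto
  finally show ?thesis by simp
qed

lemma funpow_shift_in:
  "shift_map ` X \<subseteq> X \<Longrightarrow> x \<in> X \<Longrightarrow> (shift_map ^^ i) x \<in> X"
  using funpow_space[of shift_map X x i] by auto

lemma birkhoff_approx:
  fixes \<phi> :: "(nat \<Rightarrow> nat) \<Rightarrow> real"
  assumes X: "X \<subseteq> full_shift p" "shift_map ` X \<subseteq> X" and x: "x \<in> X"
    and b: "\<And>x. x \<in> X \<Longrightarrow> \<bar>\<phi> x - b (pre x k)\<bar> \<le> \<delta>"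
  shows "\<bar>(\<Sum>i<n. \<phi> ((shift_map ^^ i) x)) - (\<Sum>u\<in>block p k. b u * real (visits u x n))\<bar> \<le> real n * \<delta>"
proof -
  have in_X: "(shift_map ^^ i) x \<in> X" for i by (rule funpow_shift_in[OF X(2) x])
  have "(\<Sum>u\<in>block p k. b u * real (visits u x n)) = (\<Sum>i<n. b (pre ((shift_map ^^ i) x) k))"
    by (rule sum_visits[symmetric]) (use in_X X(1) in blast)
  then have "\<bar>(\<Sum>i<n. \<phi> ((shift_map ^^ i) x)) - (\<Sum>u\<in>block p k. b u * real (visits u x n))\<bar> =
    \<bar>\<Sum>i<n. \<phi> ((shift_map ^^ i) x) - b (pre ((shift_map ^^ i) x) k)\<bar>"
    by (simp add: sum_subtractf)
  also have "\<dots> \<le> (\<Sum>i<n. \<delta>)"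
    using b[OF in_X] by (intro order_trans[OF sum_abs] sum_mono) auto
  finally show ?thesis by simp
qed

text \<open>By invariance the expected number of visits is exactly
  \<open>m * cyl_meas p X \<mu> u\<close>, and \<open>occ\<close> differs from \<open>visits\<close>
  by at most \<open>length u\<close> at every point.\<close>

lemma expected_occ:
  assumes X: "X \<subseteq> full_shift p" "shift_map ` X \<subseteq> X" and \<mu>: "\<mu> \<in> invariant_measures X"
  shows "\<bar>(\<Sum>w\<in>block p m. cyl_meas p X \<mu> w * real (occ u w)) - real m * cyl_meas p X \<mu> u\<bar> \<le> real (length u)"
proof -
  interpret pmpt \<mu> shift_map by (rule pmpt_shift[OF X(2) \<mu>])
  have \<mu>': "\<mu> \<in> borel_probs X" using \<mu> by (simp add: invariant_measures_def)
  have sp: "space \<mu> = X" by (rule space_borel_probs[OF \<mu>'])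
  have m: "cylinder p u \<inter> X \<in> events"
    using sets_cylinder[OF X(1)] \<mu>' by (simp add: borel_probs_def)
  have in_X: "(shift_map ^^ i) x \<in> X" if "x \<in> X" for i x by (rule funpow_shift_in[OF X(2) that])
  let ?A = "\<lambda>i. (shift_map ^^ i) -` (cylinder p u \<inter> X) \<inter> space \<mu>"
  have mA: "?A i \<in> events" for i by (rule measurable_sets[OF funpow_meas m])
  have v: "real (visits u x m) = (\<Sum>i<m. indicator (?A i) x)" if "x \<in> space \<mu>" for x
    using that sp in_X unfolding visits_def of_nat_sum
    by (intro sum.cong) (auto simp: cylinder_Int[OF X(1)] indicator_def)
  have int: "integrable \<mu> (\<lambda>x. indicator (?A i) x :: real)" for i
    using mA by (simp add: less_top[symmetric])
  have intv: "integrable \<mu> (\<lambda>x. real (visits u x m))"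
    by (subst Bochner_Integration.integrable_cong[OF refl v]) (use int in auto)
  have "(\<integral>x. real (visits u x m) \<partial>\<mu>) = (\<integral>x. (\<Sum>i<m. indicator (?A i) x) \<partial>\<mu>)"
    by (rule Bochner_Integration.integral_cong[OF refl v])
  also have "\<dots> = (\<Sum>i<m. \<integral>x. indicator (?A i) x \<partial>\<mu>)"
    using int by (intro Bochner_Integration.integral_sum)
  also have "\<dots> = (\<Sum>i<m. prob (?A i))" using mA by simp
  also have "\<dots> = real m * cyl_meas p X \<mu> u"
    using prob_funpow[OF m] by (simp add: cyl_meas_def)
  finally have ev: "(\<integral>x. real (visits u x m) \<partial>\<mu>) = real m * cyl_meas p X \<mu> u" .
  have into: "integrable \<mu> (\<lambda>x. real (occ u (pre x m)))"
    using integral_cyl(1)[OF X(1) \<mu>', of "\<lambda>w. real (occ u w)"] .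
  have eo: "(\<integral>x. real (occ u (pre x m)) \<partial>\<mu>) = (\<Sum>w\<in>block p m. cyl_meas p X \<mu> w * real (occ u w))"
    using integral_cyl(2)[OF X(1) \<mu>', of "\<lambda>w. real (occ u w)"] by (simp add: mult.commute)
  have "\<bar>(\<integral>x. real (occ u (pre x m)) \<partial>\<mu>) - (\<integral>x. real (visits u x m) \<partial>\<mu>)\<bar> =
    \<bar>\<integral>x. real (occ u (pre x m)) - real (visits u x m) \<partial>\<mu>\<bar>"
    using into intv by simp
  also have "\<dots> \<le> (\<integral>x. \<bar>real (occ u (pre x m)) - real (visits u x m)\<bar> \<partial>\<mu>)" by (rule integral_abs_bound)
  also have "\<dots> \<le> (\<integral>x. real (length u) \<partial>\<mu>)"
  proof (intro integral_mono)
    show "\<bar>real (occ u (pre x m)) - real (visits u x m)\<bar> \<le> real (length u)" for x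
      using visits_occ[of u x m] by linarith
  qed (use into intv in auto)
  also have "\<dots> = real (length u)" using prob_space by simp
  finally show ?thesis unfolding ev eo .
qed

lemma topspace_weak_star: "topspace (weak_star X) = borel_probs X"
proof -
  have "borel_probs X \<in> {{\<mu> \<in> borel_probs X. (\<integral>x. f x \<partial>\<mu>) \<in> U} | f U. continuous_on X f \<and> open (U :: real set)}"
    by (intro CollectI exI[of _ "\<lambda>_. 0"] exI[of _ UNIV]) auto
  then show ?thesis unfolding weak_star_def by auto
qed

text \<open>Cylinders are open and closed, so their indicators are continuous test functions. The
  map transports compactness and connectedness of \<open>K\<close> to a metric space.\<close>

lemma continuous_map_cyl_meas:
  assumes X: "X \<subseteq> full_shift p"
  shows "continuous_map (weak_star X) euclidean (cyl_meas p X)"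
proof -
  have "continuous_map (weak_star X) euclideanreal (\<lambda>\<mu>. cyl_meas p X \<mu> w)" for w
    unfolding continuous_map_def
  proof (intro conjI allI impI)
    fix U :: "real set" assume "openin euclidean U"
    then have U: "open U" by simp
    let ?f = "\<lambda>x. indicator {w} (pre x (length w)) :: real"
    have "continuous_on X ?f"
    proof -
      have "continuous_on UNIV ?f"
        unfolding continuous_on_open_vimage[OF open_UNIV]
      proof (intro allI impI)
        fix B :: "real set"
        have "?f -` B \<inter> UNIV = {x. pre x (length w) \<in> {v. indicator {w} v \<in> B}}" by auto
        then show "open (?f -` B \<inter> UNIV)" by (simp only: open_prefix_set)
      qed
      then show ?thesis using continuous_on_subset by blast
    qed
    then have "openin (weak_star X) {\<mu> \<in> borel_probs X. (\<integral>x. ?f x \<partial>\<mu>) \<in> U}"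
      unfolding weak_star_def using U by (intro topology_generated_by_Basis) blast
    moreover have "(\<integral>x. ?f x \<partial>\<mu>) = cyl_meas p X \<mu> w" if \<mu>: "\<mu> \<in> borel_probs X" for \<mu>
    proof -
      have sp: "space \<mu> = X" by (rule space_borel_probs[OF \<mu>])
      have "(\<integral>x. ?f x \<partial>\<mu>) = (\<integral>x. indicator (cylinder p w \<inter> X) x \<partial>\<mu>)"
        using sp by (intro Bochner_Integration.integral_cong) (auto simp: cylinder_Int[OF X] indicator_def)
      then show ?thesis using sets_cylinder[OF X] \<mu> by (simp add: borel_probs_def cyl_meas_def)
    qed
    then have "{\<mu> \<in> borel_probs X. (\<integral>x. ?f x \<partial>\<mu>) \<in> U} = {\<mu> \<in> topspace (weak_star X). cyl_meas p X \<mu> w \<in> U}"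
      by (auto simp: topspace_weak_star)
    ultimately show "openin (weak_star X) {\<mu> \<in> topspace (weak_star X). cyl_meas p X \<mu> w \<in> U}" by simp
  qed simp
  then show ?thesis
    unfolding euclidean_product_topology[symmetric] continuous_map_componentwise_UNIV by simp
qed

text \<open>Conversely, finitely many cylinder measures control each weak* neighbourhood. The
  induction follows the generation of the topology; for a subbasic set, the test function is
  uniformly close to a function of a prefix, which has a finite combination of cylinder measures as
  its integral.\<close>

lemma weak_star_nbhd:
  assumes X: "X \<subseteq> full_shift p" "compact X" and U: "openin (weak_star X) U" and \<mu>: "\<mu> \<in> U" "\<mu> \<in> borel_probs X"
  shows "\<exists>F \<epsilon>. finite F \<and> F \<subseteq> words p \<and> \<epsilon> > 0 \<and>
    (\<forall>\<nu>\<in>borel_probs X. (\<forall>w\<in>F. \<bar>cyl_meas p X \<nu> w - cyl_meas p X \<mu> w\<bar> < \<epsilon>) \<longrightarrow> \<nu> \<in> U)"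
proof -
  have "generate_topology_on {{\<mu> \<in> borel_probs X. (\<integral>x. f x \<partial>\<mu>) \<in> U} | f U. continuous_on X f \<and> open (U :: real set)} U"
    using U unfolding weak_star_def by (rule openin_topology_generated_by)
  then show ?thesis using \<mu>(1)
  proof induction
    case (Int a b)
    obtain F e where F: "finite F" "F \<subseteq> words p" "e > 0"
      "\<forall>\<nu>\<in>borel_probs X. (\<forall>w\<in>F. \<bar>cyl_meas p X \<nu> w - cyl_meas p X \<mu> w\<bar> < e) \<longrightarrow> \<nu> \<in> a" using Int by blast
    obtain F' e' where F': "finite F'" "F' \<subseteq> words p" "e' > 0"
      "\<forall>\<nu>\<in>borel_probs X. (\<forall>w\<in>F'. \<bar>cyl_meas p X \<nu> w - cyl_meas p X \<mu> w\<bar> < e') \<longrightarrow> \<nu> \<in> b" using Int by blast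
    show ?case using F F' by (intro exI[of _ "F \<union> F'"] exI[of _ "min e e'"]) auto
  next
    case (UN K)
    then obtain k where k: "k \<in> K" "\<mu> \<in> k" by auto
    obtain F e where F: "finite F" "F \<subseteq> words p" "e > 0"
      "\<forall>\<nu>\<in>borel_probs X. (\<forall>w\<in>F. \<bar>cyl_meas p X \<nu> w - cyl_meas p X \<mu> w\<bar> < e) \<longrightarrow> \<nu> \<in> k"
      using UN.IH[OF k] by blast
    show ?case using F k by (intro exI[of _ F] exI[of _ e]) auto
  next
    case (Basis s)
    then obtain f :: "(nat \<Rightarrow> nat) \<Rightarrow> real" and V :: "real set" where f: "continuous_on X f" "open V" "s = {\<mu> \<in> borel_probs X. (\<integral>x. f x \<partial>\<mu>) \<in> V}" by blast
    then have "(\<integral>x. f x \<partial>\<mu>) \<in> V" using Basis by auto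
    then obtain e where e: "e > 0" "ball (\<integral>x. f x \<partial>\<mu>) e \<subseteq> V" using f(2) open_contains_ball by blast
    obtain k b where kb: "\<And>x. x \<in> X \<Longrightarrow> \<bar>f x - b (pre x k)\<bar> \<le> e / 4"
    proof -
      have "e / 4 > 0" using e(1) by simp
      then show ?thesis using locally_constant_approx[OF X(2) f(1)] that by blast
    qed
    define B where "B = (\<Sum>u\<in>block p k. \<bar>b u\<bar>) + 1"
    have B: "B > 0" by (auto simp: B_def intro!: add_nonneg_pos sum_nonneg)
    have "\<nu> \<in> s" if \<nu>: "\<nu> \<in> borel_probs X" and
      close: "\<forall>w\<in>block p k. \<bar>cyl_meas p X \<nu> w - cyl_meas p X \<mu> w\<bar> < e / (4 * B)" for \<nu>
    proof -
      have "\<bar>(\<Sum>u\<in>block p k. b u * cyl_meas p X \<nu> u) - (\<Sum>u\<in>block p k. b u * cyl_meas p X \<mu> u)\<bar> =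
        \<bar>\<Sum>u\<in>block p k. b u * (cyl_meas p X \<nu> u - cyl_meas p X \<mu> u)\<bar>"
        by (simp add: sum_subtractf algebra_simps)
      also have "\<dots> \<le> (\<Sum>u\<in>block p k. \<bar>b u\<bar> * (e / (4 * B)))"
      proof (intro order_trans[OF sum_abs] sum_mono)
        fix u assume "u \<in> block p k"
        then have "\<bar>cyl_meas p X \<nu> u - cyl_meas p X \<mu> u\<bar> \<le> e / (4 * B)" using close by (simp add: less_imp_le)
        then show "\<bar>b u * (cyl_meas p X \<nu> u - cyl_meas p X \<mu> u)\<bar> \<le> \<bar>b u\<bar> * (e / (4 * B))"
          unfolding abs_mult by (rule mult_left_mono) simp
      qed
      also have "\<dots> = (B - 1) * (e / (4 * B))"
        unfolding B_def by (simp only: sum_distrib_right[symmetric] add_diff_cancel_right')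
      also have "\<dots> \<le> B * (e / (4 * B))" using B e(1) by (intro mult_right_mono) auto
      also have "\<dots> = e / 4" using B by simp
      finally have "\<bar>(\<integral>x. f x \<partial>\<nu>) - (\<integral>x. f x \<partial>\<mu>)\<bar> < e"
        using integral_approx[OF X f(1) \<nu> kb] integral_approx[OF X f(1) \<mu>(2) kb] e(1) by linarith
      then show ?thesis using e(2) \<nu> f(3) by (auto simp: dist_real_def abs_minus_commute)
    qed
    moreover have "block p k \<subseteq> words p" by (auto simp: block_def)
    ultimately show ?case using e(1) B
      by (intro exI[of _ "block p k"] exI[of _ "e / (4 * B)"]) auto
  qed auto
qed

text \<open>The raw \<open>measure_of\<close> term is identified with the image of the uniform
  measure on \<open>{..<n}\<close> under \<open>i \<mapsto> (shift_map ^^ i) x\<close>; countable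
  additivity comes from there.\<close>

lemma empirical_measure:
  assumes X: "X \<subseteq> full_shift p" "shift_map ` X \<subseteq> X" and x: "x \<in> X" and n: "n > 0"
  shows "empirical_measure X n x \<in> borel_probs X"
    and "cyl_meas p X (empirical_measure X n x) w = real (visits w x n) / real n"
proof -
  let ?N = "restrict_space borel X"
  let ?U = "uniform_count_measure {..<n}"
  define y where "y i = (shift_map ^^ i) x" for i
  have y: "y i \<in> X" for i unfolding y_def by (rule funpow_shift_in[OF X(2) x])
  have spN: "space ?N = X" by (simp add: space_restrict_space)
  have ym: "y \<in> measurable ?U ?N"
    using y spN by (intro measurableI) (auto simp: space_uniform_count_measure sets_uniform_count_measure)
  interpret U: prob_space ?U using n by (intro prob_space_uniform_count_measure) auto
  have prob: "prob_space (distr ?U ?N y)" by (rule U.prob_space_distr[OF ym])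
  have em: "emeasure (distr ?U ?N y) A = ennreal (1 / real n) * (\<Sum>i<n. emeasure (return ?N (y i)) A)"
    if A: "A \<in> sets ?N" for A
  proof -
    have l: "emeasure (distr ?U ?N y) A = ennreal (real (card (y -` A \<inter> {..<n})) / real n)"
      using A ym by (simp add: emeasure_distr space_uniform_count_measure emeasure_uniform_count_measure)
    have "(\<Sum>i<n. emeasure (return ?N (y i)) A) = (\<Sum>i<n. indicator A (y i))"
      using A by simp
    also have "\<dots> = (\<Sum>i<n. of_nat (of_bool (y i \<in> A)))" by (intro sum.cong) (auto simp: indicator_def)
    also have "\<dots> = of_nat (\<Sum>i<n. of_bool (y i \<in> A))" by (simp only: of_nat_sum)
    also have "(\<Sum>i<n. of_bool (y i \<in> A)) = card (y -` A \<inter> {..<n})"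
      by (simp add: of_bool_def sum.If_cases Int_commute vimage_def)
    finally show ?thesis
      unfolding l by (simp add: ennreal_of_nat_eq_real_of_nat ennreal_mult[symmetric])
  qed
  have "empirical_measure X n x = measure_of X (sets ?N) (emeasure (distr ?U ?N y))"
    unfolding empirical_measure_def y_def[symmetric]
  proof (rule measure_of_eq)
    show "sets ?N \<subseteq> Pow X" using sets.space_closed[of ?N] spN by simp
    fix A assume "A \<in> sigma_sets X (sets ?N)"
    then have "A \<in> sets ?N" using sets.sigma_sets_eq[of ?N] spN by simp
    then show "ennreal (1 / real n) * (\<Sum>i<n. emeasure (return ?N (y i)) A) = emeasure (distr ?U ?N y) A"
      using em by simp
  qed
  also have "\<dots> = distr ?U ?N y"
    using measure_of_of_measure[of "distr ?U ?N y"] spN by simp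
  finally have eq: "empirical_measure X n x = distr ?U ?N y" .
  show "empirical_measure X n x \<in> borel_probs X"
    unfolding eq borel_probs_def using prob by simp
  have "cyl_meas p X (empirical_measure X n x) w = measure ?U (y -` (cylinder p w \<inter> X) \<inter> {..<n})"
    unfolding eq cyl_meas_def using ym sets_cylinder[OF X(1)]
    by (simp add: measure_distr space_uniform_count_measure)
  also have "\<dots> = real (card (y -` (cylinder p w \<inter> X) \<inter> {..<n})) / real n"
    by (simp add: measure_uniform_count_measure)
  also have "card (y -` (cylinder p w \<inter> X) \<inter> {..<n}) = visits w x n"
  proof -
    have "y -` (cylinder p w \<inter> X) \<inter> {..<n} = {i \<in> {..<n}. pre ((shift_map ^^ i) x) (length w) = w}"
      using y by (auto simp: cylinder_Int[OF X(1)] y_def)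
    then show ?thesis by (simp add: visits_def of_bool_def sum.If_cases Int_def)
  qed
  finally show "cyl_meas p X (empirical_measure X n x) w = real (visits w x n) / real n" .
qed

definition frequency :: "(nat \<Rightarrow> nat) \<Rightarrow> nat \<Rightarrow> nat list \<Rightarrow> real" where
  "frequency x n w = real (visits w x n) / real n"

text \<open>From here on saturated sets are a matter of counting. The times are restricted to
  \<open>n > 0\<close>, where the empirical measure is a probability.\<close>

lemma limit_points_empirical:
  assumes X: "X \<subseteq> full_shift p" "compact X" "shift_map ` X \<subseteq> X" and x: "x \<in> X"
  shows "\<mu> \<in> seq_limit_points (weak_star X) (\<lambda>n. empirical_measure X n x) \<longleftrightarrow>
    \<mu> \<in> borel_probs X \<and> (\<forall>F \<epsilon>. finite F \<longrightarrow> F \<subseteq> words p \<longrightarrow> \<epsilon> > 0 \<longrightarrow>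
      (\<exists>\<^sub>F n in sequentially. \<forall>w\<in>F. \<bar>frequency x n w - cyl_meas p X \<mu> w\<bar> < \<epsilon>))"
    (is "?L \<longleftrightarrow> ?R")
proof
  have fr: "frequency x n w = cyl_meas p X (empirical_measure X n x) w" if "n > 0" for n w
    using empirical_measure(2)[OF X(1,3) x that] by (simp add: frequency_def)
  show ?R if L: ?L
  proof (intro conjI allI impI)
    show \<mu>: "\<mu> \<in> borel_probs X" using L by (simp add: seq_limit_points_def topspace_weak_star)
    fix F \<epsilon> assume F: "finite F" "F \<subseteq> words p" "(\<epsilon> :: real) > 0"
    have cm: "continuous_map (weak_star X) euclideanreal (\<lambda>\<mu>. cyl_meas p X \<mu> w)" for w
      using continuous_map_cyl_meas[OF X(1)]
      unfolding euclidean_product_topology[symmetric] continuous_map_componentwise_UNIV by simp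
    define V where "V w = {\<nu> \<in> topspace (weak_star X). cyl_meas p X \<nu> w \<in> ball (cyl_meas p X \<mu> w) \<epsilon>}" for w
    have "openin (weak_star X) (V w)" for w
      unfolding V_def using cm[of w] by (rule openin_continuous_map_preimage) simp
    then have "openin (weak_star X) (topspace (weak_star X) \<inter> (\<Inter>w\<in>F. V w))"
      using F(1) openin_Inter[of "V ` F" "weak_star X"] by (cases "F = {}") (auto intro: openin_Int)
    moreover have "\<mu> \<in> topspace (weak_star X) \<inter> (\<Inter>w\<in>F. V w)"
      using \<mu> F(3) by (auto simp: V_def topspace_weak_star)
    ultimately have "\<exists>\<^sub>F n in sequentially. empirical_measure X n x \<in> topspace (weak_star X) \<inter> (\<Inter>w\<in>F. V w)"
      using L unfolding seq_limit_points_def by blast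
    moreover have "\<forall>\<^sub>F n::nat in sequentially. n > 0" by (rule eventually_gt_at_top)
    ultimately have "\<exists>\<^sub>F n in sequentially. empirical_measure X n x \<in> topspace (weak_star X) \<inter> (\<Inter>w\<in>F. V w) \<and> n > 0"
      by (rule frequently_eventually_frequently)
    then show "\<exists>\<^sub>F n in sequentially. \<forall>w\<in>F. \<bar>frequency x n w - cyl_meas p X \<mu> w\<bar> < \<epsilon>"
      by (rule frequently_elim1) (auto simp: V_def fr dist_real_def abs_minus_commute)
  qed
  show ?L if R: ?R
    unfolding seq_limit_points_def topspace_weak_star
  proof (intro CollectI conjI allI impI)
    show \<mu>: "\<mu> \<in> borel_probs X" using R by simp
    fix U assume U: "openin (weak_star X) U \<and> \<mu> \<in> U"
    obtain F \<epsilon> where F: "finite F" "F \<subseteq> words p" "\<epsilon> > 0"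
      "\<forall>\<nu>\<in>borel_probs X. (\<forall>w\<in>F. \<bar>cyl_meas p X \<nu> w - cyl_meas p X \<mu> w\<bar> < \<epsilon>) \<longrightarrow> \<nu> \<in> U"
      using weak_star_nbhd[OF X(1,2) _ _ \<mu>, of U] U by blast
    have "\<exists>\<^sub>F n in sequentially. \<forall>w\<in>F. \<bar>frequency x n w - cyl_meas p X \<mu> w\<bar> < \<epsilon>"
      using R F(1-3) by blast
    moreover have "\<forall>\<^sub>F n::nat in sequentially. n > 0" by (rule eventually_gt_at_top)
    ultimately have "\<exists>\<^sub>F n in sequentially. (\<forall>w\<in>F. \<bar>frequency x n w - cyl_meas p X \<mu> w\<bar> < \<epsilon>) \<and> n > 0"
      by (rule frequently_eventually_frequently)
    then show "\<exists>\<^sub>F n in sequentially. empirical_measure X n x \<in> U"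
      by (rule frequently_elim1) (use F(4) empirical_measure(1)[OF X(1,3) x] in \<open>auto simp: fr\<close>)
  qed
qed

section \<open>Chains in compact connected sets\<close>

definition chainable :: "'a::metric_space set \<Rightarrow> real \<Rightarrow> 'a \<Rightarrow> 'a \<Rightarrow> bool" where
  "chainable C e x y \<longleftrightarrow> (\<exists>l. l \<noteq> [] \<and> set l \<subseteq> C \<and> hd l = x \<and> last l = y \<and>
    (\<forall>i. Suc i < length l \<longrightarrow> dist (l ! i) (l ! Suc i) < e))"

lemma chain_append:
  assumes "l \<noteq> []" "m \<noteq> []" "\<forall>i. Suc i < length l \<longrightarrow> dist (l ! i) (l ! Suc i) < e"
    "\<forall>i. Suc i < length m \<longrightarrow> dist (m ! i) (m ! Suc i) < e" "dist (last l) (hd m) < e"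
  shows "\<forall>i. Suc i < length (l @ m) \<longrightarrow> dist ((l @ m) ! i) ((l @ m) ! Suc i) < e"
proof (intro allI impI)
  fix i assume i: "Suc i < length (l @ m)"
  consider "Suc i < length l" | "Suc i = length l" | "length l \<le> i" by linarith
  then show "dist ((l @ m) ! i) ((l @ m) ! Suc i) < e"
  proof cases
    case 1
    then show ?thesis using assms(3) by (simp add: nth_append)
  next
    case 2
    then have "i = length l - 1" by simp
    then have "(l @ m) ! i = last l" "(l @ m) ! Suc i = hd m"
      using 2 assms(1,2) by (auto simp: nth_append last_conv_nth hd_conv_nth)
    then show ?thesis using assms(5) by simp
  next
    case 3
    then have "(l @ m) ! i = m ! (i - length l)" "(l @ m) ! Suc i = m ! Suc (i - length l)"
      by (auto simp: nth_append Suc_diff_le)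
    moreover have "Suc (i - length l) < length m" using i 3 by simp
    ultimately show ?thesis using assms(4) by simp
  qed
qed

lemma chainable_refl: "x \<in> C \<Longrightarrow> chainable C e x x"
  unfolding chainable_def by (intro exI[of _ "[x]"]) auto

lemma chainable_step:
  assumes "chainable C e x y" "z \<in> C" "dist y z < e"
  shows "chainable C e x z"
proof -
  obtain l where l: "l \<noteq> []" "set l \<subseteq> C" "hd l = x" "last l = y"
    "\<forall>i. Suc i < length l \<longrightarrow> dist (l ! i) (l ! Suc i) < e" using assms(1) unfolding chainable_def by blast
  show ?thesis unfolding chainable_def
    using l assms(2,3) chain_append[of l "[z]" e] by (intro exI[of _ "l @ [z]"]) auto
qed

text \<open>Points that an \<open>e\<close>-chain from \<open>x\<close> reaches and points that it
  does not reach are at distance at least \<open>e\<close>, so the balls of radius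
  \<open>e / 2\<close> about the two kinds would disconnect \<open>C\<close>.\<close>

lemma connected_chainable:
  assumes "connected C" "e > 0" "x \<in> C" "y \<in> C"
  shows "chainable C e x y"
proof (rule ccontr)
  assume no: "\<not> chainable C e x y"
  define R where "R = {z \<in> C. chainable C e x z}"
  define A where "A = (\<Union>z\<in>R. ball z (e / 2))"
  define B where "B = (\<Union>z\<in>C - R. ball z (e / 2))"
  have "A \<inter> B \<inter> C = {}"
  proof (rule ccontr)
    assume "A \<inter> B \<inter> C \<noteq> {}"
    then obtain w where w: "w \<in> A" "w \<in> B" by blast
    obtain z where z: "z \<in> R" "dist z w < e / 2" using w(1) by (auto simp: A_def)
    obtain z' where z': "z' \<in> C - R" "dist z' w < e / 2" using w(2) by (auto simp: B_def)
    have "dist z z' < e" using z z' dist_triangle_half_l[of z w e z'] by simp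
    then have "chainable C e x z'" using z z' chainable_step[of C e x z z'] by (simp add: R_def)
    then show False using z' by (simp add: R_def)
  qed
  moreover have "C \<subseteq> A \<union> B"
  proof
    fix z assume "z \<in> C"
    moreover have "z \<in> ball z (e / 2)" using assms(2) by simp
    ultimately show "z \<in> A \<union> B" unfolding A_def B_def by blast
  qed
  moreover have "A \<inter> C \<noteq> {}"
  proof -
    have "x \<in> R" "x \<in> ball x (e / 2)" using assms(2,3) chainable_refl[of x C e] by (auto simp: R_def)
    then show ?thesis using assms(3) unfolding A_def by blast
  qed
  moreover have "B \<inter> C \<noteq> {}"
  proof -
    have "y \<in> C - R" "y \<in> ball y (e / 2)" using assms(2,4) no by (auto simp: R_def)
    then show ?thesis using assms(4) unfolding B_def by blast
  qed
  moreover have "open A" "open B" by (auto simp: A_def B_def)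
  ultimately show False using assms(1) unfolding connected_def by blast
qed

text \<open>The chain is a loop at \<open>c\<close>, so that the chains for smaller and smaller \<open>e\<close> can be concatenated.\<close>

lemma chain_loop:
  assumes C: "compact C" "connected C" and c: "c \<in> C" and e: "e > (0::real)"
  obtains l where "l \<noteq> []" "set l \<subseteq> C" "hd l = c" "last l = c"
    "\<forall>i. Suc i < length l \<longrightarrow> dist (l ! i) (l ! Suc i) < e" "\<forall>y\<in>C. \<exists>z\<in>set l. dist z y < e"
proof -
  obtain F where F: "finite F" "F \<subseteq> C" "C \<subseteq> (\<Union>x\<in>F. ball x e)"
    using compactE_image[OF C(1), of C "\<lambda>x. ball x e"] e by (metis UN_I centre_in_ball open_ball subsetI)
  have "\<exists>l. l \<noteq> [] \<and> set l \<subseteq> C \<and> hd l = c \<and> last l = c \<and>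
    (\<forall>i. Suc i < length l \<longrightarrow> dist (l ! i) (l ! Suc i) < e) \<and> F \<subseteq> set l"
    using F(1,2)
  proof (induction F)
    case empty
    show ?case using c by (intro exI[of _ "[c]"]) auto
  next
    case (insert x F)
    then obtain l where l: "l \<noteq> []" "set l \<subseteq> C" "hd l = c" "last l = c"
      "\<forall>i. Suc i < length l \<longrightarrow> dist (l ! i) (l ! Suc i) < e" "F \<subseteq> set l" by auto
    obtain a where a: "a \<noteq> []" "set a \<subseteq> C" "hd a = c" "last a = x"
      "\<forall>i. Suc i < length a \<longrightarrow> dist (a ! i) (a ! Suc i) < e"
      using connected_chainable[OF C(2) e c, of x] insert.prems unfolding chainable_def by auto
    obtain b where b: "b \<noteq> []" "set b \<subseteq> C" "hd b = x" "last b = c"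
      "\<forall>i. Suc i < length b \<longrightarrow> dist (b ! i) (b ! Suc i) < e"
      using connected_chainable[OF C(2) e _ c, of x] insert.prems unfolding chainable_def by auto
    have 1: "\<forall>i. Suc i < length (a @ b) \<longrightarrow> dist ((a @ b) ! i) ((a @ b) ! Suc i) < e"
      using a b e by (intro chain_append) auto
    have "\<forall>i. Suc i < length (l @ (a @ b)) \<longrightarrow> dist ((l @ (a @ b)) ! i) ((l @ (a @ b)) ! Suc i) < e"
      using a b l e 1 by (intro chain_append) auto
    moreover have "x \<in> set a" using a by auto
    ultimately show ?case using l a b by (intro exI[of _ "l @ (a @ b)"]) auto
  qed
  then obtain l where l: "l \<noteq> []" "set l \<subseteq> C" "hd l = c" "last l = c"
    "\<forall>i. Suc i < length l \<longrightarrow> dist (l ! i) (l ! Suc i) < e" "F \<subseteq> set l" by blast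
  have "\<forall>y\<in>C. \<exists>z\<in>set l. dist z y < e" using F(3) l(6) by force
  then show ?thesis using that l by blast
qed

text \<open>Walks through the infinite concatenation of the lists \<open>L 0\<close>,
  \<open>L 1\<close>, and so on; the pair consists of the number of the list and the position in
  it.\<close>

fun concat_pos :: "(nat \<Rightarrow> 'a list) \<Rightarrow> nat \<Rightarrow> nat \<times> nat" where
  "concat_pos L 0 = (0, 0)"
| "concat_pos L (Suc n) =
    (let (j, i) = concat_pos L n in if Suc i < length (L j) then (j, Suc i) else (Suc j, 0))"

text \<open>Concatenates loops at one base point with steps below \<open>1 / Suc j\<close>. At a
  junction the base point is repeated, so the step there is 0.\<close>

lemma slow_dense_sequence:
  fixes C :: "'a::metric_space set"
  assumes C: "compact C" "connected C" "C \<noteq> {}"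
  obtains c where "range c \<subseteq> C" "(\<lambda>n. dist (c n) (c (Suc n))) \<longlonglongrightarrow> 0"
    "\<And>y e. y \<in> C \<Longrightarrow> e > 0 \<Longrightarrow> \<exists>\<^sub>F n in sequentially. dist (c n) y < e"
proof -
  obtain c0 where c0: "c0 \<in> C" using C(3) by auto
  define ok where "ok l e \<longleftrightarrow> l \<noteq> [] \<and> set l \<subseteq> C \<and> hd l = c0 \<and> last l = c0 \<and>
    (\<forall>i. Suc i < length l \<longrightarrow> dist (l ! i) (l ! Suc i) < e) \<and> (\<forall>y\<in>C. \<exists>z\<in>set l. dist z y < e)" for l e
  have "\<exists>l. ok l (1 / real (Suc j))" for j
  proof -
    obtain l where "l \<noteq> []" "set l \<subseteq> C" "hd l = c0" "last l = c0"
      "\<forall>i. Suc i < length l \<longrightarrow> dist (l ! i) (l ! Suc i) < 1 / real (Suc j)"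
      "\<forall>y\<in>C. \<exists>z\<in>set l. dist z y < 1 / real (Suc j)"
      by (rule chain_loop[OF C(1,2) c0, of "1 / real (Suc j)"]) auto
    then show ?thesis unfolding ok_def by blast
  qed
  then obtain L where L: "\<And>j. ok (L j) (1 / real (Suc j))" by metis
  have len: "length (L j) > 0" for j using L[of j] by (simp add: ok_def)
  define pos where "pos n = concat_pos L n" for n
  define c where "c n = L (fst (pos n)) ! snd (pos n)" for n
  have pos_Suc: "pos (Suc n) = (if Suc (snd (pos n)) < length (L (fst (pos n)))
      then (fst (pos n), Suc (snd (pos n))) else (Suc (fst (pos n)), 0))" for n
    by (simp add: pos_def split_def Let_def)
  have bound: "snd (pos n) < length (L (fst (pos n)))" for n
  proof (induction n)
    case 0
    then show ?case using len by (simp add: pos_def)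
  next
    case (Suc n)
    then show ?case using len by (simp add: pos_Suc)
  qed
  have mono: "fst (pos n) \<le> fst (pos m)" if "n \<le> m" for n m
    using that
  proof (induction m)
    case (Suc m)
    then show ?case by (cases "n = Suc m") (auto simp: pos_Suc)
  qed simp
  have reach: "\<exists>n. pos n = (j, i)" if "i < length (L j)" for j i
    using that
  proof (induction j arbitrary: i)
    case 0
    then show ?case
    proof (induction i)
      case 0
      show ?case by (intro exI[of _ 0]) (simp add: pos_def)
    next
      case (Suc i)
      then obtain n where "pos n = (0, i)" by auto
      then show ?case using Suc by (intro exI[of _ "Suc n"]) (simp add: pos_Suc)
    qed
  next
    case (Suc j)
    obtain n0 where n0: "pos n0 = (j, length (L j) - 1)" using Suc.IH[of "length (L j) - 1"] len[of j] by auto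
    from Suc.prems show ?case
    proof (induction i)
      case 0
      show ?case using n0 len[of j] by (intro exI[of _ "Suc n0"]) (simp add: pos_Suc)
    next
      case (Suc i)
      then obtain n where "pos n = (Suc j, i)" by auto
      then show ?case using Suc by (intro exI[of _ "Suc n"]) (simp add: pos_Suc)
    qed
  qed
  have step: "dist (c n) (c (Suc n)) \<le> 1 / real (Suc (fst (pos n)))" for n
  proof (cases "Suc (snd (pos n)) < length (L (fst (pos n)))")
    case True
    then show ?thesis using L[of "fst (pos n)"] by (auto simp: c_def pos_Suc ok_def intro: less_imp_le)
  next
    case False
    then have "Suc (snd (pos n)) = length (L (fst (pos n)))" using bound[of n] by simp
    then have "snd (pos n) = length (L (fst (pos n))) - 1" by simp
    then have "c n = last (L (fst (pos n)))" using len[of "fst (pos n)"]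
      by (simp add: c_def last_conv_nth)
    moreover have "c (Suc n) = hd (L (Suc (fst (pos n))))"
      using False len[of "Suc (fst (pos n))"] by (simp add: c_def pos_Suc hd_conv_nth)
    ultimately have "c n = c (Suc n)" using L[of "fst (pos n)"] L[of "Suc (fst (pos n))"] by (simp add: ok_def)
    then show ?thesis by simp
  qed
  show ?thesis
  proof (rule that[of c])
    have "c n \<in> C" for n
      using L[of "fst (pos n)"] nth_mem[OF bound[of n]] unfolding ok_def c_def by blast
    then show "range c \<subseteq> C" by blast
    show "(\<lambda>n. dist (c n) (c (Suc n))) \<longlonglongrightarrow> 0"
    proof (rule LIMSEQ_I)
      fix e :: real assume "e > 0"
      then obtain j where j: "1 / real (Suc j) < e" using nat_approx_posE by (metis inverse_eq_divide)
      obtain n0 where n0: "pos n0 = (j, 0)" using reach[of 0 j] len by auto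
      have "norm (dist (c n) (c (Suc n)) - 0) < e" if "n \<ge> n0" for n
      proof -
        have "j \<le> fst (pos n)" using mono[OF that] n0 by simp
        then have "1 / real (Suc (fst (pos n))) \<le> 1 / real (Suc j)" by (intro divide_left_mono) auto
        then show ?thesis using step[of n] j by simp
      qed
      then show "\<exists>no. \<forall>n\<ge>no. norm (dist (c n) (c (Suc n)) - 0) < e" by blast
    qed
    fix y and e :: real assume y: "y \<in> C" and e: "e > 0"
    show "\<exists>\<^sub>F n in sequentially. dist (c n) y < e"
      unfolding frequently_sequentially
    proof
      fix N
      obtain j0 where j0: "1 / real (Suc j0) < e" using nat_approx_posE[OF e] by (metis inverse_eq_divide)
      \<comment> \<open>A loop later than the one in progress at time \<open>N\<close> is visited
        only after time \<open>N\<close>.\<close>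
      define j where "j = max j0 (Suc (fst (pos N)))"
      have "1 / real (Suc j) \<le> 1 / real (Suc j0)" by (intro divide_left_mono) (auto simp: j_def)
      moreover obtain z where "z \<in> set (L j)" "dist z y < 1 / real (Suc j)" using L[of j] y by (auto simp: ok_def)
      ultimately obtain i where i: "i < length (L j)" "dist (L j ! i) y < e" using j0 by (metis in_set_conv_nth less_trans order_less_le_trans)
      obtain n where n: "pos n = (j, i)" using reach[OF i(1)] by auto
      have "n \<ge> N"
      proof (rule ccontr)
        assume "\<not> n \<ge> N"
        then have "fst (pos n) \<le> fst (pos N)" by (intro mono) simp
        then show False using n by (simp add: j_def)
      qed
      then show "\<exists>n\<ge>N. dist (c n) y < e" using n i by (intro exI[of _ n]) (simp add: c_def)
    qed
  qed
qed

section \<open>Words with the statistics of an invariant measure\<close>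

lemma language_words: "language p X \<subseteq> words p"
  by (auto simp: language_def)

text \<open>Every block pays \<open>g m\<close> edits to enter \<open>G\<close>, and every
  connecting word is an insertion of at most \<tau> letters.\<close>

lemma glue_concat:
  assumes G: "G \<subseteq> language p X"
    and spec: "\<And>v w. v \<in> G \<Longrightarrow> w \<in> G \<Longrightarrow> \<exists>u\<in>language p X. length u \<le> \<tau> \<and> v @ u @ w \<in> G"
    and appr: "\<And>w. w \<in> language p X \<Longrightarrow> \<exists>v\<in>G. edit_dist p v w \<le> g (length w)"
    and s: "set s \<subseteq> language p X \<inter> block p m" "s \<noteq> []"
  shows "\<exists>z\<in>G. z \<in> edit_ball p (real (length s) * (real (g m) + real \<tau>)) (concat s)"
  using s
proof (induction s)
  case (Cons a s)
  have a: "a \<in> language p X" "length a = m" "a \<in> words p" using Cons.prems by (auto simp: block_def)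
  then obtain v where v: "v \<in> G" "edit_dist p v a \<le> g m" using appr by blast
  have vw: "v \<in> words p" using v G language_words by blast
  have va: "v \<in> edit_ball p (real (g m)) a"
    using edits_sym[OF edit_dist_edits[OF vw a(3)]] v(2) unfolding edit_ball_def by auto
  show ?case
  proof (cases "s = []")
    case True
    then show ?thesis using v(1) va by (auto intro!: bexI[of _ v] edit_ball_mono[OF va])
  next
    case False
    then obtain z where z: "z \<in> G" "z \<in> edit_ball p (real (length s) * (real (g m) + real \<tau>)) (concat s)"
      using Cons by auto
    obtain u where u: "u \<in> language p X" "length u \<le> \<tau>" "v @ u @ z \<in> G" using spec[OF v(1) z(1)] by blast
    have uw: "u \<in> words p" using u language_words by blast
    have "v @ u \<in> edit_ball p (real \<tau>) v"
      using edits_insert[OF vw uw] u(2) unfolding edit_ball_def by auto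
    then have "v @ u \<in> edit_ball p (real (g m) + real \<tau>) a" by (rule edit_ball_trans[OF va])
    then have "(v @ u) @ z \<in> edit_ball p ((real (g m) + real \<tau>) + real (length s) * (real (g m) + real \<tau>)) (a @ concat s)"
      using Cons.prems uw vw by (intro edit_ball_append z) (auto simp: words_concat block_def)
    then show ?thesis using u(3) by (intro bexI[of _ "v @ u @ z"]) (auto simp: algebra_simps)
  qed
qed simp

text \<open>First \<open>m\<close> is fixed so large that \<open>g m\<close>, \<tau> and the seams
  are small compared with \<open>m\<close>; only then is the number \<open>N\<close> of blocks
  chosen, for this alphabet of \<open>m\<close>-words. The edits per block stay proportionally small
  however large \<open>N\<close> becomes. The words in \<open>D\<close> are the unedited
  concatenations, which are distinct.\<close>

lemma horseshoe:
  assumes X: "X \<subseteq> full_shift p" "shift_map ` X \<subseteq> X"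
    and G: "G \<subseteq> language p X"
    and spec: "\<And>v w. v \<in> G \<Longrightarrow> w \<in> G \<Longrightarrow> \<exists>u\<in>language p X. length u \<le> \<tau> \<and> v @ u @ w \<in> G"
    and appr: "\<And>w. w \<in> language p X \<Longrightarrow> \<exists>v\<in>G. edit_dist p v w \<le> g (length w)"
    and g: "(\<lambda>n. real (g n) / real n) \<longlonglongrightarrow> 0"
    and \<mu>: "\<mu> \<in> invariant_measures X" and h: "ks_entropy \<mu> shift_map = ereal h"
    and \<epsilon>: "\<epsilon> > 0" and F: "finite F"
  shows "\<exists>l D. l > 0 \<and> D \<subseteq> block p l \<and> real \<tau> \<le> \<epsilon> * real l \<and> 1 \<le> \<epsilon> * real l \<and>
    exp (real l * (h - \<epsilon>)) \<le> real (card D) \<and>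
    (\<forall>W\<in>D. (\<exists>v\<in>G. v \<in> edit_ball p (\<epsilon> * real l) W) \<and>
      (\<forall>u\<in>F. \<bar>real (occ u W) - real l * cyl_meas p X \<mu> u\<bar> \<le> \<epsilon> * real l))"
proof -
  have \<mu>': "\<mu> \<in> borel_probs X" using \<mu> by (simp add: invariant_measures_def)
  obtain K where K: "\<And>u. u \<in> F \<Longrightarrow> length u \<le> K"
    using F by (metis finite_imageI finite_nat_set_iff_bounded_le imageI)
  \<comment> \<open>The factor 4 makes a boundary error of \<open>K\<close> per block at most a
    quarter of \<open>\<epsilon> * m\<close>; the summand 1 yields
    \<open>1 \<le> \<epsilon> * real l\<close>.\<close>
  have "(\<lambda>m. (real \<tau> + 1 + 4 * real K) / real m) \<longlonglongrightarrow> 0" by real_asymp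
  then have "(\<lambda>m. real (g m) / real m + (real \<tau> + 1 + 4 * real K) / real m) \<longlonglongrightarrow> 0 + 0"
    using g by (intro tendsto_add)
  then have "\<forall>\<^sub>F m in sequentially. real (g m) / real m + (real \<tau> + 1 + 4 * real K) / real m < \<epsilon>"
    using \<epsilon> by (intro order_tendstoD(2)) auto
  then have "\<forall>\<^sub>F m in sequentially. real (g m) / real m + (real \<tau> + 1 + 4 * real K) / real m < \<epsilon> \<and> m > 0"
    using eventually_gt_at_top[of 0] by (rule eventually_conj)
  from eventually_happens'[OF sequentially_bot this] obtain m where m0: "m > 0"
    and "real (g m) / real m + (real \<tau> + 1 + 4 * real K) / real m < \<epsilon>" by blast
  then have m: "real (g m) + real \<tau> + 1 + 4 * real K \<le> \<epsilon> * real m"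
    by (simp add: add_divide_distrib[symmetric] divide_less_eq)
  define q where "q = cyl_meas p X \<mu>"
  \<comment> \<open>Words of positive mass lie in the language, and \<open>typical_lists\<close>
    asks for positive masses.\<close>
  define A where "A = {w \<in> block p m. q w > 0}"
  have fA: "finite A" by (simp add: A_def)
  have q1: "(\<Sum>a\<in>A. q a) = 1"
  proof -
    have "(\<Sum>a\<in>A. q a) = (\<Sum>a\<in>block p m. q a)"
      using cyl_meas_nonneg[of p X \<mu>] by (intro sum.mono_neutral_left) (auto simp: A_def q_def less_le)
    then show ?thesis using sum_cyl_meas[OF X(1) \<mu>'] by (simp add: q_def)
  qed
  have A_lang: "A \<subseteq> language p X \<inter> block p m"
    by (auto simp: A_def q_def cyl_meas_def language_def block_def)
  \<comment> \<open>The entropy rate is at most each normalised block entropy, so one fixed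
    \<open>m\<close> suffices here.\<close>
  have H: "real m * h \<le> shannon A q"
  proof -
    obtain h' where h': "\<And>n. n > 0 \<Longrightarrow> h' \<le> entropy_of \<mu> (\<lambda>x. pre x n) / real n" "ks_entropy \<mu> shift_map = ereal h'"
      by (rule ks_entropy_shift[OF X \<mu>]) blast
    have "h \<le> entropy_of \<mu> (\<lambda>x. pre x m) / real m" using h'(1)[OF m0] h'(2) h by simp
    also have "entropy_of \<mu> (\<lambda>x. pre x m) = shannon (block p m) q"
      unfolding q_def by (rule entropy_of_pre[OF X(1) \<mu>'])
    also have "shannon (block p m) q = shannon A q"
      using cyl_meas_nonneg[of p X \<mu>]
      by (intro shannon_superset[symmetric]) (auto simp: A_def q_def less_le)
    finally show ?thesis using m0 by (simp add: field_simps)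
  qed
  \<comment> \<open>Each of the \<open>card A\<close> counts may be off by
    \<open>\<epsilon>1 * N\<close>, and each such block holds at most \<open>m\<close> occurrences;
    in total this is at most \<open>\<epsilon> / 4 * l\<close>.\<close>
  define \<epsilon>1 where "\<epsilon>1 = \<epsilon> / (4 * (real (card A) + 1))"
  have \<epsilon>1: "\<epsilon>1 > 0" "\<epsilon>1 \<le> \<epsilon>" "real (card A) * \<epsilon>1 \<le> \<epsilon> / 4"
    using \<epsilon> by (auto simp: \<epsilon>1_def field_simps)
  have "\<forall>\<^sub>F n in sequentially. (\<exists>T\<subseteq>lists_of A n.
    (\<forall>s\<in>T. \<forall>a\<in>A. \<bar>real (count_list s a) - real n * q a\<bar> \<le> \<epsilon>1 * real n) \<and>
    exp (real n * (shannon A q - \<epsilon>1)) \<le> real (card T)) \<and> n > 0"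
    by (intro eventually_conj typical_lists fA q1 \<epsilon>1 eventually_gt_at_top) (auto simp: A_def)
  from eventually_happens'[OF sequentially_bot this] obtain N T where N: "N > 0" and T: "T \<subseteq> lists_of A N"
    and cnt': "\<forall>s\<in>T. \<forall>a\<in>A. \<bar>real (count_list s a) - real N * q a\<bar> \<le> \<epsilon>1 * real N"
    and cT: "exp (real N * (shannon A q - \<epsilon>1)) \<le> real (card T)" by blast
  note cnt = cnt'[rule_format]
  define l where "l = N * m"
  have "m \<le> l" using N by (simp add: l_def)
  then have ml: "\<epsilon> * real m \<le> \<epsilon> * real l" using \<epsilon> by (intro mult_left_mono) auto
  have len: "\<And>s w. s \<in> T \<Longrightarrow> w \<in> set s \<Longrightarrow> length w = m" "\<And>s. s \<in> T \<Longrightarrow> length s = N"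
    "\<And>s. s \<in> T \<Longrightarrow> set s \<subseteq> A"
    using T by (auto simp: lists_of_def A_def block_def)
  \<comment> \<open>All entries have length \<open>m\<close>, so a concatenation can be cut back in
    only one way.\<close>
  have inj: "inj_on concat T"
  proof (rule inj_onI)
    fix s t assume st: "s \<in> T" "t \<in> T" "concat s = concat t"
    show "s = t"
    proof (rule concat_injective[OF st(3)])
      show "length s = length t" using len(2) st by simp
      show "\<forall>(x, y)\<in>set (zip s t). length x = length y"
      proof clarify
        fix a b assume ab: "(a, b) \<in> set (zip s t)"
        show "length a = length b"
          using len(1)[OF st(1) set_zip_leftD[OF ab]] len(1)[OF st(2) set_zip_rightD[OF ab]] by simp
      qed
    qed
  qed
  have lenc: "length (concat s) = l" if "s \<in> T" for s
  proof -
    have "map length s = map (\<lambda>_. m) s" using len(1)[OF that] by (intro map_cong refl)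
    then have "length (concat s) = (\<Sum>w\<leftarrow>s. m)" by (simp only: length_concat)
    then show ?thesis using len(2)[OF that] by (simp add: sum_list_triv l_def)
  qed
  have D: "concat ` T \<subseteq> block p l"
  proof clarify
    fix s assume s: "s \<in> T"
    have "set s \<subseteq> words p" using len(3)[OF s] by (auto simp: A_def block_def)
    then show "concat s \<in> block p l" using lenc[OF s] by (simp add: block_def words_concat)
  qed
  have card: "exp (real l * (h - \<epsilon>)) \<le> real (card (concat ` T))"
  proof -
    have "real l * (h - \<epsilon>) = real N * (real m * h - real m * \<epsilon>)" by (simp add: l_def algebra_simps)
    also have "\<dots> \<le> real N * (shannon A q - \<epsilon>1)"
    proof (intro mult_left_mono)
      have "\<epsilon>1 \<le> real m * \<epsilon>"
      proof -
        have "1 * \<epsilon> \<le> real m * \<epsilon>" using m0 \<epsilon> by (intro mult_right_mono) auto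
        then show ?thesis using \<epsilon>1(2) by linarith
      qed
      then show "real m * h - real m * \<epsilon> \<le> shannon A q - \<epsilon>1" using H by simp
    qed simp
    finally have "exp (real l * (h - \<epsilon>)) \<le> exp (real N * (shannon A q - \<epsilon>1))"
      by (simp only: exp_le_cancel_iff)
    from order_trans[OF this cT] show ?thesis by (simp only: card_image[OF inj])
  qed
  have Gd: "\<exists>v\<in>G. v \<in> edit_ball p (\<epsilon> * real l) (concat s)" if s: "s \<in> T" for s
  proof -
    have "set s \<subseteq> language p X \<inter> block p m" "s \<noteq> []" using len[OF s] A_lang N by auto
    then obtain z where z: "z \<in> G" "z \<in> edit_ball p (real (length s) * (real (g m) + real \<tau>)) (concat s)"
      using glue_concat[where g = g, OF G spec appr, of s m] by blast
    have "real (length s) * (real (g m) + real \<tau>) \<le> real N * (\<epsilon> * real m)"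
      using m len(2)[OF s] by (intro mult_mono) auto
    also have "\<dots> = \<epsilon> * real l" by (simp add: l_def)
    finally show ?thesis using z edit_ball_mono by blast
  qed
  have occ: "\<bar>real (occ u (concat s)) - real l * q u\<bar> \<le> \<epsilon> * real l" if s: "s \<in> T" and u: "u \<in> F" for s u
  proof -
    have Ku: "4 * real (length u) \<le> \<epsilon> * real m" using K[OF u] m by linarith
    have sl: "(\<Sum>w\<leftarrow>s. real (occ u w)) = real (\<Sum>w\<leftarrow>s. occ u w)" by (induction s) auto
    have 1: "\<bar>real (occ u (concat s)) - (\<Sum>w\<leftarrow>s. real (occ u w))\<bar> \<le> real N * real (length u)"
    proof -
      have "real (\<Sum>w\<leftarrow>s. occ u w) \<le> real (occ u (concat s))"
        "real (occ u (concat s)) \<le> real ((\<Sum>w\<leftarrow>s. occ u w) + N * length u)"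
        using occ_concat[of u s] len(2)[OF s] by (simp_all only: of_nat_le_iff)
      then show ?thesis unfolding sl by simp
    qed
    have "(\<Sum>w\<leftarrow>s. real (occ u w)) = (\<Sum>a\<in>A. real (count_list s a) * real (occ u a))"
      by (rule sum_list_count[OF fA len(3)[OF s]])
    then have "\<bar>(\<Sum>w\<leftarrow>s. real (occ u w)) - real N * (\<Sum>a\<in>A. q a * real (occ u a))\<bar> =
      \<bar>\<Sum>a\<in>A. (real (count_list s a) - real N * q a) * real (occ u a)\<bar>"
      by (simp add: sum_distrib_left sum_subtractf algebra_simps)
    also have "\<dots> \<le> (\<Sum>a\<in>A. (\<epsilon>1 * real N) * real m)"
    proof (intro order_trans[OF sum_abs] sum_mono)
      fix a assume a: "a \<in> A"
      have "occ u a \<le> m" using occ_le_length[of u a] a by (auto simp: A_def block_def)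
      then show "\<bar>(real (count_list s a) - real N * q a) * real (occ u a)\<bar> \<le> (\<epsilon>1 * real N) * real m"
        using cnt[OF s a] \<epsilon>1(1) unfolding abs_mult by (intro mult_mono) auto
    qed
    also have "\<dots> = (real (card A) * \<epsilon>1) * real l" by (simp add: l_def)
    also have "\<dots> \<le> \<epsilon> / 4 * real l" using \<epsilon>1(3) by (intro mult_right_mono) auto
    finally have 2: "\<bar>(\<Sum>w\<leftarrow>s. real (occ u w)) - real N * (\<Sum>a\<in>A. q a * real (occ u a))\<bar> \<le> \<epsilon> / 4 * real l" .
    have "(\<Sum>a\<in>A. q a * real (occ u a)) = (\<Sum>a\<in>block p m. q a * real (occ u a))"
      using cyl_meas_nonneg[of p X \<mu>] by (intro sum.mono_neutral_left) (auto simp: A_def q_def less_le)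
    then have "\<bar>(\<Sum>a\<in>A. q a * real (occ u a)) - real m * q u\<bar> \<le> real (length u)"
      using expected_occ[OF X \<mu>, where m = m and u = u] by (simp add: q_def)
    then have "real N * \<bar>(\<Sum>a\<in>A. q a * real (occ u a)) - real m * q u\<bar> \<le> real N * real (length u)"
      by (intro mult_left_mono) auto
    moreover have "real N * \<bar>(\<Sum>a\<in>A. q a * real (occ u a)) - real m * q u\<bar> =
      \<bar>real N * (\<Sum>a\<in>A. q a * real (occ u a)) - real l * q u\<bar>"
    proof -
      have "real N * (\<Sum>a\<in>A. q a * real (occ u a)) - real l * q u =
        real N * ((\<Sum>a\<in>A. q a * real (occ u a)) - real m * q u)" by (simp add: l_def right_diff_distrib)
      then show ?thesis by (simp only: abs_mult abs_of_nat)
    qed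
    ultimately have 3: "\<bar>real N * (\<Sum>a\<in>A. q a * real (occ u a)) - real l * q u\<bar> \<le> real N * real (length u)"
      by simp
    have "real N * real (length u) \<le> \<epsilon> / 4 * real l"
      using mult_left_mono[OF Ku, of "real N"] by (simp add: l_def algebra_simps)
    \<comment> \<open>A quarter each for the seams, the deviating counts, and the boundary error of
      the expected occurrences in one block.\<close>
    then have "\<bar>real (occ u (concat s)) - real l * q u\<bar> \<le> \<epsilon> / 4 * real l + \<epsilon> / 4 * real l + \<epsilon> / 4 * real l"
      using 1 2 3 by linarith
    also have "\<dots> \<le> \<epsilon> * real l" using \<epsilon> by simp
    finally show ?thesis .
  qed
  show ?thesis
  proof (intro exI[of _ l] exI[of _ "concat ` T"] conjI ballI)
    show "l > 0" using N m0 by (simp add: l_def)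
    show "real \<tau> \<le> \<epsilon> * real l" "1 \<le> \<epsilon> * real l" using m ml by linarith+
  qed (use D card Gd occ in \<open>auto simp: q_def\<close>)
qed

section \<open>The upper bound\<close>

lemma pre_language:
  assumes "X \<subseteq> full_shift p" "x \<in> X"
  shows "pre x n \<in> language p X"
proof -
  have "x \<in> cylinder p (pre x n) \<inter> X" using assms by (auto simp: cylinder_pre)
  then show ?thesis using assms by (auto simp: language_def pre_words)
qed

lemma pressure_sum_mono:
  assumes "M \<le> N"
  shows "pressure_sum p X Z t \<phi> M \<le> pressure_sum p X Z t \<phi> N"
  unfolding pressure_sum_def using assms by (intro INF_superset_mono) auto

text \<open>Raising \<open>N\<close> leaves fewer covers, so the sums increase and
  \<open>lim\<close> is a genuine limit.\<close>

lemma pressure_limit_eq_SUP: "pressure_limit p X Z t \<phi> = (SUP N. pressure_sum p X Z t \<phi> N)"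
  unfolding pressure_limit_def
  by (intro limI LIMSEQ_SUP) (auto simp: incseq_def pressure_sum_mono)

lemma sum_geometric_tail:
  fixes r :: real
  assumes "0 < r" "r < 1"
  shows "(\<Sum>n\<in>{N<..M}. r ^ n) \<le> r ^ N / (1 - r)"
proof -
  have "(\<Sum>n\<in>{N<..M}. r ^ n) \<le> (\<Sum>n\<in>{N..<N + Suc M}. r ^ n)"
    using assms by (intro sum_mono2) auto
  also have "\<dots> = r ^ N * (\<Sum>n<Suc M. r ^ n)"
    using sum.shift_bounds_nat_ivl[of "\<lambda>n. r ^ n" 0 N "Suc M"]
    by (simp add: power_add sum_distrib_left atLeast0LessThan algebra_simps)
  also have "(\<Sum>n<Suc M. r ^ n) \<le> (\<Sum>n. r ^ n)"
    using assms by (intro sum_le_suminf summable_geometric) auto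
  also have "(\<Sum>n. r ^ n) = 1 / (1 - r)" using assms by (intro suminf_geometric) auto
  finally show ?thesis using assms by (simp add: mult_left_mono)
qed

lemma pressure_upper:
  fixes \<phi> :: "(nat \<Rightarrow> nat) \<Rightarrow> real"
  assumes p: "p \<ge> 2" and X: "shift_space p X" and \<phi>: "continuous_on X \<phi>"
    and \<mu>: "\<mu> \<in> invariant_measures X" and Z: "Z \<subseteq> X"
    and freq: "\<And>x F \<epsilon>. x \<in> Z \<Longrightarrow> finite F \<Longrightarrow> F \<subseteq> words p \<Longrightarrow> \<epsilon> > 0 \<Longrightarrow>
      \<exists>\<^sub>F n in sequentially. \<forall>w\<in>F. \<bar>frequency x n w - cyl_meas p X \<mu> w\<bar> < \<epsilon>"
  shows "pressure p X Z \<phi> \<le> ks_entropy \<mu> shift_map + ereal (\<integral>x. \<phi> x \<partial>\<mu>)"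
proof -
  have X1: "X \<subseteq> full_shift p" and X2: "shift_map ` X \<subseteq> X" and X3: "compact X"
    using X by (auto simp: shift_space_def)
  have \<mu>': "\<mu> \<in> borel_probs X" using \<mu> by (simp add: invariant_measures_def)
  let ?I = "\<integral>x. \<phi> x \<partial>\<mu>"
  obtain h where h: "(\<lambda>n. entropy_of \<mu> (\<lambda>x. pre x n) / real n) \<longlonglongrightarrow> h" "ks_entropy \<mu> shift_map = ereal h"
    by (rule ks_entropy_shift[OF X1 X2 \<mu>]) blast
  have zero: "pressure_limit p X Z t \<phi> = 0" if t: "t > h + ?I" for t
  proof -
    \<comment> \<open>Two \<epsilon> are lost in counting the words and three in the Birkhoff sums;
      the remaining three give the geometric decay.\<close>
    define \<epsilon> where "\<epsilon> = (t - h - ?I) / 8"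
    have \<epsilon>: "\<epsilon> > 0" using t by (simp add: \<epsilon>_def)
    obtain k1 b1 where b1: "\<And>x. x \<in> X \<Longrightarrow> \<bar>\<phi> x - b1 (pre x k1)\<bar> \<le> \<epsilon>"
      using locally_constant_approx[OF X3 \<phi> \<epsilon>] by blast
    have "\<forall>\<^sub>F n in sequentially. entropy_of \<mu> (\<lambda>x. pre x n) / real n < h + \<epsilon> \<and> n \<ge> Suc k1"
      using h(1) \<epsilon> by (intro eventually_conj order_tendstoD(2) eventually_ge_at_top) auto
    from eventually_happens'[OF sequentially_bot this] obtain k
      where k: "entropy_of \<mu> (\<lambda>x. pre x k) / real k < h + \<epsilon>" "k \<ge> Suc k1" by blast
    have k0: "k > 0" using k by simp
    \<comment> \<open>A single depth \<open>k\<close> serves both the entropy estimate and the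
      approximation of \<phi>, because a longer prefix still determines \<open>b1\<close>.\<close>
    define b where "b w = b1 (take k1 w)" for w
    have b: "\<bar>\<phi> x - b (pre x k)\<bar> \<le> \<epsilon>" if "x \<in> X" for x
      using b1[OF that] k(2) by (simp add: b_def take_pre min_def)
    define q where "q = cyl_meas p X \<mu>"
    have sh: "shannon (block p k) q / real k < h + \<epsilon>"
      using k(1) entropy_of_pre[OF X1 \<mu>'] by (simp add: q_def)
    have p1: "p \<ge> 1" using p by simp
    have q0: "0 \<le> q u" for u by (simp add: q_def cyl_meas_nonneg)
    have q1: "(\<Sum>u\<in>block p k. q u) = 1" unfolding q_def by (rule sum_cyl_meas[OF X1 \<mu>'])
    obtain \<delta> where \<delta>: "\<delta> > 0" "\<And>n. real (card {w \<in> block p n. \<forall>u\<in>block p k. \<bar>real (occ u w) - real n * q u\<bar> \<le> \<delta> * real n})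
      \<le> real k * real p ^ (2 * k) * exp (real n * (shannon (block p k) q / real k + \<epsilon>))"
      using card_frequent_words[OF k0 p1 q0 q1 \<epsilon>] by blast
    define B where "B = (\<Sum>u\<in>block p k. \<bar>b u\<bar>)"
    have B: "B \<ge> 0" by (simp add: B_def sum_nonneg)
    \<comment> \<open>\<open>\<eta> \<le> \<delta>\<close> allows the counting bound,
      \<open>B * \<eta> \<le> \<epsilon>\<close> controls the Birkhoff sums.\<close>
    define \<eta> where "\<eta> = min \<delta> (\<epsilon> / (B + 1))"
    have \<eta>: "\<eta> > 0" "\<eta> \<le> \<delta>" "B * \<eta> \<le> \<epsilon>"
    proof -
      show "\<eta> > 0" "\<eta> \<le> \<delta>" using \<delta> \<epsilon> B by (auto simp: \<eta>_def)
      have "B * \<eta> \<le> B * (\<epsilon> / (B + 1))" using B by (intro mult_left_mono) (auto simp: \<eta>_def)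
      also have "\<dots> \<le> (B + 1) * (\<epsilon> / (B + 1))" using B \<epsilon> by (intro mult_right_mono) auto
      finally show "B * \<eta> \<le> \<epsilon>" using B by simp
    qed
    define E where "E n = {w \<in> block p n \<inter> language p X. \<forall>u\<in>block p k. \<bar>real (occ u w) - real n * q u\<bar> \<le> \<eta> * real n}" for n
    have finE: "finite (E n)" for n by (rule finite_subset[OF _ finite_block[of p n]]) (auto simp: E_def)
    define C where "C = real k * real p ^ (2 * k)"
    have C: "C > 0" using k0 p by (simp add: C_def)
    have cardE: "real (card (E n)) \<le> C * exp (real n * (h + 2 * \<epsilon>))" for n
    proof -
      have "\<eta> * real n \<le> \<delta> * real n" using \<eta>(2) by (intro mult_right_mono) auto
      then have "E n \<subseteq> {w \<in> block p n. \<forall>u\<in>block p k. \<bar>real (occ u w) - real n * q u\<bar> \<le> \<delta> * real n}"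
        by (auto simp: E_def intro: order_trans)
      then have "card (E n) \<le> card {w \<in> block p n. \<forall>u\<in>block p k. \<bar>real (occ u w) - real n * q u\<bar> \<le> \<delta> * real n}"
        by (intro card_mono) auto
      then have "real (card (E n)) \<le> C * exp (real n * (shannon (block p k) q / real k + \<epsilon>))"
        using \<delta>(2)[of n] unfolding C_def by linarith
      also have "\<dots> \<le> C * exp (real n * (h + 2 * \<epsilon>))"
        using C sh by (intro mult_left_mono exp_mono) auto
      finally show ?thesis .
    qed
    define a where "a w = exp (- t * real (length w) +
      (SUP x\<in>cylinder p w \<inter> X. \<Sum>k<length w. \<phi> ((shift_map ^^ k) x)))" for w
    have Ib: "(\<Sum>u\<in>block p k. b u * q u) \<le> ?I + \<epsilon>"
      using integral_approx[OF X1 X3 \<phi> \<mu>' b] by (simp add: q_def)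
    have aE: "a w \<le> exp (B * real k) * exp (real n * (- t + ?I + 3 * \<epsilon>))" if w: "w \<in> E n" for w n
    proof -
      have wn: "length w = n" "w \<in> language p X" using w by (auto simp: E_def block_def)
      have "(SUP x\<in>cylinder p w \<inter> X. \<Sum>k<length w. \<phi> ((shift_map ^^ k) x)) \<le> B * real k + real n * (?I + 3 * \<epsilon>)"
      proof (rule cSUP_least)
        show "cylinder p w \<inter> X \<noteq> {}" using wn(2) by (simp add: language_def)
        fix x assume "x \<in> cylinder p w \<inter> X"
        then have x: "x \<in> X" "pre x n = w" using wn by (auto simp: cylinder_pre)
        have "(\<Sum>i<n. \<phi> ((shift_map ^^ i) x)) \<le> (\<Sum>u\<in>block p k. b u * real (visits u x n)) + real n * \<epsilon>"
          using birkhoff_approx[where \<phi> = \<phi> and b = b and k = k and \<delta> = \<epsilon> and n = n, OF X1 X2 x(1) b]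
          by linarith
        also have "(\<Sum>u\<in>block p k. b u * real (visits u x n)) \<le>
          (\<Sum>u\<in>block p k. real n * (b u * q u) + \<bar>b u\<bar> * (\<eta> * real n + real k))"
        proof (intro sum_mono)
          fix u assume u: "u \<in> block p k"
          have "\<bar>real (occ u w) - real n * q u\<bar> \<le> \<eta> * real n" using w u by (auto simp: E_def)
          then have "\<bar>real (visits u x n) - real n * q u\<bar> \<le> \<eta> * real n + real k"
            using visits_occ[of u x n] u x(2) by (auto simp: block_def)
          then have "\<bar>b u\<bar> * \<bar>real (visits u x n) - real n * q u\<bar> \<le> \<bar>b u\<bar> * (\<eta> * real n + real k)"
            by (intro mult_left_mono) auto
          then have "b u * (real (visits u x n) - real n * q u) \<le> \<bar>b u\<bar> * (\<eta> * real n + real k)"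
            by (metis abs_ge_self abs_mult order_trans)
          then show "b u * real (visits u x n) \<le> real n * (b u * q u) + \<bar>b u\<bar> * (\<eta> * real n + real k)"
            by (simp add: algebra_simps)
        qed
        also have "\<dots> = real n * (\<Sum>u\<in>block p k. b u * q u) + B * (\<eta> * real n + real k)"
          by (simp only: sum.distrib sum_distrib_left sum_distrib_right B_def)
        also have "\<dots> \<le> real n * (?I + \<epsilon>) + (\<epsilon> * real n + B * real k)"
        proof (intro add_mono mult_left_mono Ib)
          have "(B * \<eta>) * real n \<le> \<epsilon> * real n" using \<eta>(3) by (intro mult_right_mono) auto
          then show "B * (\<eta> * real n + real k) \<le> \<epsilon> * real n + B * real k" by (simp add: algebra_simps)
        qed simp
        finally show "(\<Sum>k<length w. \<phi> ((shift_map ^^ k) x)) \<le> B * real k + real n * (?I + 3 * \<epsilon>)"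
          using wn by (simp add: algebra_simps)
      qed
      then have "a w \<le> exp (- t * real n + (B * real k + real n * (?I + 3 * \<epsilon>)))"
        unfolding a_def wn by (intro exp_mono add_left_mono)
      also have "\<dots> = exp (B * real k) * exp (real n * (- t + ?I + 3 * \<epsilon>))"
        by (simp add: exp_add[symmetric] algebra_simps)
      finally show ?thesis .
    qed
    define C' where "C' = C * exp (B * real k)"
    define r where "r = exp (- 3 * \<epsilon>)"
    have r: "0 < r" "r < 1" using \<epsilon> by (auto simp: r_def)
    have C': "C' > 0" using C by (simp add: C'_def)
    have sumE: "(\<Sum>w\<in>E n. a w) \<le> C' * r ^ n" for n
    proof -
      have "(\<Sum>w\<in>E n. a w) \<le> (\<Sum>w\<in>E n. exp (B * real k) * exp (real n * (- t + ?I + 3 * \<epsilon>)))"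
        using aE by (intro sum_mono)
      also have "\<dots> = real (card (E n)) * (exp (B * real k) * exp (real n * (- t + ?I + 3 * \<epsilon>)))" by simp
      also have "\<dots> \<le> (C * exp (real n * (h + 2 * \<epsilon>))) * (exp (B * real k) * exp (real n * (- t + ?I + 3 * \<epsilon>)))"
        using cardE by (intro mult_right_mono) auto
      also have "\<dots> = C' * exp (real n * (h + 2 * \<epsilon>) + real n * (- t + ?I + 3 * \<epsilon>))"
        unfolding exp_add C'_def by simp
      also have "real n * (h + 2 * \<epsilon>) + real n * (- t + ?I + 3 * \<epsilon>) = real n * (- 3 * \<epsilon>)"
        by (simp add: \<epsilon>_def field_simps)
      also have "exp (real n * (- 3 * \<epsilon>)) = r ^ n" unfolding r_def by (rule exp_of_nat_mult)
      finally show ?thesis .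
    qed
    have sum_le: "pressure_sum p X Z t \<phi> N \<le> ennreal (C' * (r ^ N / (1 - r)))" for N
    proof -
      define S where "S = (\<Union>n\<in>{N<..}. E n)"
      have S_len: "length w > N" "w \<in> E (length w)" if "w \<in> S" for w
        using that by (auto simp: S_def E_def block_def)
      have S_lang: "S \<subseteq> language p X" by (auto simp: S_def E_def)
      have "Z \<subseteq> (\<Union>w\<in>S. cylinder p w)"
      proof
        fix x assume x: "x \<in> Z"
        have xX: "x \<in> X" using x Z by blast
        have "\<exists>\<^sub>F n in sequentially. \<forall>w\<in>block p k. \<bar>frequency x n w - q w\<bar> < \<eta> / 2"
        proof -
          have "block p k \<subseteq> words p" by (auto simp: block_def)
          then show ?thesis unfolding q_def using \<eta>(1) by (intro freq[OF x]) auto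
        qed
        moreover have "\<forall>\<^sub>F n in sequentially. n > N \<and> real k \<le> \<eta> / 2 * real n"
        proof (intro eventually_conj eventually_gt_at_top)
          show "\<forall>\<^sub>F n in sequentially. real k \<le> \<eta> / 2 * real n" using \<eta>(1) by real_asymp
        qed
        ultimately have "\<exists>\<^sub>F n in sequentially. (\<forall>w\<in>block p k. \<bar>frequency x n w - q w\<bar> < \<eta> / 2) \<and>
          n > N \<and> real k \<le> \<eta> / 2 * real n" by (rule frequently_eventually_frequently)
        then obtain n where n: "\<forall>w\<in>block p k. \<bar>frequency x n w - q w\<bar> < \<eta> / 2" "n > N" "real k \<le> \<eta> / 2 * real n"
          using frequently_ex by blast
        have "\<bar>real (occ u (pre x n)) - real n * q u\<bar> \<le> \<eta> * real n" if u: "u \<in> block p k" for u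
        proof -
          have "real n * \<bar>frequency x n u - q u\<bar> \<le> real n * (\<eta> / 2)" using n(1) u by (intro mult_left_mono) auto
          moreover have "real n * \<bar>frequency x n u - q u\<bar> = \<bar>real (visits u x n) - real n * q u\<bar>"
          proof -
            have "real (visits u x n) - real n * q u = real n * (frequency x n u - q u)"
              using n(2) by (simp add: frequency_def right_diff_distrib)
            then show ?thesis by (simp only: abs_mult abs_of_nat)
          qed
          ultimately have "\<bar>real (visits u x n) - real n * q u\<bar> \<le> \<eta> / 2 * real n" by (simp add: mult.commute)
          moreover have "\<bar>real (occ u (pre x n)) - real (visits u x n)\<bar> \<le> real k"
            using visits_occ[of u x n] u by (auto simp: block_def)
          moreover have "\<eta> * real n = \<eta> / 2 * real n + \<eta> / 2 * real n" by simp
          ultimately show ?thesis using n(3) by linarith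
        qed
        moreover have "pre x n \<in> block p n \<inter> language p X" "x \<in> cylinder p (pre x n)"
          using xX X1 pre_language[OF X1 xX] by (auto simp: pre_block cylinder_pre)
        ultimately have "pre x n \<in> E n" by (simp add: E_def)
        then have "pre x n \<in> S" using n(2) by (auto simp: S_def)
        then show "x \<in> (\<Union>w\<in>S. cylinder p w)" using \<open>x \<in> cylinder p (pre x n)\<close> by blast
      qed
      then have "pressure_sum p X Z t \<phi> N \<le> (\<Sum>\<^sub>\<infinity>w\<in>S. ennreal (a w))"
        unfolding pressure_sum_def a_def using S_len S_lang by (intro INF_lower) auto
      also have "\<dots> \<le> ennreal (C' * (r ^ N / (1 - r)))"
      proof (rule infsum_le_finite_sums)
        show "(\<lambda>w. ennreal (a w)) summable_on S" by (intro nonneg_summable_on_complete) simp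
        fix F assume F: "finite F" "F \<subseteq> S"
        obtain M where M: "\<And>w. w \<in> F \<Longrightarrow> length w \<le> M"
          using F(1) by (metis finite_imageI finite_nat_set_iff_bounded_le imageI)
        have "F \<subseteq> (\<Union>n\<in>{N<..M}. E n)" using F(2) S_len M by fastforce
        then have "(\<Sum>w\<in>F. a w) \<le> (\<Sum>w\<in>(\<Union>n\<in>{N<..M}. E n). a w)"
          using finE by (intro sum_mono2) (auto simp: a_def)
        also have "\<dots> \<le> (\<Sum>n\<in>{N<..M}. \<Sum>w\<in>E n. a w)" using finE by (intro sum_UN_le) (auto simp: a_def)
        also have "\<dots> \<le> (\<Sum>n\<in>{N<..M}. C' * r ^ n)" by (intro sum_mono sumE)
        also have "\<dots> = C' * (\<Sum>n\<in>{N<..M}. r ^ n)" by (simp add: sum_distrib_left)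
        also have "\<dots> \<le> C' * (r ^ N / (1 - r))" using C' sum_geometric_tail[OF r] by (intro mult_left_mono) auto
        finally have "ennreal (\<Sum>w\<in>F. a w) \<le> ennreal (C' * (r ^ N / (1 - r)))" by (rule ennreal_leI)
        then show "(\<Sum>w\<in>F. ennreal (a w)) \<le> ennreal (C' * (r ^ N / (1 - r)))"
          by (subst sum_ennreal) (auto simp: a_def)
      qed
      finally show ?thesis .
    qed
    \<comment> \<open>The sums increase with \<open>N\<close> while their bounds tend to 0, so every
      one of them vanishes.\<close>
    have "pressure_sum p X Z t \<phi> M = 0" for M
    proof -
      have "(\<lambda>N. C' * (r ^ N / (1 - r))) \<longlonglongrightarrow> C' * (0 / (1 - r))"
        using r by (intro tendsto_intros LIMSEQ_power_zero) auto
      then have lim: "(\<lambda>N. ennreal (C' * (r ^ N / (1 - r)))) \<longlonglongrightarrow> ennreal 0"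
        by (intro tendsto_ennrealI) simp
      have "\<forall>\<^sub>F N in sequentially. pressure_sum p X Z t \<phi> M \<le> ennreal (C' * (r ^ N / (1 - r)))"
        using eventually_ge_at_top[of M] by eventually_elim (rule order_trans[OF pressure_sum_mono sum_le])
      then have "pressure_sum p X Z t \<phi> M \<le> ennreal 0"
        by (rule tendsto_lowerbound[OF lim]) simp
      then show ?thesis by simp
    qed
    then show ?thesis by (simp add: pressure_limit_eq_SUP)
  qed
  have "pressure p X Z \<phi> \<le> ereal (h + ?I)"
  proof (rule ereal_le_epsilon2)
    fix e :: real assume "0 < e"
    then have "pressure p X Z \<phi> \<le> ereal (h + ?I + e)"
      unfolding pressure_def using zero[of "h + ?I + e"] by (intro INF_lower) simp
    then show "pressure p X Z \<phi> \<le> ereal (h + ?I) + ereal e" by simp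
  qed
  then show ?thesis by (simp add: h(2))
qed

section \<open>Slow schedules\<close>

text \<open>Total length of the stages before stage \<open>j\<close>; the factor of
  \<open>l j\<close> is the number of blocks in stage \<open>j\<close>.\<close>

primrec stage_total :: "(nat \<Rightarrow> nat) \<Rightarrow> nat \<Rightarrow> nat" where
  "stage_total l 0 = 0"
| "stage_total l (Suc j) = stage_total l j + Suc j * (stage_total l j + l (Suc j)) * l j"

text \<open>Stage \<open>j\<close> repeats its block length \<open>l j\<close> so often that it outweighs all earlier stages
  and the first block of the next one by a factor \<open>j + 1\<close>.\<close>

lemma schedule:
  fixes l :: "nat \<Rightarrow> nat"
  assumes l: "\<And>n. l n > 0"
  obtains s where "filterlim s at_top sequentially" "\<And>n. \<exists>i\<ge>n. s i = n"
    "(\<lambda>I. real (l (s I)) / (\<Sum>i<I. real (l (s i)))) \<longlonglongrightarrow> 0"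
    "\<And>(a :: nat \<Rightarrow> real) B. (\<And>n. \<bar>a n\<bar> \<le> B) \<Longrightarrow> (\<lambda>n. a n - a (Suc n)) \<longlonglongrightarrow> 0 \<Longrightarrow>
      (\<lambda>I. (\<Sum>i<I. real (l (s i)) * a (s i)) / (\<Sum>i<I. real (l (s i))) - a (s I)) \<longlonglongrightarrow> 0"
proof -
  define T where "T = stage_total l"
  define r where "r j = Suc j * (T j + l (Suc j))" for j
  \<comment> \<open>\<open>R j\<close> is the number of blocks before stage \<open>j\<close>, and
    \<open>s i\<close> below is the stage that contains block \<open>i\<close>.\<close>
  define R where "R j = (\<Sum>j'<j. r j')" for j
  have T: "T 0 = 0" "T (Suc j) = T j + r j * l j" for j by (simp_all add: T_def r_def)
  have r_pos: "r j > 0" for j using l[of "Suc j"] by (simp add: r_def)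
  have R: "R 0 = 0" "R (Suc j) = R j + r j" for j by (simp_all add: R_def)
  have R_mono: "strict_mono R" by (rule strict_monoI_Suc) (simp add: R r_pos)
  have R_ge: "j \<le> R j" for j using strict_mono_imp_increasing[OF R_mono] by simp
  define s where "s i = (LEAST j. i < R (Suc j))" for i
  have s1: "i < R (Suc (s i))" for i
    unfolding s_def by (rule LeastI[of _ i]) (use R_ge[of "Suc i"] in simp)
  have s_eq: "s i = j" if "R j \<le> i" "i < R (Suc j)" for i j
  proof (rule antisym)
    show "s i \<le> j" unfolding s_def by (rule Least_le) fact
    show "j \<le> s i"
    proof (rule ccontr)
      assume "\<not> j \<le> s i"
      then have "R (Suc (s i)) \<le> R j" using strict_mono_less_eq[OF R_mono] by simp
      then show False using s1[of i] that by simp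
    qed
  qed
  have s2: "R (s i) \<le> i" for i
  proof (cases "s i")
    case (Suc j)
    have "\<not> i < R (Suc j)" using not_less_Least[of j "\<lambda>j. i < R (Suc j)"] Suc by (simp add: s_def)
    then show ?thesis using Suc by simp
  qed (simp add: R)
  have sR: "s (R j) = j" for j by (rule s_eq) (use r_pos in \<open>auto simp: R\<close>)
  have s_ge: "j \<le> s i" if "R j \<le> i" for i j
  proof (rule ccontr)
    assume "\<not> j \<le> s i"
    then have "R (Suc (s i)) \<le> R j" using strict_mono_less_eq[OF R_mono] by simp
    then show False using s1[of i] that by simp
  qed
  have stage_sum: "(\<Sum>i<R j + n. f (s i)) = (\<Sum>i<R j. f (s i)) + real n * f j" if "n \<le> r j" for j n and f :: "nat \<Rightarrow> real"
    using that
  proof (induction n)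
    case (Suc n)
    have "s (R j + n) = j" using Suc.prems by (intro s_eq) (auto simp: R)
    then show ?case using Suc by (simp add: algebra_simps)
  qed simp
  define L where "L I = (\<Sum>i<I. real (l (s i)))" for I
  have LR: "L (R j) = real (T j)" for j
  proof (induction j)
    case (Suc j)
    then show ?case using stage_sum[of "r j" j "\<lambda>j. real (l j)"] by (simp add: L_def R T)
  qed (simp add: L_def R T)
  \<comment> \<open>Counting each block of stage \<open>j\<close> as a single letter already gives
    this.\<close>
  have T_ge: "real (Suc j) * (real (T j) + real (l (Suc j))) \<le> real (T (Suc j))" for j
  proof -
    have "r j \<le> r j * l j" using l[of j] by (simp add: Suc_leI)
    then have "r j \<le> T (Suc j)" unfolding T(2) by linarith
    then have "real (r j) \<le> real (T (Suc j))" by (simp only: of_nat_le_iff)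
    then show ?thesis unfolding r_def of_nat_mult of_nat_add .
  qed
  have L_ge: "real (T (s I)) \<le> L I" for I
  proof -
    have "L (R (s I)) \<le> L I" unfolding L_def using s2 by (intro sum_mono2) auto
    then show ?thesis by (simp add: LR)
  qed
  have T_pos: "real (T (Suc j)) > 0" for j
  proof -
    have "0 < real (Suc j) * (real (T j) + real (l (Suc j)))" using l[of "Suc j"] by (simp add: add_nonneg_pos)
    then show ?thesis using T_ge[of j] by linarith
  qed
  have lim_s: "filterlim s at_top sequentially"
    unfolding filterlim_at_top eventually_sequentially using s_ge by blast
  then have ev: "\<forall>\<^sub>F I in sequentially. s I \<ge> 1" by (simp add: filterlim_at_top)
  show ?thesis
  proof (rule that[of s])
    show "filterlim s at_top sequentially" by (rule lim_s)
    show "\<exists>i\<ge>n. s i = n" for n using sR R_ge by blast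
    have "(\<lambda>I. real (l (s I)) / L I) \<longlonglongrightarrow> 0"
    proof (rule tendsto_sandwich[of "\<lambda>_. 0" _ _ "\<lambda>I. 1 / real (s I)"])
      show "\<forall>\<^sub>F I in sequentially. real (l (s I)) / L I \<le> 1 / real (s I)"
        using ev
      proof eventually_elim
        case (elim I)
        then obtain j where j: "s I = Suc j" by (cases "s I") auto
        have "real (Suc j) * real (l (s I)) \<le> real (Suc j) * (real (T j) + real (l (Suc j)))"
          unfolding j by (intro mult_left_mono) auto
        also have "\<dots> \<le> L I" using T_ge[of j] L_ge[of I] by (simp add: j)
        finally show ?case using T_pos[of j] L_ge[of I] by (simp add: j field_simps)
      qed
      show "(\<lambda>I. 1 / real (s I)) \<longlonglongrightarrow> 0"
        using filterlim_compose[OF lim_1_over_n lim_s] by simp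
    qed (auto simp: L_def sum_nonneg)
    then show "(\<lambda>I. real (l (s I)) / (\<Sum>i<I. real (l (s i)))) \<longlonglongrightarrow> 0" by (simp add: L_def)
    fix a :: "nat \<Rightarrow> real" and B :: real
    assume B: "\<And>n. \<bar>a n\<bar> \<le> B" and diff: "(\<lambda>n. a n - a (Suc n)) \<longlonglongrightarrow> 0"
    define A where "A I = (\<Sum>i<I. real (l (s i)) * a (s i))" for I
    have A_bound: "\<bar>A (R j) - a j * real (T j)\<bar> \<le> 2 * B * real (T j)" for j
    proof -
      have "\<bar>A (R j)\<bar> \<le> (\<Sum>i<R j. real (l (s i)) * B)"
        unfolding A_def using B by (intro order_trans[OF sum_abs] sum_mono) (auto simp: abs_mult intro!: mult_left_mono)
      also have "\<dots> = B * real (T j)" by (simp add: LR[symmetric] L_def sum_distrib_left mult.commute)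
      finally have "\<bar>A (R j)\<bar> \<le> B * real (T j)" .
      moreover have "\<bar>a j * real (T j)\<bar> \<le> B * real (T j)" using B by (simp add: abs_mult mult_right_mono)
      ultimately show ?thesis by linarith
    qed
    have key: "\<bar>A I / L I - a (s I)\<bar> \<le> 2 * B / real (s I) + \<bar>a (s I - 1) - a (s I)\<bar>" if I: "s I \<ge> 1" for I
    proof -
      obtain j where j: "s I = Suc j" using I by (cases "s I") auto
      define n where "n = I - R (Suc j)"
      have n: "I = R (Suc j) + n" "n \<le> r (Suc j)"
        using s2[of I] s1[of I] by (auto simp: j n_def R)
      have Tj: "T j \<le> T (Suc j)" by (simp add: T)
      have AI: "A I = A (R (Suc j)) + real n * (real (l (Suc j)) * a (Suc j))"
        unfolding A_def n(1) by (rule stage_sum[OF n(2), of "\<lambda>j. real (l j) * a j"])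
      have LI: "L I = real (T (Suc j)) + real n * real (l (Suc j))"
        unfolding LR[symmetric] L_def n(1) by (rule stage_sum[OF n(2), of "\<lambda>j. real (l j)"])
      have AR: "A (R (Suc j)) = A (R j) + real (r j) * (real (l j) * a j)"
        unfolding A_def R(2) by (rule stage_sum[of "r j" j "\<lambda>j. real (l j) * a j"]) simp
      have Lpos: "L I > 0" using L_ge[of I] T_pos[of j] by (simp add: j)
      \<comment> \<open>The current stage \<open>Suc j\<close> cancels. What remains is stage
        \<open>j\<close>, whose value is close to \<open>a (Suc j)\<close>, and the stages before
        it, whose relative weight is at most \<open>1 / Suc j\<close>.\<close>
      have "A I - a (Suc j) * L I = (A (R j) - a j * real (T j)) + (a j - a (Suc j)) * real (T (Suc j))"
        unfolding AI LI AR T by (simp add: algebra_simps)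
      also have "\<bar>\<dots>\<bar> \<le> 2 * B * real (T j) + \<bar>a j - a (Suc j)\<bar> * real (T (Suc j))"
        using A_bound[of j] by (simp add: abs_mult order_trans[OF abs_triangle_ineq])
      also have "\<dots> \<le> 2 * B / real (Suc j) * real (T (Suc j)) + \<bar>a j - a (Suc j)\<bar> * real (T (Suc j))"
      proof (intro add_right_mono)
        have "real (Suc j) * real (T j) \<le> real (Suc j) * (real (T j) + real (l (Suc j)))"
          by (intro mult_left_mono) auto
        then have "real (Suc j) * real (T j) \<le> real (T (Suc j))" using T_ge[of j] by linarith
        then have "real (T j) \<le> real (T (Suc j)) / real (Suc j)" by (simp add: field_simps)
        moreover have "B \<ge> 0" using B[of 0] by linarith
        ultimately have "2 * B * real (T j) \<le> 2 * B * (real (T (Suc j)) / real (Suc j))"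
          by (intro mult_left_mono) auto
        then show "2 * B * real (T j) \<le> 2 * B / real (Suc j) * real (T (Suc j))" by simp
      qed
      also have "\<dots> = (2 * B / real (Suc j) + \<bar>a j - a (Suc j)\<bar>) * real (T (Suc j))"
        by (simp only: distrib_right)
      also have "\<dots> \<le> (2 * B / real (Suc j) + \<bar>a j - a (Suc j)\<bar>) * L I"
        using L_ge[of I] B[of 0] by (intro mult_left_mono) (auto simp: j)
      finally have "\<bar>A I - a (Suc j) * L I\<bar> / L I \<le> 2 * B / real (Suc j) + \<bar>a j - a (Suc j)\<bar>"
        using Lpos by (simp add: pos_divide_le_eq)
      moreover have "\<bar>A I / L I - a (Suc j)\<bar> = \<bar>A I - a (Suc j) * L I\<bar> / L I"
        using Lpos by (simp add: abs_divide[symmetric] field_simps)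
      ultimately show ?thesis by (simp add: j)
    qed
    have lim2: "(\<lambda>n. \<bar>a (n - 1) - a n\<bar>) \<longlonglongrightarrow> 0"
    proof -
      have "(\<lambda>n. \<bar>a (Suc n - 1) - a (Suc n)\<bar>) \<longlonglongrightarrow> 0" using tendsto_rabs_zero[OF diff] by simp
      then show ?thesis by (rule LIMSEQ_imp_Suc)
    qed
    have "(\<lambda>n. 2 * B / real n) \<longlonglongrightarrow> 0" by real_asymp
    then have "(\<lambda>n. 2 * B / real n + \<bar>a (n - 1) - a n\<bar>) \<longlonglongrightarrow> 0 + 0" using lim2 by (rule tendsto_add)
    then have "(\<lambda>I. 2 * B / real (s I) + \<bar>a (s I - 1) - a (s I)\<bar>) \<longlonglongrightarrow> 0"
      using filterlim_compose[OF _ lim_s] by force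
    then have "(\<lambda>I. A I / L I - a (s I)) \<longlonglongrightarrow> 0"
    proof (rule Lim_null_comparison[rotated])
      show "\<forall>\<^sub>F I in sequentially. norm (A I / L I - a (s I)) \<le> 2 * B / real (s I) + \<bar>a (s I - 1) - a (s I)\<bar>"
        using ev by eventually_elim (use key in simp)
    qed
    then show "(\<lambda>I. (\<Sum>i<I. real (l (s i)) * a (s i)) / (\<Sum>i<I. real (l (s i))) - a (s I)) \<longlonglongrightarrow> 0"
      by (simp add: A_def L_def)
  qed
qed

section \<open>The Moran construction\<close>

text \<open>\<open>c n\<close> is the vector of cylinder measures of the \<open>n\<close>-th target measure, and \<open>D n\<close> consists of
  words of length \<open>l n\<close> that have these statistics up to the relative error \<open>e n\<close>. The \<open>i\<close>-th block of
  a point is chosen freely from \<open>D (s i)\<close>, where \<open>s\<close> is a slow schedule.\<close>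

locale moran =
  fixes p :: nat and X :: "(nat \<Rightarrow> nat) set" and G :: "nat list set" and \<tau> :: nat
    and l :: "nat \<Rightarrow> nat" and D :: "nat \<Rightarrow> nat list set" and c :: "nat \<Rightarrow> nat list \<Rightarrow> real"
    and e :: "nat \<Rightarrow> real" and s :: "nat \<Rightarrow> nat"
  assumes X: "X \<subseteq> full_shift p" "closed X" "shift_map ` X \<subseteq> X"
    and G: "G \<subseteq> language p X"
    and spec: "\<And>v w. v \<in> G \<Longrightarrow> w \<in> G \<Longrightarrow> \<exists>u\<in>language p X. length u \<le> \<tau> \<and> v @ u @ w \<in> G"
    and l_pos: "\<And>n. l n > 0"
    and D_block: "\<And>n. D n \<subseteq> block p (l n)" and D_ne: "\<And>n. D n \<noteq> {}"
    and e_pos: "\<And>n. 0 < e n" and e_le: "\<And>n. e n \<le> 1 / 2" and e_lim: "e \<longlonglongrightarrow> 0"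
    and tau_le: "\<And>n. real \<tau> \<le> e n * real (l n)" and one_le: "\<And>n. 1 \<le> e n * real (l n)"
    and D_G: "\<And>n W. W \<in> D n \<Longrightarrow> \<exists>v\<in>G. v \<in> edit_ball p (e n * real (l n)) W"
    and D_occ: "\<And>n W u. W \<in> D n \<Longrightarrow> u \<in> words p \<Longrightarrow> length u \<le> n \<Longrightarrow>
      \<bar>real (occ u W) - real (l n) * c n u\<bar> \<le> e n * real (l n)"
    and c_ge: "\<And>n u. 0 \<le> c n u" and c_le: "\<And>n u. c n u \<le> 1"
    and c_slow: "\<And>u. (\<lambda>n. c n u - c (Suc n) u) \<longlonglongrightarrow> 0"
    and s_lim: "filterlim s at_top sequentially"
    and s_surj: "\<And>n. \<exists>i\<ge>n. s i = n"
    and s_ratio: "(\<lambda>I. real (l (s I)) / (\<Sum>i<I. real (l (s i)))) \<longlonglongrightarrow> 0"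
    and s_cesaro: "\<And>(a :: nat \<Rightarrow> real) B. (\<And>n. \<bar>a n\<bar> \<le> B) \<Longrightarrow> (\<lambda>n. a n - a (Suc n)) \<longlonglongrightarrow> 0 \<Longrightarrow>
      (\<lambda>I. (\<Sum>i<I. real (l (s i)) * a (s i)) / (\<Sum>i<I. real (l (s i))) - a (s I)) \<longlonglongrightarrow> 0"
begin

text \<open>\<open>L I\<close> is the length of the first \<open>I\<close> source blocks, and \<open>E I\<close> bounds the number of edits that
  turn them into a word of \<open>G\<close>.\<close>

definition L :: "nat \<Rightarrow> real" where "L I = (\<Sum>i<I. real (l (s i)))"

definition E :: "nat \<Rightarrow> real" where "E I = 2 * (\<Sum>i<I. real (l (s i)) * e (s i))"

definition choices :: "(nat \<Rightarrow> nat list) set" where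
  "choices = {\<omega>. \<forall>i. \<omega> i \<in> D (s i)}"

definition near :: "nat \<Rightarrow> nat list \<Rightarrow> nat list" where
  "near n W = (SOME v. v \<in> G \<and> v \<in> edit_ball p (e n * real (l n)) W)"

definition glue :: "nat list \<Rightarrow> nat list \<Rightarrow> nat list" where
  "glue v w = (SOME u. u \<in> language p X \<and> length u \<le> \<tau> \<and> v @ u @ w \<in> G)"

text \<open>\<open>chain \<omega> I\<close> has used the blocks 0 to \<open>I\<close>, one more than
  \<open>src \<omega> I\<close>. It starts with a block because the empty word may lie outside
  \<open>G\<close>.\<close>

primrec chain :: "(nat \<Rightarrow> nat list) \<Rightarrow> nat \<Rightarrow> nat list" where
  "chain \<omega> 0 = near (s 0) (\<omega> 0)"
| "chain \<omega> (Suc I) = chain \<omega> I @ glue (chain \<omega> I) (near (s (Suc I)) (\<omega> (Suc I))) @ near (s (Suc I)) (\<omega> (Suc I))"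

definition src :: "(nat \<Rightarrow> nat list) \<Rightarrow> nat \<Rightarrow> nat list" where
  "src \<omega> I = concat (map \<omega> [0..<I])"

text \<open>The limit of the chains: \<open>chain \<omega> j\<close> has more than \<open>j\<close>
  letters, and later chains only extend it.\<close>

definition pt :: "(nat \<Rightarrow> nat list) \<Rightarrow> nat \<Rightarrow> nat" where
  "pt \<omega> = (\<lambda>j. chain \<omega> j ! j)"

lemma near: "W \<in> D n \<Longrightarrow> near n W \<in> G \<and> near n W \<in> edit_ball p (e n * real (l n)) W"
  unfolding near_def by (rule someI_ex) (use D_G in blast)

lemma glue: "v \<in> G \<Longrightarrow> w \<in> G \<Longrightarrow> glue v w \<in> language p X \<and> length (glue v w) \<le> \<tau> \<and> v @ glue v w @ w \<in> G"
  unfolding glue_def by (rule someI_ex) (use spec in blast)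

lemma G_words: "v \<in> G \<Longrightarrow> v \<in> words p"
  using G language_words by blast

lemma L_Suc: "L (Suc I) = L I + real (l (s I))"
  by (simp add: L_def)

lemma L_0: "L 0 = 0"
  by (simp add: L_def)

lemma E_Suc: "E (Suc I) = E I + 2 * (real (l (s I)) * e (s I))"
  by (simp add: E_def algebra_simps)

lemma E_0: "E 0 = 0"
  by (simp add: E_def)

lemma E_nonneg: "0 \<le> E I"
  using e_pos by (simp add: E_def sum_nonneg less_imp_le)

lemma L_ge: "real I \<le> L I"
proof (induction I)
  case (Suc I)
  have "1 \<le> real (l (s I))" using l_pos[of "s I"] by simp
  then show ?case using Suc by (simp add: L_Suc)
qed (simp add: L_0)

lemma L_mono: "I \<le> J \<Longrightarrow> L I \<le> L J"
  unfolding L_def by (intro sum_mono2) auto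

lemma L_pos: "I > 0 \<Longrightarrow> L I > 0"
  using L_ge[of I] by linarith

text \<open>The differences of a null sequence vanish, so its weighted averages follow its current
  value, which tends to 0.\<close>

lemma cesaro_null:
  assumes "\<And>n. \<bar>a n\<bar> \<le> B" "a \<longlonglongrightarrow> 0"
  shows "(\<lambda>I. (\<Sum>i<I. real (l (s i)) * a (s i)) / L I) \<longlonglongrightarrow> 0"
proof -
  have "(\<lambda>n. a n - a (Suc n)) \<longlonglongrightarrow> 0 - 0"
    using assms(2) LIMSEQ_Suc[OF assms(2)] by (intro tendsto_diff)
  then have "(\<lambda>I. (\<Sum>i<I. real (l (s i)) * a (s i)) / L I - a (s I)) \<longlonglongrightarrow> 0"
    using s_cesaro[OF assms(1)] by (simp add: L_def)
  moreover have "(\<lambda>I. a (s I)) \<longlonglongrightarrow> 0" by (rule filterlim_compose[OF assms(2) s_lim])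
  ultimately have "(\<lambda>I. ((\<Sum>i<I. real (l (s i)) * a (s i)) / L I - a (s I)) + a (s I)) \<longlonglongrightarrow> 0 + 0"
    by (rule tendsto_add)
  then show ?thesis by simp
qed

lemma E_small: "(\<lambda>I. E I / L I) \<longlonglongrightarrow> 0"
proof -
  have "\<bar>e n\<bar> \<le> 1 / 2" for n using e_pos[of n] e_le[of n] by simp
  then have "(\<lambda>I. 2 * ((\<Sum>i<I. real (l (s i)) * e (s i)) / L I)) \<longlonglongrightarrow> 2 * 0"
    by (intro tendsto_mult tendsto_const cesaro_null e_lim)
  then show ?thesis by (simp add: E_def)
qed

lemma src_Suc: "src \<omega> (Suc I) = src \<omega> I @ \<omega> I"
  by (simp add: src_def)

lemma length_src: "\<omega> \<in> choices \<Longrightarrow> real (length (src \<omega> I)) = L I"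
proof (induction I)
  case (Suc I)
  have "length (\<omega> I) = l (s I)" using Suc.prems D_block by (fastforce simp: choices_def block_def)
  then show ?case using Suc by (simp add: src_Suc L_Suc)
qed (simp add: src_def L_0)

lemma chain_G:
  assumes "\<omega> \<in> choices"
  shows "chain \<omega> I \<in> G"
proof (induction I)
  case 0
  show ?case using near[of "\<omega> 0" "s 0"] assms by (simp add: choices_def)
next
  case (Suc I)
  show ?case using glue[OF Suc, of "near (s (Suc I)) (\<omega> (Suc I))"] near[of "\<omega> (Suc I)" "s (Suc I)"] assms
    by (simp add: choices_def)
qed

text \<open>The factor 2 in \<open>E\<close>: one share \<open>e n * l n\<close> pays for the edits
  of the block, the other for the connecting word of at most \<tau> letters.\<close>

lemma chain_ball:
  assumes \<omega>: "\<omega> \<in> choices"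
  shows "chain \<omega> I \<in> edit_ball p (E (Suc I)) (src \<omega> (Suc I))"
proof (induction I)
  case 0
  have "near (s 0) (\<omega> 0) \<in> edit_ball p (e (s 0) * real (l (s 0))) (\<omega> 0)"
    using near[of "\<omega> 0" "s 0"] \<omega> by (simp add: choices_def)
  then have "near (s 0) (\<omega> 0) \<in> edit_ball p (E (Suc 0)) (\<omega> 0)"
    by (rule edit_ball_mono) (use e_pos[of "s 0"] in \<open>simp add: E_def mult.commute\<close>)
  then show ?case by (simp add: src_def)
next
  case (Suc I)
  define n where "n = s (Suc I)"
  define W where "W = \<omega> (Suc I)"
  define v where "v = near n W"
  define u where "u = glue (chain \<omega> I) v"
  have W: "W \<in> D n" using \<omega> by (simp add: choices_def W_def n_def)
  have v: "v \<in> G" "v \<in> edit_ball p (e n * real (l n)) W" using near[OF W] by (auto simp: v_def)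
  have u: "u \<in> language p X" "length u \<le> \<tau>" using glue[OF chain_G[OF \<omega>] v(1)] by (auto simp: u_def)
  have uw: "u \<in> words p" using u language_words by blast
  have cw: "chain \<omega> I \<in> words p" using G_words chain_G[OF \<omega>] by blast
  have Ww: "W \<in> words p" using W D_block[of n] by (auto simp: block_def)
  have "chain \<omega> I @ u \<in> edit_ball p (real \<tau>) (chain \<omega> I)"
    using edits_insert[OF cw uw] u(2) unfolding edit_ball_def by auto
  then have "chain \<omega> I @ u \<in> edit_ball p (E (Suc I) + real \<tau>) (src \<omega> (Suc I))"
    by (rule edit_ball_trans[OF Suc])
  then have "(chain \<omega> I @ u) @ v \<in> edit_ball p ((E (Suc I) + real \<tau>) + e n * real (l n)) (src \<omega> (Suc I) @ W)"
    using cw uw Ww by (intro edit_ball_append v) auto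
  then have "(chain \<omega> I @ u) @ v \<in> edit_ball p (E (Suc (Suc I))) (src \<omega> (Suc I) @ W)"
    by (rule edit_ball_mono) (use tau_le[of n] in \<open>simp add: E_Suc[of "Suc I"] n_def mult.commute\<close>)
  then show ?case by (simp add: src_Suc[of _ "Suc I"] u_def v_def W_def n_def)
qed

text \<open>By \<open>e n \<le> 1 / 2\<close> at least half of the length of the source block
  survives.\<close>

lemma near_length: "W \<in> D n \<Longrightarrow> length (near n W) > 0"
proof -
  assume W: "W \<in> D n"
  have "length W = l n" using W D_block[of n] by (auto simp: block_def)
  then have "real (l n) - e n * real (l n) \<le> real (length (near n W))"
    using near[OF W] edit_ball_length[of "near n W" p "e n * real (l n)" W] by (simp add: abs_le_iff)
  moreover have "e n * real (l n) \<le> 1 / 2 * real (l n)" using e_le[of n] by (intro mult_right_mono) auto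
  moreover have "0 < real (l n)" using l_pos[of n] by simp
  ultimately have "0 < real (length (near n W))" by linarith
  then show ?thesis by (simp only: of_nat_0_less_iff)
qed

lemma chain_length:
  assumes "\<omega> \<in> choices"
  shows "I < length (chain \<omega> I)"
proof (induction I)
  case 0
  then show ?case using near_length[of "\<omega> 0" "s 0"] assms by (simp add: choices_def)
next
  case (Suc I)
  have "0 < length (near (s (Suc I)) (\<omega> (Suc I)))" using assms by (intro near_length) (simp add: choices_def)
  then show ?case using Suc unfolding chain.simps length_append by linarith
qed

lemma chain_prefix: "\<exists>z. chain \<omega> (I + n) = chain \<omega> I @ z"
  by (induction n) auto

lemma pre_pt_chain:
  assumes "\<omega> \<in> choices"
  shows "pre (pt \<omega>) (length (chain \<omega> I)) = chain \<omega> I"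
proof (rule nth_equalityI)
  fix j assume "j < length (pre (pt \<omega>) (length (chain \<omega> I)))"
  then have j: "j < length (chain \<omega> I)" by simp
  obtain z where z: "chain \<omega> (I + j) = chain \<omega> I @ z" using chain_prefix by blast
  obtain z' where z': "chain \<omega> (j + I) = chain \<omega> j @ z'" using chain_prefix by blast
  have "chain \<omega> j ! j = chain \<omega> (j + I) ! j" using chain_length[OF assms, of j] by (simp add: z' nth_append)
  also have "\<dots> = chain \<omega> I ! j" using z j by (simp add: nth_append add.commute)
  finally show "pre (pt \<omega>) (length (chain \<omega> I)) ! j = chain \<omega> I ! j" using j by (simp add: nth_pre pt_def)
qed simp

text \<open>Every prefix of the point is a prefix of some chain, hence of a point of
  \<open>X\<close>, and \<open>X\<close> is closed.\<close>

lemma pt_X: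
  assumes "\<omega> \<in> choices"
  shows "pt \<omega> \<in> X"
proof (rule ccontr)
  assume "pt \<omega> \<notin> X"
  then obtain k where k: "\<And>y. pre y k = pre (pt \<omega>) k \<Longrightarrow> y \<in> - X"
    using open_prefix[of "- X" "pt \<omega>"] X(2) by (metis ComplI open_Compl)
  have "chain \<omega> k \<in> language p X" using chain_G[OF assms] G by blast
  then obtain y where y: "y \<in> X" "pre y (length (chain \<omega> k)) = chain \<omega> k"
    using cylinder_pre by (fastforce simp: language_def)
  have "pre y k = pre (pt \<omega>) k"
    by (rule pre_eq_mono[of _ "length (chain \<omega> k)"])
      (use y pre_pt_chain[OF assms, of k] chain_length[OF assms, of k] in auto)
  then show False using k[of y] y by blast
qed

text \<open>The number of source blocks completed at time \<open>n\<close>. The clock runs on the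
  source lengths, so it is the same for all choices.\<close>

definition idx :: "nat \<Rightarrow> nat" where
  "idx n = (LEAST I. real n < L (Suc I))"

lemma idx_less: "real n < L (Suc (idx n))"
  unfolding idx_def by (rule LeastI[of _ n]) (use L_ge[of "Suc n"] in simp)

lemma idx_le: "L (idx n) \<le> real n"
proof (cases "idx n")
  case (Suc j)
  have "\<not> real n < L (Suc j)" using not_less_Least[of j "\<lambda>I. real n < L (Suc I)"] Suc by (simp add: idx_def)
  then show ?thesis using Suc by simp
qed (simp add: L_0)

lemma idx_eq:
  assumes "L I \<le> real n" "real n < L (Suc I)"
  shows "idx n = I"
proof (rule antisym)
  show "idx n \<le> I" unfolding idx_def by (rule Least_le) fact
  show "I \<le> idx n"
  proof (rule ccontr)
    assume "\<not> I \<le> idx n"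
    then have "L (Suc (idx n)) \<le> L I" by (intro L_mono) simp
    then show False using idx_less[of n] assms by simp
  qed
qed

lemma idx_lim: "filterlim idx at_top sequentially"
  unfolding filterlim_at_top eventually_sequentially
proof
  fix I
  have "I \<le> idx n" if "nat \<lceil>L I\<rceil> \<le> n" for n
  proof (rule ccontr)
    assume "\<not> I \<le> idx n"
    then have "L (Suc (idx n)) \<le> L I" by (intro L_mono) simp
    moreover have "L I \<le> real n" using that by linarith
    ultimately show False using idx_less[of n] by simp
  qed
  then show "\<exists>N. \<forall>n\<ge>N. I \<le> idx n" by blast
qed

lemma ev_idx: "eventually P sequentially \<Longrightarrow> \<forall>\<^sub>F n in sequentially. P (idx n)"
  by (rule eventually_compose_filterlim[OF _ idx_lim])

lemma ev_small:
  assumes "(\<lambda>I. r I / L I) \<longlonglongrightarrow> 0" "\<eta> > 0"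
  shows "\<forall>\<^sub>F n in sequentially. r (idx n) \<le> \<eta> * real n"
proof -
  have "\<forall>\<^sub>F I in sequentially. r I / L I < \<eta> \<and> I > 0"
    using assms by (intro eventually_conj order_tendstoD(2) eventually_gt_at_top) auto
  then have "\<forall>\<^sub>F n in sequentially. r (idx n) / L (idx n) < \<eta> \<and> idx n > 0" by (rule ev_idx)
  then show ?thesis
  proof eventually_elim
    case (elim n)
    then have "r (idx n) \<le> \<eta> * L (idx n)" using L_pos[of "idx n"] by (simp add: field_simps)
    also have "\<dots> \<le> \<eta> * real n" using assms(2) idx_le by (intro mult_left_mono) auto
    finally show ?case .
  qed
qed

text \<open>The edited word of the completed blocks has length \<open>L (idx n)\<close> up to
  \<open>E (idx n)\<close>, and \<open>n\<close> exceeds \<open>L (idx n)\<close> by less than one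
  block. The prefix of length \<open>n\<close> is thus obtained from it by a few deletions or
  insertions at its end, uniformly in \<omega>.\<close>

lemma track:
  assumes "\<eta> > 0"
  shows "\<forall>\<^sub>F n in sequentially. \<forall>\<omega>\<in>choices. pre (pt \<omega>) n \<in> edit_ball p (\<eta> * real n) (src \<omega> (idx n))"
proof -
  have "(\<lambda>I. real (l (s I)) / L I + 2 * (E I / L I)) \<longlonglongrightarrow> 0 + 2 * 0"
    using s_ratio E_small by (intro tendsto_add tendsto_mult tendsto_const) (simp_all add: L_def)
  then have "(\<lambda>I. (real (l (s I)) + 2 * E I) / L I) \<longlonglongrightarrow> 0"
    by (simp add: add_divide_distrib)
  then have "\<forall>\<^sub>F n in sequentially. real (l (s (idx n))) + 2 * E (idx n) \<le> \<eta> * real n"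
    using assms by (rule ev_small[where r = "\<lambda>I. real (l (s I)) + 2 * E I"])
  moreover have "\<forall>\<^sub>F n in sequentially. idx n > 0" by (rule ev_idx[OF eventually_gt_at_top])
  ultimately show ?thesis
  proof eventually_elim
    case (elim n)
    show ?case
    proof
      fix \<omega> assume \<omega>: "\<omega> \<in> choices"
      obtain I where I: "idx n = Suc I" using elim(2) by (cases "idx n") auto
      define Z where "Z = chain \<omega> I"
      have Z: "Z \<in> edit_ball p (E (idx n)) (src \<omega> (idx n))" using chain_ball[OF \<omega>, of I] by (simp add: Z_def I)
      then have lenZ: "\<bar>real (length Z) - L (idx n)\<bar> \<le> E (idx n)"
        using edit_ball_length length_src[OF \<omega>] by metis
      \<comment> \<open>This chain extends \<open>Z\<close> and has more than \<open>n\<close>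
        letters, so both prefixes can be compared inside one word.\<close>
      obtain z where z: "chain \<omega> (I + n) = Z @ z" using chain_prefix[of \<omega> I n] by (auto simp: Z_def)
      define V where "V = chain \<omega> (I + n)"
      have Vw: "V \<in> words p" unfolding V_def by (rule G_words[OF chain_G[OF \<omega>]])
      have V: "n \<le> length V" "length Z \<le> length V" "take (length Z) V = Z"
        using chain_length[OF \<omega>, of "I + n"] z by (auto simp: V_def)
      have "take n V = pre (pt \<omega>) n"
        using pre_pt_chain[OF \<omega>, of "I + n"] V(1) take_pre[of n "pt \<omega>" "length V"] by (simp add: V_def min_def)
      moreover have "take n V \<in> edit_ball p (real (l (s (idx n))) + E (idx n)) (take (length Z) V)"
      proof (rule edit_ball_prefix)
        show "\<bar>real n - real (length Z)\<bar> \<le> real (l (s (idx n))) + E (idx n)"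
          using lenZ idx_le[of n] idx_less[of n] by (simp add: L_Suc)
      qed (use V Vw in auto)
      ultimately have "pre (pt \<omega>) n \<in> edit_ball p (E (idx n) + (real (l (s (idx n))) + E (idx n))) (src \<omega> (idx n))"
        using V(3) by (intro edit_ball_trans[OF Z]) simp
      then show "pre (pt \<omega>) n \<in> edit_ball p (\<eta> * real n) (src \<omega> (idx n))"
        by (rule edit_ball_mono) (use elim(1) in simp)
    qed
  qed
qed

text \<open>Stages below \<open>length u\<close> give no information on \<open>u\<close> and are
  charged with their full length. Each seam costs \<open>length u\<close>, which
  \<open>one_le\<close> absorbs into \<open>length u * E I\<close>.\<close>

lemma occ_src:
  assumes \<omega>: "\<omega> \<in> choices" and u: "u \<in> words p"
  shows "\<bar>real (occ u (src \<omega> I)) - (\<Sum>i<I. real (l (s i)) * c (s i) u)\<bar> \<le>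
    real (length u) * E I + (\<Sum>i<I. real (l (s i)) * (if s i < length u then 1 else e (s i)))"
proof (induction I)
  case 0
  then show ?case by (simp add: src_def E_0)
next
  case (Suc I)
  let ?n = "s I"
  have W: "\<omega> I \<in> D ?n" using \<omega> by (simp add: choices_def)
  have len: "length (\<omega> I) = l ?n" using W D_block[of ?n] by (auto simp: block_def)
  have 1: "\<bar>real (occ u (\<omega> I)) - real (l ?n) * c ?n u\<bar> \<le> real (l ?n) * (if ?n < length u then 1 else e ?n)"
  proof (cases "?n < length u")
    case True
    have "real (l ?n) * c ?n u \<le> real (l ?n) * 1" using c_le by (intro mult_left_mono) auto
    moreover have "0 \<le> real (l ?n) * c ?n u" using c_ge by simp
    moreover have "real (occ u (\<omega> I)) \<le> real (l ?n)" using occ_le_length[of u "\<omega> I"] len by simp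
    ultimately show ?thesis using True by (simp add: abs_le_iff)
  next
    case False
    then show ?thesis using D_occ[OF W u] by (simp add: mult.commute)
  qed
  have oa: "occ u (src \<omega> I) + occ u (\<omega> I) \<le> occ u (src \<omega> I @ \<omega> I)"
    "occ u (src \<omega> I @ \<omega> I) \<le> occ u (src \<omega> I) + occ u (\<omega> I) + length u"
    using occ_append[of u "src \<omega> I" "\<omega> I"] by auto
  have 2: "\<bar>real (occ u (src \<omega> (Suc I))) - (real (occ u (src \<omega> I)) + real (occ u (\<omega> I)))\<bar> \<le> real (length u)"
    using oa unfolding src_Suc by linarith
  have 3: "real (length u) \<le> real (length u) * (2 * (real (l ?n) * e ?n))"
  proof -
    have "1 \<le> 2 * (real (l ?n) * e ?n)" using one_le[of ?n] by (simp add: mult.commute)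
    then have "real (length u) * 1 \<le> real (length u) * (2 * (real (l ?n) * e ?n))" by (rule mult_left_mono) simp
    then show ?thesis by simp
  qed
  have 4: "real (length u) * E (Suc I) = real (length u) * E I + real (length u) * (2 * (real (l ?n) * e ?n))"
    by (simp add: E_Suc distrib_left)
  show ?case using Suc 1 2 3 unfolding 4 sum.lessThan_Suc by linarith
qed

lemma visits_track:
  assumes u: "u \<in> words p" and "\<eta> > 0"
  shows "\<forall>\<^sub>F n in sequentially. \<forall>\<omega>\<in>choices.
    \<bar>real (visits u (pt \<omega>) n) - (\<Sum>i<idx n. real (l (s i)) * c (s i) u)\<bar> \<le> \<eta> * real n"
proof -
  let ?k = "real (length u)"
  define r where "r I = ?k * E I + (\<Sum>i<I. real (l (s i)) * (if s i < length u then 1 else e (s i)))" for I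
  \<comment> \<open>The uninformative stages are finitely many, so they disappear in the
    average.\<close>
  have "(\<lambda>I. (\<Sum>i<I. real (l (s i)) * (\<lambda>n. if n < length u then 1 else e n) (s i)) / L I) \<longlonglongrightarrow> 0"
  proof (rule cesaro_null)
    show "\<bar>if n < length u then 1 else e n\<bar> \<le> 1" for n using e_pos[of n] e_le[of n] by simp
    have "\<forall>\<^sub>F n in sequentially. e n = (if n < length u then 1 else e n)"
      using eventually_ge_at_top[of "length u"] by eventually_elim simp
    then show "(\<lambda>n. if n < length u then 1 else e n) \<longlonglongrightarrow> 0" by (rule Lim_transform_eventually[OF e_lim])
  qed
  then have "(\<lambda>I. ?k * (E I / L I) + (\<Sum>i<I. real (l (s i)) * (if s i < length u then 1 else e (s i))) / L I) \<longlonglongrightarrow> ?k * 0 + 0"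
    using E_small by (intro tendsto_add tendsto_mult tendsto_const)
  then have "(\<lambda>I. r I / L I) \<longlonglongrightarrow> 0" by (simp add: r_def add_divide_distrib)
  then have ev1: "\<forall>\<^sub>F n in sequentially. r (idx n) \<le> \<eta> / 3 * real n" using assms(2) by (intro ev_small) auto
  \<comment> \<open>Each edit changes an occurrence count by up to
    \<open>2 * length u + 1\<close>.\<close>
  define \<eta>' where "\<eta>' = \<eta> / (3 * (2 * ?k + 1))"
  have "2 * ?k + 1 > 0" by (simp add: add_nonneg_pos)
  then have \<eta>': "\<eta>' > 0" "\<eta>' * (2 * ?k + 1) = \<eta> / 3" using assms(2) by (simp_all add: \<eta>'_def divide_simps)
  have ev2: "\<forall>\<^sub>F n in sequentially. ?k \<le> \<eta> / 3 * real n" using assms(2) by real_asymp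
  show ?thesis using ev1 ev2 track[OF \<eta>'(1)]
  proof eventually_elim
    case (elim n)
    show ?case
    proof
      fix \<omega> assume \<omega>: "\<omega> \<in> choices"
      have "\<bar>real (occ u (pre (pt \<omega>) n)) - real (occ u (src \<omega> (idx n)))\<bar> \<le> (\<eta>' * real n) * real (2 * length u + 1)"
        using elim(3) \<omega> by (intro edit_ball_occ) auto
      also have "\<dots> = (\<eta>' * (2 * ?k + 1)) * real n" by (simp add: algebra_simps)
      also have "\<dots> = \<eta> / 3 * real n" by (simp only: \<eta>'(2))
      finally have 1: "\<bar>real (occ u (pre (pt \<omega>) n)) - real (occ u (src \<omega> (idx n)))\<bar> \<le> \<eta> / 3 * real n" .
      have 2: "\<bar>real (visits u (pt \<omega>) n) - real (occ u (pre (pt \<omega>) n))\<bar> \<le> ?k"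
        using visits_occ[of u "pt \<omega>" n] by linarith
      have 3: "\<bar>real (occ u (src \<omega> (idx n))) - (\<Sum>i<idx n. real (l (s i)) * c (s i) u)\<bar> \<le> r (idx n)"
        unfolding r_def by (rule occ_src[OF \<omega> u])
      have "\<eta> * real n = \<eta> / 3 * real n + \<eta> / 3 * real n + \<eta> / 3 * real n" by simp
      then show "\<bar>real (visits u (pt \<omega>) n) - (\<Sum>i<idx n. real (l (s i)) * c (s i) u)\<bar> \<le> \<eta> * real n"
        using 1 2 3 elim(1,2) by linarith
    qed
  qed
qed

text \<open>\<open>visits_track\<close> compares the visits with a weighted average over all stages
  so far, and \<open>s_cesaro\<close> replaces the average by the value of the current stage. The
  unfinished block is negligible by \<open>s_ratio\<close>.\<close>

lemma frequency_track:
  assumes u: "u \<in> words p" and "\<eta> > 0"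
  shows "\<forall>\<^sub>F n in sequentially. \<forall>\<omega>\<in>choices. \<bar>frequency (pt \<omega>) n u - c (s (idx n)) u\<bar> \<le> \<eta>"
proof -
  let ?S = "\<lambda>I. \<Sum>i<I. real (l (s i)) * c (s i) u"
  have "(\<lambda>I. ?S I / (\<Sum>i<I. real (l (s i))) - c (s I) u) \<longlonglongrightarrow> 0"
    using c_ge c_le by (intro s_cesaro[of "\<lambda>n. c n u" 1] c_slow) (simp add: abs_le_iff order_trans[of _ 0])
  then have lim: "(\<lambda>I. ?S I / L I - c (s I) u) \<longlonglongrightarrow> 0" by (simp add: L_def)
  have "\<forall>\<^sub>F I in sequentially. \<bar>?S I / L I - c (s I) u\<bar> = \<bar>?S I - L I * c (s I) u\<bar> / L I"
    using eventually_gt_at_top[of 0]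
  proof eventually_elim
    case (elim I)
    have "?S I / L I - c (s I) u = (?S I - L I * c (s I) u) / L I"
      using L_pos[OF elim] by (simp add: diff_divide_distrib)
    then show ?case using L_pos[OF elim] by (simp add: abs_divide)
  qed
  with tendsto_rabs_zero[OF lim] have "(\<lambda>I. \<bar>?S I - L I * c (s I) u\<bar> / L I) \<longlonglongrightarrow> 0"
    by (rule Lim_transform_eventually)
  then have ev1: "\<forall>\<^sub>F n in sequentially. \<bar>?S (idx n) - L (idx n) * c (s (idx n)) u\<bar> \<le> \<eta> / 3 * real n"
    using assms(2) by (intro ev_small[where r = "\<lambda>I. \<bar>?S I - L I * c (s I) u\<bar>"]) auto
  have ev2: "\<forall>\<^sub>F n in sequentially. real (l (s (idx n))) \<le> \<eta> / 3 * real n"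
    using s_ratio assms(2) by (intro ev_small[where r = "\<lambda>I. real (l (s I))"]) (auto simp: L_def)
  have ev3: "\<forall>\<^sub>F n in sequentially. \<forall>\<omega>\<in>choices. \<bar>real (visits u (pt \<omega>) n) - ?S (idx n)\<bar> \<le> \<eta> / 3 * real n"
    using assms(2) by (intro visits_track u) auto
  show ?thesis using ev1 ev2 ev3 eventually_gt_at_top[of 0]
  proof eventually_elim
    case (elim n)
    show ?case
    proof
      fix \<omega> assume \<omega>: "\<omega> \<in> choices"
      let ?c = "c (s (idx n)) u"
      have "\<bar>L (idx n) * ?c - real n * ?c\<bar> = (real n - L (idx n)) * ?c"
        using idx_le[of n] c_ge[of "s (idx n)" u] by (simp add: left_diff_distrib[symmetric] abs_mult)
      also have "\<dots> \<le> real (l (s (idx n))) * 1"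
        using idx_le[of n] idx_less[of n] c_ge[of "s (idx n)" u] c_le[of "s (idx n)" u]
        by (intro mult_mono) (auto simp: L_Suc)
      finally have 1: "\<bar>L (idx n) * ?c - real n * ?c\<bar> \<le> real (l (s (idx n)))" by simp
      have 2: "\<bar>real (visits u (pt \<omega>) n) - ?S (idx n)\<bar> \<le> \<eta> / 3 * real n" using elim(3) \<omega> by blast
      have "\<eta> * real n = \<eta> / 3 * real n + \<eta> / 3 * real n + \<eta> / 3 * real n" by simp
      then have "\<bar>real (visits u (pt \<omega>) n) - real n * ?c\<bar> \<le> \<eta> * real n"
        using elim(1,2) 1 2 by linarith
      moreover have "real (visits u (pt \<omega>) n) - real n * ?c = real n * (frequency (pt \<omega>) n u - ?c)"
        using elim(4) by (simp add: frequency_def right_diff_distrib)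
      ultimately have "real n * \<bar>frequency (pt \<omega>) n u - ?c\<bar> \<le> real n * \<eta>"
        by (simp only: abs_mult abs_of_nat mult.commute)
      then show "\<bar>frequency (pt \<omega>) n u - ?c\<bar> \<le> \<eta>" using elim(4) by simp
    qed
  qed
qed

end

section \<open>Mass distribution\<close>

text \<open>Countable subadditivity along an enumeration of \<open>S\<close>; each
  \<open>f n\<close> has at most one element, and finite partial sums stay below the unordered
  sum.\<close>

lemma emeasure_UN_le_infsum:
  assumes "countable S" "\<And>w. w \<in> S \<Longrightarrow> B w \<in> sets M" "\<And>w. w \<in> S \<Longrightarrow> emeasure M (B w) \<le> g w"
  shows "emeasure M (\<Union>w\<in>S. B w) \<le> infsum g S"
proof -
  define f where "f n = {w \<in> S. to_nat_on S w = n}" for n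
  define B' where "B' n = (\<Union>w\<in>f n. B w)" for n
  have inj: "inj_on (to_nat_on S) S" using assms(1) by (rule inj_on_to_nat_on)
  have f1: "f n = {} \<or> (\<exists>w\<in>S. f n = {w})" for n
    using inj unfolding f_def inj_on_def by blast
  have B': "B' n \<in> sets M" for n using f1[of n] assms(2) by (auto simp: B'_def)
  have le: "emeasure M (B' n) \<le> (\<Sum>w\<in>f n. g w)" for n using f1[of n] assms(3) by (auto simp: B'_def)
  have "(\<Union>w\<in>S. B w) = (\<Union>n. B' n)" by (auto simp: B'_def f_def)
  also have "emeasure M \<dots> \<le> (\<Sum>n. emeasure M (B' n))"
    using B' by (intro emeasure_subadditive_countably) auto
  also have "\<dots> = (SUP n. \<Sum>i<n. emeasure M (B' i))" by (rule suminf_eq_SUP)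
  also have "\<dots> \<le> infsum g S"
  proof (rule SUP_least)
    fix n
    have fin: "finite (f i)" for i using f1[of i] by auto
    have "(\<Sum>i<n. emeasure M (B' i)) \<le> (\<Sum>i<n. \<Sum>w\<in>f i. g w)" by (intro sum_mono le)
    also have "\<dots> = (\<Sum>w\<in>(\<Union>i<n. f i). g w)"
      using fin by (intro sum.UNION_disjoint[symmetric]) (auto simp: f_def)
    also have "\<dots> \<le> infsum g S"
    proof -
      have "infsum g S = (SUP F\<in>{F. finite F \<and> F \<subseteq> S}. sum g F)" by (rule nonneg_infsum_complete) simp
      moreover have "(\<Union>i<n. f i) \<in> {F. finite F \<and> F \<subseteq> S}" using fin by (auto simp: f_def)
      ultimately show ?thesis by (simp only: SUP_upper)
    qed
    finally show "(\<Sum>i<n. emeasure M (B' i)) \<le> infsum g S" .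
  qed
  finally show ?thesis .
qed

context moran
begin

section \<open>Independent uniform choice of the blocks\<close>

definition choice_measure :: "(nat \<Rightarrow> nat list) measure" where
  "choice_measure = PiM UNIV (\<lambda>i. uniform_count_measure (D (s i)))"

lemma finite_D: "finite (D n)"
  using D_block finite_block finite_subset by blast

lemma card_D_pos: "card (D n) > 0"
  using finite_D D_ne by (simp add: card_gt_0_iff)

lemma product_choices: "product_prob_space (\<lambda>i. uniform_count_measure (D (s i)))"
proof -
  interpret prob_space "uniform_count_measure (D (s i))" for i
    using finite_D D_ne by (rule prob_space_uniform_count_measure)
  show ?thesis by unfold_locales
qed

lemma space_choice_measure: "space choice_measure = choices"
  by (auto simp: choice_measure_def space_PiM space_uniform_count_measure choices_def PiE_def)

lemma emeasure_choice_measure: "emeasure choice_measure choices = 1"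
proof -
  interpret product_prob_space "\<lambda>i. uniform_count_measure (D (s i))" UNIV by (rule product_choices)
  show ?thesis using P.emeasure_space_1 by (simp add: choice_measure_def space_choice_measure[unfolded choice_measure_def])
qed

definition choice_cylinder :: "(nat \<Rightarrow> nat list) \<Rightarrow> nat \<Rightarrow> (nat \<Rightarrow> nat list) set" where
  "choice_cylinder \<omega> I = {\<omega>' \<in> choices. \<forall>i<I. \<omega>' i = \<omega> i}"

lemma choice_cylinder:
  assumes "\<omega> \<in> choices"
  shows "choice_cylinder \<omega> I \<in> sets choice_measure"
    and "emeasure choice_measure (choice_cylinder \<omega> I) = ennreal (exp (- (\<Sum>i<I. ln (real (card (D (s i)))))))"
proof -
  interpret product_prob_space "\<lambda>i. uniform_count_measure (D (s i))" UNIV by (rule product_choices)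
  have eq: "choice_cylinder \<omega> I = prod_emb UNIV (\<lambda>i. uniform_count_measure (D (s i))) {..<I} (Pi\<^sub>E {..<I} (\<lambda>i. {\<omega> i}))"
    by (auto simp: choice_cylinder_def prod_emb_def choices_def space_uniform_count_measure PiE_def restrict_def Pi_def extensional_def)
  have m: "{\<omega> i} \<in> sets (uniform_count_measure (D (s i)))" for i
    using assms by (simp add: sets_uniform_count_measure choices_def)
  show "choice_cylinder \<omega> I \<in> sets choice_measure"
    unfolding eq choice_measure_def by (rule sets_PiM_I) (use m in auto)
  have "emeasure choice_measure (choice_cylinder \<omega> I) = (\<Prod>i<I. emeasure (uniform_count_measure (D (s i))) {\<omega> i})"
    unfolding eq choice_measure_def by (rule emeasure_PiM_emb) (use m in auto)
  also have "\<dots> = (\<Prod>i<I. ennreal (exp (- ln (real (card (D (s i)))))))"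
  proof (intro prod.cong refl)
    fix i
    have "\<omega> i \<in> D (s i)" using assms by (simp add: choices_def)
    then have "emeasure (uniform_count_measure (D (s i))) {\<omega> i} = ennreal (1 / real (card (D (s i))))"
      using finite_D by (subst emeasure_uniform_count_measure) auto
    also have "1 / real (card (D (s i))) = exp (- ln (real (card (D (s i)))))"
      using card_D_pos by (simp add: exp_minus inverse_eq_divide)
    finally show "emeasure (uniform_count_measure (D (s i))) {\<omega> i} = ennreal (exp (- ln (real (card (D (s i))))))" .
  qed
  also have "\<dots> = ennreal (\<Prod>i<I. exp (- ln (real (card (D (s i))))))" by (rule prod_ennreal) simp
  also have "(\<Prod>i<I. exp (- ln (real (card (D (s i)))))) = exp (- (\<Sum>i<I. ln (real (card (D (s i))))))"
    by (simp add: exp_sum sum_negf[symmetric])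
  finally show "emeasure choice_measure (choice_cylinder \<omega> I) = ennreal (exp (- (\<Sum>i<I. ln (real (card (D (s i)))))))" .
qed

text \<open>The schedule alone fixes the block lengths, so a source word determines its
  blocks.\<close>

lemma src_inj:
  assumes "\<omega> \<in> choices" "\<omega>' \<in> choices" "src \<omega> I = src \<omega>' I" "i < I"
  shows "\<omega> i = \<omega>' i"
  using assms(3,4)
proof (induction I)
  case (Suc I)
  have "\<omega> I \<in> D (s I)" "\<omega>' I \<in> D (s I)" using assms(1,2) by (simp_all add: choices_def)
  then have "\<omega> I \<in> block p (l (s I))" "\<omega>' I \<in> block p (l (s I))" using D_block by blast+
  then have "length (\<omega> I) = length (\<omega>' I)" by (simp add: block_def)
  then have "src \<omega> I = src \<omega>' I" "\<omega> I = \<omega>' I" using Suc.prems(1) by (auto simp: src_Suc)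
  then show ?case using Suc by (cases "i = I") auto
qed simp

text \<open>Each source word in the ball fixes the first \<open>I\<close> choices, that is, one
  cylinder of choices. The finite union \<open>B\<close> of these cylinders is a measurable
  superset, which is all that the covering argument asks for.\<close>

lemma mass_ball:
  "\<exists>B\<in>sets choice_measure. {\<omega> \<in> choices. src \<omega> I \<in> edit_ball p r w} \<subseteq> B \<and>
    emeasure choice_measure B \<le> ennreal (real (card (edit_ball p r w)) * exp (- (\<Sum>i<I. ln (real (card (D (s i)))))))"
proof -
  define Y where "Y = {z \<in> edit_ball p r w. \<exists>\<omega>\<in>choices. src \<omega> I = z}"
  have finY: "finite Y" unfolding Y_def using finite_edit_ball[of p r w] by simp
  have "\<forall>z\<in>Y. \<exists>\<omega>. \<omega> \<in> choices \<and> src \<omega> I = z" by (auto simp: Y_def)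
  from bchoice[OF this] obtain \<Omega> where \<Omega>: "\<And>z. z \<in> Y \<Longrightarrow> \<Omega> z \<in> choices" "\<And>z. z \<in> Y \<Longrightarrow> src (\<Omega> z) I = z" by blast
  define B where "B = (\<Union>z\<in>Y. choice_cylinder (\<Omega> z) I)"
  let ?m = "exp (- (\<Sum>i<I. ln (real (card (D (s i))))))"
  have "B \<in> sets choice_measure"
    unfolding B_def using finY choice_cylinder(1)[OF \<Omega>(1)] by (intro sets.finite_UN) auto
  moreover have "{\<omega> \<in> choices. src \<omega> I \<in> edit_ball p r w} \<subseteq> B"
  proof
    fix \<omega> assume "\<omega> \<in> {\<omega> \<in> choices. src \<omega> I \<in> edit_ball p r w}"
    then have \<omega>: "\<omega> \<in> choices" "src \<omega> I \<in> edit_ball p r w" by auto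
    then have z: "src \<omega> I \<in> Y" by (auto simp: Y_def)
    have "src \<omega> I = src (\<Omega> (src \<omega> I)) I" using \<Omega>(2)[OF z] by simp
    from src_inj[OF \<omega>(1) \<Omega>(1)[OF z] this] have "\<omega> \<in> choice_cylinder (\<Omega> (src \<omega> I)) I"
      unfolding choice_cylinder_def using \<omega>(1) by blast
    then show "\<omega> \<in> B" using z unfolding B_def by blast
  qed
  moreover have "emeasure choice_measure B \<le> ennreal (real (card (edit_ball p r w)) * ?m)"
  proof -
    have "emeasure choice_measure B \<le> (\<Sum>z\<in>Y. emeasure choice_measure (choice_cylinder (\<Omega> z) I))"
      unfolding B_def using finY choice_cylinder(1)[OF \<Omega>(1)] by (intro emeasure_subadditive_finite) auto
    also have "\<dots> = (\<Sum>z\<in>Y. ennreal ?m)" using choice_cylinder(2)[OF \<Omega>(1)] by (intro sum.cong) auto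
    also have "\<dots> = ennreal (\<Sum>z\<in>Y. ?m)" by (rule sum_ennreal) simp
    also have "(\<Sum>z\<in>Y. ?m) = real (card Y) * ?m" by simp
    also have "ennreal (real (card Y) * ?m) \<le> ennreal (real (card (edit_ball p r w)) * ?m)"
    proof (intro ennreal_leI mult_right_mono)
      have "card Y \<le> card (edit_ball p r w)" unfolding Y_def by (intro card_mono finite_edit_ball) auto
      then show "real (card Y) \<le> real (card (edit_ball p r w))" by simp
    qed simp
    finally show ?thesis .
  qed
  ultimately show ?thesis by blast
qed

text \<open>The mass distribution principle, with the image of the uniform choice measure as mass.\<close>

lemma pressure_limit_ge:
  fixes \<phi> :: "(nat \<Rightarrow> nat) \<Rightarrow> real"
  assumes X': "compact X" and \<phi>: "continuous_on X \<phi>" and Z: "\<And>\<omega>. \<omega> \<in> choices \<Longrightarrow> pt \<omega> \<in> Z" and \<delta>: "\<delta> > 0"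
    and key: "\<forall>\<^sub>F n in sequentially. \<forall>\<omega>\<in>choices. \<delta> * real n - (\<Sum>i<idx n. ln (real (card (D (s i))))) \<le>
      - t * real n + (\<Sum>k<n. \<phi> ((shift_map ^^ k) (pt \<omega>)))"
  shows "1 \<le> pressure_limit p X Z t \<phi>"
proof -
  obtain \<eta> where \<eta>: "0 < \<eta>" "\<forall>\<^sub>F n in sequentially. \<forall>w. length w \<le> n \<longrightarrow>
      real (card (edit_ball p (\<eta> * real n) w)) \<le> exp (\<delta> * real n)"
    by (rule edit_ball_subexponential[OF \<delta>]) blast
  have "\<forall>\<^sub>F n in sequentially. (\<forall>w. length w \<le> n \<longrightarrow> real (card (edit_ball p (\<eta> * real n) w)) \<le> exp (\<delta> * real n)) \<and>
    (\<forall>\<omega>\<in>choices. pre (pt \<omega>) n \<in> edit_ball p (\<eta> * real n) (src \<omega> (idx n))) \<and>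
    (\<forall>\<omega>\<in>choices. \<delta> * real n - (\<Sum>i<idx n. ln (real (card (D (s i))))) \<le>
      - t * real n + (\<Sum>k<n. \<phi> ((shift_map ^^ k) (pt \<omega>))))"
    by (intro eventually_conj \<eta>(2) track[OF \<eta>(1)] key)
  then obtain N where N: "\<And>n w. n \<ge> N \<Longrightarrow> length w \<le> n \<Longrightarrow> real (card (edit_ball p (\<eta> * real n) w)) \<le> exp (\<delta> * real n)"
    "\<And>n \<omega>. n \<ge> N \<Longrightarrow> \<omega> \<in> choices \<Longrightarrow> pre (pt \<omega>) n \<in> edit_ball p (\<eta> * real n) (src \<omega> (idx n))"
    "\<And>n \<omega>. n \<ge> N \<Longrightarrow> \<omega> \<in> choices \<Longrightarrow> \<delta> * real n - (\<Sum>i<idx n. ln (real (card (D (s i))))) \<le>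
      - t * real n + (\<Sum>k<n. \<phi> ((shift_map ^^ k) (pt \<omega>)))"
    unfolding eventually_sequentially by blast
  have "compact (\<phi> ` X)" using X' \<phi> compact_continuous_image by blast
  then obtain M where M: "\<And>x. x \<in> X \<Longrightarrow> \<phi> x \<le> M"
    by (meson bounded_imp_bdd_above bdd_above.E compact_imp_bounded imageI)
  define g where "g w = exp (- t * real (length w) +
    (SUP x\<in>cylinder p w \<inter> X. \<Sum>k<length w. \<phi> ((shift_map ^^ k) x)))" for w
  \<comment> \<open>The choices whose point starts with \<open>w\<close> have their sources within
    \<open>\<eta> * real (length w)\<close> edits of \<open>w\<close>, so there are at most
    \<open>exp (\<delta> * real (length w))\<close> such sources. The hypothesis \<open>key\<close>
    reserves exactly this margin.\<close>
  have mass: "\<exists>B\<in>sets choice_measure. {\<omega> \<in> choices. pre (pt \<omega>) (length w) = w} \<subseteq> B \<and> emeasure choice_measure B \<le> ennreal (g w)"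
    if n: "length w \<ge> N" for w
  proof (cases "\<exists>\<omega>\<in>choices. pre (pt \<omega>) (length w) = w")
    case True
    then obtain \<omega> where \<omega>: "\<omega> \<in> choices" "pre (pt \<omega>) (length w) = w" by blast
    let ?n = "length w"
    obtain B where B: "B \<in> sets choice_measure" "{\<omega> \<in> choices. src \<omega> (idx ?n) \<in> edit_ball p (\<eta> * real ?n) w} \<subseteq> B"
      "emeasure choice_measure B \<le> ennreal (real (card (edit_ball p (\<eta> * real ?n) w)) * exp (- (\<Sum>i<idx ?n. ln (real (card (D (s i)))))))"
      using mass_ball[of "idx ?n" "\<eta> * real ?n" w] by blast
    have "{\<omega> \<in> choices. pre (pt \<omega>) ?n = w} \<subseteq> {\<omega> \<in> choices. src \<omega> (idx ?n) \<in> edit_ball p (\<eta> * real ?n) w}"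
    proof
      fix \<omega>' assume "\<omega>' \<in> {\<omega> \<in> choices. pre (pt \<omega>) ?n = w}"
      then have \<omega>': "\<omega>' \<in> choices" "pre (pt \<omega>') ?n = w" by auto
      have "w \<in> edit_ball p (\<eta> * real ?n) (src \<omega>' (idx ?n))" using N(2)[OF n \<omega>'(1)] unfolding \<omega>'(2) .
      then show "\<omega>' \<in> {\<omega> \<in> choices. src \<omega> (idx ?n) \<in> edit_ball p (\<eta> * real ?n) w}"
        using edit_ball_sym[THEN iffD1] \<omega>'(1) by blast
    qed
    moreover have "real (card (edit_ball p (\<eta> * real ?n) w)) * exp (- (\<Sum>i<idx ?n. ln (real (card (D (s i)))))) \<le> g w"
    proof -
      have "real (card (edit_ball p (\<eta> * real ?n) w)) * exp (- (\<Sum>i<idx ?n. ln (real (card (D (s i)))))) \<le>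
        exp (\<delta> * real ?n) * exp (- (\<Sum>i<idx ?n. ln (real (card (D (s i))))))"
        using N(1)[OF n] by (intro mult_right_mono) auto
      also have "\<dots> = exp (\<delta> * real ?n - (\<Sum>i<idx ?n. ln (real (card (D (s i))))))"
        by (simp add: exp_add[symmetric])
      also have "\<dots> \<le> exp (- t * real ?n + (\<Sum>k<?n. \<phi> ((shift_map ^^ k) (pt \<omega>))))"
        using N(3)[OF n \<omega>(1)] by (simp only: exp_le_cancel_iff)
      also have "\<dots> \<le> g w"
        unfolding g_def exp_le_cancel_iff
      proof (intro add_left_mono cSUP_upper)
        show "pt \<omega> \<in> cylinder p w \<inter> X" using pt_X[OF \<omega>(1)] X(1) \<omega>(2) by (auto simp: cylinder_pre)
        show "bdd_above ((\<lambda>x. \<Sum>k<?n. \<phi> ((shift_map ^^ k) x)) ` (cylinder p w \<inter> X))"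
        proof (rule bdd_aboveI2)
          fix x assume "x \<in> cylinder p w \<inter> X"
          then have "(\<Sum>k<?n. \<phi> ((shift_map ^^ k) x)) \<le> (\<Sum>k<?n. M)"
            using funpow_shift_in[OF X(3)] by (intro sum_mono M) auto
          then show "(\<Sum>k<?n. \<phi> ((shift_map ^^ k) x)) \<le> real ?n * M" by simp
        qed
      qed
      finally show ?thesis .
    qed
    then have "emeasure choice_measure B \<le> ennreal (g w)" by (intro order_trans[OF B(3)] ennreal_leI)
    ultimately show ?thesis using B by blast
  next
    case False
    then have "{\<omega> \<in> choices. pre (pt \<omega>) (length w) = w} = {}" by blast
    then show ?thesis by (intro bexI[of _ "{}"]) auto
  qed
  have "1 \<le> pressure_sum p X Z t \<phi> N"
    unfolding pressure_sum_def g_def[symmetric]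
  proof (rule INF_greatest)
    fix S assume "S \<in> {S. countable S \<and> S \<subseteq> language p X \<and> (\<forall>w\<in>S. length w > N) \<and> Z \<subseteq> (\<Union>w\<in>S. cylinder p w)}"
    then have S: "countable S" "\<And>w. w \<in> S \<Longrightarrow> length w > N" "Z \<subseteq> (\<Union>w\<in>S. cylinder p w)" by auto
    have "\<forall>w\<in>S. \<exists>B. B \<in> sets choice_measure \<and> {\<omega> \<in> choices. pre (pt \<omega>) (length w) = w} \<subseteq> B \<and>
      emeasure choice_measure B \<le> ennreal (g w)"
    proof
      fix w assume w: "w \<in> S"
      show "\<exists>B. B \<in> sets choice_measure \<and> {\<omega> \<in> choices. pre (pt \<omega>) (length w) = w} \<subseteq> B \<and>
        emeasure choice_measure B \<le> ennreal (g w)"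
        using mass[OF less_imp_le[OF S(2)[OF w]]] by blast
    qed
    from bchoice[OF this] obtain B where B: "\<And>w. w \<in> S \<Longrightarrow> B w \<in> sets choice_measure"
      "\<And>w. w \<in> S \<Longrightarrow> {\<omega> \<in> choices. pre (pt \<omega>) (length w) = w} \<subseteq> B w"
      "\<And>w. w \<in> S \<Longrightarrow> emeasure choice_measure (B w) \<le> ennreal (g w)" by blast
    have "choices \<subseteq> (\<Union>w\<in>S. B w)"
    proof
      fix \<omega> assume \<omega>: "\<omega> \<in> choices"
      then obtain w where w: "w \<in> S" "pt \<omega> \<in> cylinder p w" using Z S(3) by blast
      then have "\<omega> \<in> {\<omega> \<in> choices. pre (pt \<omega>) (length w) = w}" using \<omega> by (simp add: cylinder_pre)
      then show "\<omega> \<in> (\<Union>w\<in>S. B w)" using B(2) w(1) by blast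
    qed
    then have "emeasure choice_measure choices \<le> emeasure choice_measure (\<Union>w\<in>S. B w)"
      using B(1) S(1) by (intro emeasure_mono sets.countable_UN') auto
    also have "\<dots> \<le> (\<Sum>\<^sub>\<infinity>w\<in>S. ennreal (g w))" by (rule emeasure_UN_le_infsum[OF S(1) B(1,3)])
    finally show "1 \<le> (\<Sum>\<^sub>\<infinity>w\<in>S. ennreal (g w))" by (simp add: emeasure_choice_measure)
  qed
  also have "\<dots> \<le> pressure_limit p X Z t \<phi>" unfolding pressure_limit_eq_SUP by (intro SUP_upper) simp
  finally show ?thesis .
qed

end

section \<open>The lower bound\<close>

text \<open>The metric on functions is a sum of truncated coordinate distances with weights
  \<open>(1 / 2) ^ n\<close>; one summand is bounded by the whole.\<close>

lemma dist_fun_coordinate: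
  fixes x y :: "'a::countable \<Rightarrow> real"
  shows "min \<bar>x u - y u\<bar> 1 \<le> 2 ^ to_nat u * dist x y"
proof -
  let ?f = "\<lambda>n. (1 / 2) ^ n * min (dist (x (from_nat n)) (y (from_nat n))) 1"
  have "summable ?f"
    by (rule summable_comparison_test'[of "\<lambda>n. (1 / 2) ^ n"]) (auto simp: summable_geometric_iff)
  then have "sum ?f {to_nat u} \<le> suminf ?f" by (intro sum_le_suminf) auto
  then have "(1 / 2) ^ to_nat u * min \<bar>x u - y u\<bar> 1 \<le> dist x y"
    by (simp add: dist_fun_def dist_real_def)
  then have "2 ^ to_nat u * ((1 / 2) ^ to_nat u * min \<bar>x u - y u\<bar> 1) \<le> 2 ^ to_nat u * dist x y"
    by (rule mult_left_mono) simp
  moreover have "2 ^ to_nat u * ((1 / 2 :: real) ^ to_nat u * min \<bar>x u - y u\<bar> 1) = min \<bar>x u - y u\<bar> 1"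
    by (simp add: power_one_over)
  ultimately show ?thesis by simp
qed

lemma dist_fun_tendsto_coordinate:
  fixes c d :: "nat \<Rightarrow> 'a::countable \<Rightarrow> real"
  assumes "(\<lambda>n. dist (c n) (d n)) \<longlonglongrightarrow> 0"
  shows "(\<lambda>n. c n u - d n u) \<longlonglongrightarrow> 0"
proof (rule LIMSEQ_I)
  fix r :: real assume "r > 0"
  have "(\<lambda>n. 2 ^ to_nat u * dist (c n) (d n)) \<longlonglongrightarrow> 2 ^ to_nat u * 0" by (intro tendsto_intros assms)
  then have "\<forall>\<^sub>F n in sequentially. 2 ^ to_nat u * dist (c n) (d n) < min r 1"
    using \<open>r > 0\<close> by (intro order_tendstoD(2)) auto
  then have "\<forall>\<^sub>F n in sequentially. norm (c n u - d n u - 0) < r"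
  proof eventually_elim
    case (elim n)
    then show ?case using dist_fun_coordinate[of "c n" u "d n"] by (auto simp: min_def split: if_splits)
  qed
  then show "\<exists>no. \<forall>n\<ge>no. norm (c n u - d n u - 0) < r" by (simp add: eventually_sequentially)
qed

lemma compact_imp_closed_seq:
  assumes "compact (X :: (nat \<Rightarrow> nat) set)"
  shows "closed X"
proof -
  have "Hausdorff_space (euclidean :: nat topology)"
    unfolding Hausdorff_space_def
  proof clarify
    fix x y :: nat assume "x \<noteq> y"
    then show "\<exists>U V. openin euclidean U \<and> openin euclidean V \<and> x \<in> U \<and> y \<in> V \<and> disjnt U V"
      by (intro exI[of _ "{x}"] exI[of _ "{y}"]) (simp add: Topological_Spaces.open_discrete)
  qed
  then have "Hausdorff_space (euclidean :: (nat \<Rightarrow> nat) topology)"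
    unfolding euclidean_product_topology[symmetric] Hausdorff_space_product_topology by simp
  then have "closedin euclidean X" by (rule compactin_imp_closedin) (use assms in simp)
  then show ?thesis by simp
qed

lemma cyl_meas_outside: "X \<subseteq> full_shift p \<Longrightarrow> w \<notin> words p \<Longrightarrow> cyl_meas p X \<mu> w = 0"
proof -
  assume X: "X \<subseteq> full_shift p" and w: "w \<notin> words p"
  have "cylinder p w \<inter> X = {}"
  proof (rule ccontr)
    assume "cylinder p w \<inter> X \<noteq> {}"
    then obtain x where "x \<in> full_shift p" "pre x (length w) = w" by (auto simp: cylinder_pre)
    then show False using pre_words[of x p "length w"] w by simp
  qed
  then show ?thesis by (simp add: cyl_meas_def)
qed

text \<open>The frequencies at time \<open>n\<close> are close to \<open>c (s (idx n))\<close>. All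
  limits therefore lie in the closed image of \<open>K\<close>, and a measure is determined by its
  vector (\<open>sub1\<close>). Conversely \<open>c\<close> comes close to every vector of the
  image, and the schedule passes through every stage (\<open>sub2\<close>).\<close>

lemma (in moran) pt_saturated:
  assumes X': "compact X" and K: "K \<subseteq> borel_probs X" and comp: "compact (cyl_meas p X ` K)"
    and cK: "\<And>n. c n \<in> cyl_meas p X ` K"
    and dense: "\<And>y r. y \<in> cyl_meas p X ` K \<Longrightarrow> r > 0 \<Longrightarrow> \<exists>\<^sub>F n in sequentially. dist (c n) y < r"
    and \<omega>: "\<omega> \<in> choices"
  shows "pt \<omega> \<in> saturated_set X K"
proof -
  let ?x = "pt \<omega>"
  have x: "?x \<in> X" by (rule pt_X[OF \<omega>])
  have near_c: "\<forall>\<^sub>F n in sequentially. \<forall>w\<in>F. \<bar>frequency ?x n w - c (s (idx n)) w\<bar> \<le> r"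
    if "finite F" "F \<subseteq> words p" "r > 0" for F r
    unfolding eventually_ball_finite_distrib[OF that(1)]
  proof
    fix w assume "w \<in> F"
    then have "w \<in> words p" using that(2) by blast
    from frequency_track[OF this that(3)]
    show "\<forall>\<^sub>F n in sequentially. \<bar>frequency ?x n w - c (s (idx n)) w\<bar> \<le> r"
      by eventually_elim (use \<omega> in blast)
  qed
  have sub1: "\<alpha> \<in> K" if \<alpha>: "\<alpha> \<in> borel_probs X" and
    lim: "\<And>F r. finite F \<Longrightarrow> F \<subseteq> words p \<Longrightarrow> r > 0 \<Longrightarrow>
      \<exists>\<^sub>F n in sequentially. \<forall>w\<in>F. \<bar>frequency ?x n w - cyl_meas p X \<alpha> w\<bar> < r" for \<alpha>
  proof -
    have "cyl_meas p X \<alpha> \<in> cyl_meas p X ` K"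
    proof (rule ccontr)
      assume no: "cyl_meas p X \<alpha> \<notin> cyl_meas p X ` K"
      have "open (- (cyl_meas p X ` K))" using compact_imp_closed[OF comp] by (simp add: open_Compl)
      then have op: "openin (product_topology (\<lambda>i. euclidean) UNIV) (- (cyl_meas p X ` K))"
        by (simp add: open_fun_def)
      have in_C: "cyl_meas p X \<alpha> \<in> - (cyl_meas p X ` K)" using no by simp
      obtain U where U: "finite {i. U i \<noteq> (UNIV :: real set)}" "\<And>i. open (U i)" "cyl_meas p X \<alpha> \<in> Pi\<^sub>E UNIV U"
        "Pi\<^sub>E UNIV U \<subseteq> - (cyl_meas p X ` K)"
      proof -
        have "\<exists>U. finite {i \<in> UNIV. U i \<noteq> topspace (euclidean :: real topology)} \<and>
          (\<forall>i\<in>UNIV. openin euclidean (U i)) \<and> cyl_meas p X \<alpha> \<in> Pi\<^sub>E UNIV U \<and> Pi\<^sub>E UNIV U \<subseteq> - (cyl_meas p X ` K)"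
          using op[unfolded openin_product_topology_alt, rule_format, OF in_C] .
        then show ?thesis using that by auto
      qed
      define F0 where "F0 = {i. U i \<noteq> UNIV}"
      have "\<exists>r. r > 0 \<and> ball (cyl_meas p X \<alpha> i) r \<subseteq> U i" for i
      proof -
        have "cyl_meas p X \<alpha> i \<in> U i" using U(3) by auto
        then show ?thesis using U(2)[of i] open_contains_ball by blast
      qed
      then have "\<forall>i. \<exists>r. r > 0 \<and> ball (cyl_meas p X \<alpha> i) r \<subseteq> U i" by blast
      from choice[OF this] obtain rr where rr: "\<And>i. rr i > 0" "\<And>i. ball (cyl_meas p X \<alpha> i) (rr i) \<subseteq> U i" by blast
      define r where "r = Min (insert 1 (rr ` F0))"
      have finF0: "finite F0" using U(1) by (simp add: F0_def)
      have r: "r > 0" "\<And>i. i \<in> F0 \<Longrightarrow> r \<le> rr i" using finF0 rr(1) by (auto simp: r_def)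
      have fin: "finite (F0 \<inter> words p)" using finF0 by simp
      have r3: "r / 3 > 0" using r(1) by simp
      have "\<exists>\<^sub>F n in sequentially. (\<forall>w\<in>F0 \<inter> words p. \<bar>frequency ?x n w - cyl_meas p X \<alpha> w\<bar> < r / 3) \<and>
        (\<forall>w\<in>F0 \<inter> words p. \<bar>frequency ?x n w - c (s (idx n)) w\<bar> \<le> r / 3)"
        by (rule frequently_eventually_frequently[OF lim[OF fin _ r3] near_c[OF fin _ r3]]) auto
      then obtain n where n: "\<And>w. w \<in> F0 \<inter> words p \<Longrightarrow> \<bar>frequency ?x n w - cyl_meas p X \<alpha> w\<bar> < r / 3"
        "\<And>w. w \<in> F0 \<inter> words p \<Longrightarrow> \<bar>frequency ?x n w - c (s (idx n)) w\<bar> \<le> r / 3"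
        using frequently_ex by blast
      have "c (s (idx n)) i \<in> U i" for i
      proof (cases "i \<in> F0")
        case True
        have "\<bar>cyl_meas p X \<alpha> i - c (s (idx n)) i\<bar> < r"
        proof (cases "i \<in> words p")
          case True
          then have "i \<in> F0 \<inter> words p" using \<open>i \<in> F0\<close> by simp
          then show ?thesis using n(1)[of i] n(2)[of i] r(1) by linarith
        next
          \<comment> \<open>A coordinate that is not a word over the alphabet vanishes for every
            measure.\<close>
          case False
          obtain \<mu> where "c (s (idx n)) = cyl_meas p X \<mu>" using cK by blast
          then show ?thesis using cyl_meas_outside[OF X(1) False] r(1) by simp
        qed
        then have "c (s (idx n)) i \<in> ball (cyl_meas p X \<alpha> i) (rr i)"
          using r(2)[OF True] by (simp add: dist_real_def)
        then show ?thesis using rr(2) by blast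
      qed (simp add: F0_def)
      then have "c (s (idx n)) \<in> Pi\<^sub>E UNIV U" by auto
      then show False using U(4) cK by blast
    qed
    then obtain \<mu> where \<mu>: "\<mu> \<in> K" "cyl_meas p X \<alpha> = cyl_meas p X \<mu>" by blast
    have "\<alpha> = \<mu>" using \<mu> K by (intro borel_probs_eqI[OF X(1) \<alpha>]) auto
    then show ?thesis using \<mu>(1) by simp
  qed
  have sub2: "\<exists>\<^sub>F n in sequentially. \<forall>w\<in>F. \<bar>frequency ?x n w - cyl_meas p X \<mu> w\<bar> < r"
    if \<mu>: "\<mu> \<in> K" and F: "finite F" "F \<subseteq> words p" and r: "r > 0" for \<mu> F r
    unfolding frequently_sequentially
  proof
    fix N
    obtain N1 where N1: "\<And>n w. n \<ge> N1 \<Longrightarrow> w \<in> F \<Longrightarrow> \<bar>frequency ?x n w - c (s (idx n)) w\<bar> \<le> r / 3"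
      using near_c[OF F, of "r / 3"] r by (auto simp: eventually_sequentially)
    define V where "V = (\<Inter>w\<in>F. (\<lambda>y :: nat list \<Rightarrow> real. y w) -` ball (cyl_meas p X \<mu> w) (r / 2))"
    have "open V" unfolding V_def using F(1)
      by (intro open_INT ballI open_vimage open_ball continuous_on_product_coordinates)
    moreover have "cyl_meas p X \<mu> \<in> V" using r by (simp add: V_def)
    ultimately obtain d where d: "d > 0" "ball (cyl_meas p X \<mu>) d \<subseteq> V" using open_contains_ball by blast
    have "\<exists>\<^sub>F n in sequentially. dist (c n) (cyl_meas p X \<mu>) < d" using \<mu> d(1) by (intro dense) auto
    then obtain j where j: "j \<ge> max N N1" "dist (c j) (cyl_meas p X \<mu>) < d"
      unfolding frequently_sequentially by blast
    then have cj: "c j \<in> V" using d(2) by (auto simp: dist_commute)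
    obtain i where i: "i \<ge> j" "s i = j" using s_surj[of j] by blast
    \<comment> \<open>The time at which source block \<open>i\<close> starts, so that
      \<open>idx n = i\<close> holds exactly.\<close>
    define n where "n = (\<Sum>i'<i. l (s i'))"
    have Li: "L i = real n" by (simp add: L_def n_def)
    have idx: "idx n = i" using l_pos[of "s i"] by (intro idx_eq) (auto simp: L_Suc Li)
    have ni: "n \<ge> i" using L_ge[of i] unfolding Li by simp
    have "\<bar>frequency ?x n w - cyl_meas p X \<mu> w\<bar> < r" if w: "w \<in> F" for w
    proof -
      have "\<bar>frequency ?x n w - c j w\<bar> \<le> r / 3" using N1[of n w] ni i j(1) w by (simp add: idx)
      moreover have "\<bar>cyl_meas p X \<mu> w - c j w\<bar> < r / 2" using cj w by (auto simp: V_def dist_real_def)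
      ultimately show ?thesis using r by linarith
    qed
    then show "\<exists>n\<ge>N. \<forall>w\<in>F. \<bar>frequency ?x n w - cyl_meas p X \<mu> w\<bar> < r"
      using ni i(1) j(1) by (intro exI[of _ n]) auto
  qed
  have "seq_limit_points (weak_star X) (\<lambda>n. empirical_measure X n ?x) = K"
  proof (intro set_eqI)
    fix \<mu>
    show "\<mu> \<in> seq_limit_points (weak_star X) (\<lambda>n. empirical_measure X n ?x) \<longleftrightarrow> \<mu> \<in> K"
      unfolding limit_points_empirical[OF X(1) X' X(3) x] using sub1[of \<mu>] sub2[of \<mu>] K by blast
  qed
  then show ?thesis using x by (simp add: saturated_set_def)
qed

lemma pressure_lower:
  fixes \<phi> :: "(nat \<Rightarrow> nat) \<Rightarrow> real"
  assumes X: "shift_space p X" and \<phi>: "continuous_on X \<phi>"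
    and G: "G \<subseteq> language p X" "W_specification (language p X) G" "edit_approachable p (language p X) G"
    and K: "K \<subseteq> invariant_measures X" "K \<noteq> {}" "compactin (weak_star X) K" "connectedin (weak_star X) K"
    and J: "\<And>\<mu>. \<mu> \<in> K \<Longrightarrow> ereal J \<le> ks_entropy \<mu> shift_map + ereal (\<integral>x. \<phi> x \<partial>\<mu>)" and t: "t < J"
  shows "1 \<le> pressure_limit p X (saturated_set X K) t \<phi>"
proof -
  have X1: "X \<subseteq> full_shift p" and X2: "shift_map ` X \<subseteq> X" and X3: "compact X"
    using X by (auto simp: shift_space_def)
  have K': "K \<subseteq> borel_probs X" using K(1) by (auto simp: invariant_measures_def)
  obtain \<tau> where spec: "\<And>v w. v \<in> G \<Longrightarrow> w \<in> G \<Longrightarrow> \<exists>u\<in>language p X. length u \<le> \<tau> \<and> v @ u @ w \<in> G"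
    using G(2) unfolding W_specification_def by blast
  obtain g where g: "(\<lambda>n. real (g n) / real n) \<longlonglongrightarrow> 0"
    and appr: "\<And>w. w \<in> language p X \<Longrightarrow> \<exists>v\<in>G. edit_dist p v w \<le> g (length w)"
    using G(3) unfolding edit_approachable_def mistake_function_def by blast
  let ?\<Phi> = "cyl_meas p X"
  have comp: "compact (?\<Phi> ` K)"
    using image_compactin[OF K(3) continuous_map_cyl_meas[OF X1]] by simp
  have conn: "connected (?\<Phi> ` K)"
    using connectedin_continuous_map_image[OF continuous_map_cyl_meas[OF X1] K(4)] by simp
  obtain c where c: "range c \<subseteq> ?\<Phi> ` K" "(\<lambda>n. dist (c n) (c (Suc n))) \<longlonglongrightarrow> 0"
    and dense: "\<And>y r. y \<in> ?\<Phi> ` K \<Longrightarrow> r > 0 \<Longrightarrow> \<exists>\<^sub>F n in sequentially. dist (c n) y < r"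
    by (rule slow_dense_sequence[OF comp conn]) (use K(2) in blast)+
  have cK: "c n \<in> ?\<Phi> ` K" for n using c(1) by blast
  then have "\<forall>n. \<exists>\<mu>. \<mu> \<in> K \<and> c n = ?\<Phi> \<mu>" by blast
  from choice[OF this] obtain \<mu> where \<mu>: "\<And>n. \<mu> n \<in> K" "\<And>n. c n = ?\<Phi> (\<mu> n)" by blast
  have \<mu>inv: "\<mu> n \<in> invariant_measures X" for n using \<mu>(1) K(1) by blast
  have "\<forall>n. \<exists>h. ks_entropy (\<mu> n) shift_map = ereal h"
  proof
    fix n
    show "\<exists>h. ks_entropy (\<mu> n) shift_map = ereal h" by (rule ks_entropy_shift[OF X1 X2 \<mu>inv[of n]]) blast
  qed
  from choice[OF this] obtain h where h: "\<And>n. ks_entropy (\<mu> n) shift_map = ereal (h n)" by blast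
  \<comment> \<open>The accuracy of stage \<open>n\<close>. The same stage controls all words of
    length at most \<open>n\<close>, so every fixed word is controlled from some stage on.\<close>
  define e where "e n = 1 / (real n + 2)" for n :: nat
  have e: "0 < e n" "e n \<le> 1 / 2" for n by (auto simp: e_def field_simps)
  have e_lim: "e \<longlonglongrightarrow> 0" unfolding e_def by real_asymp
  have finF: "finite {u \<in> words p. length u \<le> n}" for n
  proof -
    have "{u \<in> words p. length u \<le> n} = (\<Union>m\<le>n. block p m)" by (auto simp: block_def)
    then show ?thesis by (simp only: finite_UN_I finite_atMost finite_block)
  qed
  have "\<forall>n. \<exists>z. fst z > 0 \<and> snd z \<subseteq> block p (fst z) \<and> real \<tau> \<le> e n * real (fst z) \<and> 1 \<le> e n * real (fst z) \<and>
    exp (real (fst z) * (h n - e n)) \<le> real (card (snd z)) \<and>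
    (\<forall>W\<in>snd z. (\<exists>v\<in>G. v \<in> edit_ball p (e n * real (fst z)) W) \<and>
      (\<forall>u\<in>{u \<in> words p. length u \<le> n}. \<bar>real (occ u W) - real (fst z) * ?\<Phi> (\<mu> n) u\<bar> \<le> e n * real (fst z)))"
    (is "\<forall>n. \<exists>z. ?P n (fst z) (snd z)")
  proof
    fix n
    have "\<exists>l D. ?P n l D"
      by (rule horseshoe[OF X1 X2 G(1) spec appr g \<mu>inv[of n] h[of n] e(1) finF])
    then obtain l D where P: "?P n l D" by blast
    show "\<exists>z. ?P n (fst z) (snd z)"
    proof (rule exI[of _ "(l, D)"])
      show "?P n (fst (l, D)) (snd (l, D))" unfolding fst_conv snd_conv by (rule P)
    qed
  qed
  from choice[OF this] obtain z where z: "\<And>n. ?P n (fst (z n)) (snd (z n))" by blast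
  define l where "l n = fst (z n)" for n
  define D where "D n = snd (z n)" for n
  have lD: "?P n (l n) (D n)" for n unfolding l_def D_def by (rule z)
  have l_pos: "l n > 0" for n using lD[of n] by blast
  have card_D: "exp (real (l n) * (h n - e n)) \<le> real (card (D n))" for n using lD[of n] by blast
  have D_ne: "D n \<noteq> {}" for n
  proof
    assume "D n = {}"
    then show False using card_D[of n] exp_gt_zero[of "real (l n) * (h n - e n)"] by simp
  qed
  obtain s where s: "filterlim s at_top sequentially" "\<And>n. \<exists>i\<ge>n. s i = n"
    "(\<lambda>I. real (l (s I)) / (\<Sum>i<I. real (l (s i)))) \<longlonglongrightarrow> 0"
    "\<And>(a :: nat \<Rightarrow> real) B. (\<And>n. \<bar>a n\<bar> \<le> B) \<Longrightarrow> (\<lambda>n. a n - a (Suc n)) \<longlonglongrightarrow> 0 \<Longrightarrow>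
      (\<lambda>I. (\<Sum>i<I. real (l (s i)) * a (s i)) / (\<Sum>i<I. real (l (s i))) - a (s I)) \<longlonglongrightarrow> 0"
    by (rule schedule[of l, OF l_pos]) blast
  interpret moran p X G \<tau> l D c e s
  proof
    show "closed X" by (rule compact_imp_closed_seq[OF X3])
    show "\<exists>u\<in>language p X. length u \<le> \<tau> \<and> v @ u @ w \<in> G" if "v \<in> G" "w \<in> G" for v w using spec[OF that] .
    show "(\<lambda>n. c n u - c (Suc n) u) \<longlonglongrightarrow> 0" for u by (rule dist_fun_tendsto_coordinate[OF c(2)])
    show "0 \<le> c n u" "c n u \<le> 1" for n u
      using cyl_meas_nonneg[of p X "\<mu> n" u] cyl_meas_le_1[of "\<mu> n" X p u] \<mu> K' by auto
    show "\<bar>real (occ u W) - real (l n) * c n u\<bar> \<le> e n * real (l n)" if "W \<in> D n" "u \<in> words p" "length u \<le> n" for n W u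
      using lD[of n] that unfolding \<mu>(2) by blast
    show "(\<lambda>I. (\<Sum>i<I. real (l (s i)) * a (s i)) / (\<Sum>i<I. real (l (s i))) - a (s I)) \<longlonglongrightarrow> 0"
      if "\<And>n. \<bar>a n\<bar> \<le> B" "(\<lambda>n. a n - a (Suc n)) \<longlonglongrightarrow> 0" for a :: "nat \<Rightarrow> real" and B
      by (rule s(4)[OF that])
    show "D n \<subseteq> block p (l n)" "real \<tau> \<le> e n * real (l n)" "1 \<le> e n * real (l n)" for n using lD[of n] by blast+
    show "\<exists>v\<in>G. v \<in> edit_ball p (e n * real (l n)) W" if "W \<in> D n" for n W using lD[of n] that by blast
  qed (use X1 X2 G(1) l_pos D_ne e e_lim s(1-3) in auto)
  \<comment> \<open>Five errors of size \<open>\<delta> * n\<close> occur: the edits in the entropy,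
    the integrals, the unfinished block, the Birkhoff sum and the visits. One more
    \<open>\<delta> * n\<close> is the margin for edit balls.\<close>
  define \<delta> where "\<delta> = (J - t) / 8"
  have \<delta>: "\<delta> > 0" using t by (simp add: \<delta>_def)
  obtain k b where b: "\<And>x. x \<in> X \<Longrightarrow> \<bar>\<phi> x - b (pre x k)\<bar> \<le> \<delta>"
    using locally_constant_approx[OF X3 \<phi> \<delta>] by blast
  define B where "B = (\<Sum>u\<in>block p k. \<bar>b u\<bar>)"
  have B: "B \<ge> 0" by (simp add: B_def sum_nonneg)
  define \<eta> where "\<eta> = \<delta> / (B + 1)"
  have \<eta>: "\<eta> > 0" "B * \<eta> \<le> \<delta>" using \<delta> B by (auto simp: \<eta>_def field_simps)
  define I\<phi> where "I\<phi> n = (\<integral>x. \<phi> x \<partial>\<mu> n)" for n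
  have ev_v: "\<forall>\<^sub>F n in sequentially. \<forall>u\<in>block p k. \<forall>\<omega>\<in>choices.
    \<bar>real (visits u (pt \<omega>) n) - (\<Sum>i<idx n. real (l (s i)) * c (s i) u)\<bar> \<le> \<eta> * real n"
    unfolding eventually_ball_finite_distrib[OF finite_block]
    using visits_track[OF _ \<eta>(1)] by (auto simp: block_def)
  have ev_E: "\<forall>\<^sub>F n in sequentially. E (idx n) \<le> \<delta> * real n" by (rule ev_small[OF E_small \<delta>])
  have "(\<lambda>I. \<bar>J\<bar> * (real (l (s I)) / L I)) \<longlonglongrightarrow> \<bar>J\<bar> * 0"
    using s(3) by (intro tendsto_mult tendsto_const) (simp add: L_def)
  then have "(\<lambda>I. (\<bar>J\<bar> * real (l (s I))) / L I) \<longlonglongrightarrow> 0" by simp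
  then have ev_l: "\<forall>\<^sub>F n in sequentially. \<bar>J\<bar> * real (l (s (idx n))) \<le> \<delta> * real n"
    using \<delta> by (rule ev_small[where r = "\<lambda>I. \<bar>J\<bar> * real (l (s I))"])
  have key: "\<forall>\<^sub>F n in sequentially. \<forall>\<omega>\<in>choices. \<delta> * real n - (\<Sum>i<idx n. ln (real (card (D (s i))))) \<le>
      - t * real n + (\<Sum>k<n. \<phi> ((shift_map ^^ k) (pt \<omega>)))"
    using ev_v ev_E ev_l
  proof eventually_elim
    case (elim n)
    define I where "I = idx n"
    define V where "V u = (\<Sum>i<I. real (l (s i)) * c (s i) u)" for u
    have LI: "L I \<le> real n" "real n \<le> L I + real (l (s I))"
      using idx_le[of n] idx_less[of n] by (auto simp: I_def L_Suc)
    have ent: "(\<Sum>i<I. real (l (s i)) * h (s i)) - E I \<le> (\<Sum>i<I. ln (real (card (D (s i)))))"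
    proof -
      have "(\<Sum>i<I. real (l (s i)) * (h (s i) - e (s i))) \<le> (\<Sum>i<I. ln (real (card (D (s i)))))"
      proof (intro sum_mono)
        fix i
        have "0 < real (card (D (s i)))" using card_D_pos[of "s i"] by simp
        then show "real (l (s i)) * (h (s i) - e (s i)) \<le> ln (real (card (D (s i))))"
          using card_D[of "s i"] by (simp add: ln_ge_iff)
      qed
      moreover have "(\<Sum>i<I. real (l (s i)) * (h (s i) - e (s i))) = (\<Sum>i<I. real (l (s i)) * h (s i)) - E I / 2"
        by (simp add: E_def right_diff_distrib sum_subtractf)
      ultimately show ?thesis using E_nonneg[of I] by linarith
    qed
    have bV: "(\<Sum>i<I. real (l (s i)) * I\<phi> (s i)) - \<delta> * L I \<le> (\<Sum>u\<in>block p k. b u * V u)"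
    proof -
      have "(\<Sum>u\<in>block p k. b u * V u) = (\<Sum>u\<in>block p k. \<Sum>i<I. real (l (s i)) * (b u * c (s i) u))"
        by (simp add: V_def sum_distrib_left mult.left_commute)
      also have "\<dots> = (\<Sum>i<I. \<Sum>u\<in>block p k. real (l (s i)) * (b u * c (s i) u))" by (rule sum.swap)
      also have "\<dots> = (\<Sum>i<I. real (l (s i)) * (\<Sum>u\<in>block p k. b u * c (s i) u))" by (simp add: sum_distrib_left)
      also have "\<dots> \<ge> (\<Sum>i<I. real (l (s i)) * (I\<phi> (s i) - \<delta>))"
      proof (intro sum_mono mult_left_mono)
        fix i
        have m: "\<mu> (s i) \<in> borel_probs X" using \<mu>(1) K' by blast
        have "\<bar>I\<phi> (s i) - (\<Sum>u\<in>block p k. b u * c (s i) u)\<bar> \<le> \<delta>"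
          unfolding I\<phi>_def \<mu>(2) by (rule integral_approx[OF X1 X3 \<phi> m]) (rule b)
        then show "I\<phi> (s i) - \<delta> \<le> (\<Sum>u\<in>block p k. b u * c (s i) u)" by linarith
      qed simp
      finally show ?thesis by (simp add: L_def right_diff_distrib sum_subtractf sum_distrib_left mult.commute)
    qed
    have tot: "J * L I \<le> (\<Sum>i<I. real (l (s i)) * h (s i)) + (\<Sum>i<I. real (l (s i)) * I\<phi> (s i))"
    proof -
      have "J * L I = (\<Sum>i<I. real (l (s i)) * J)" by (simp add: L_def sum_distrib_left mult.commute)
      also have "\<dots> \<le> (\<Sum>i<I. real (l (s i)) * (h (s i) + I\<phi> (s i)))"
        using J[OF \<mu>(1)] h by (intro sum_mono mult_left_mono) (auto simp: I\<phi>_def)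
      finally show ?thesis by (simp add: distrib_left sum.distrib)
    qed
    \<comment> \<open>\<open>L I\<close> falls short of \<open>n\<close> by less than one block, and
      \<open>J\<close> may have either sign, hence the absolute value in
      \<open>ev_l\<close>.\<close>
    have JL: "J * real n - \<delta> * real n \<le> J * L I"
    proof -
      have "J * (real n - L I) \<le> \<bar>J\<bar> * (real n - L I)" using LI by (intro mult_right_mono) auto
      also have "\<dots> \<le> \<bar>J\<bar> * real (l (s I))" using LI by (intro mult_left_mono) auto
      also have "\<dots> \<le> \<delta> * real n" using elim(3) by (simp add: I_def)
      finally show ?thesis by (simp add: right_diff_distrib)
    qed
    have dL: "\<delta> * L I \<le> \<delta> * real n" using LI \<delta> by (intro mult_left_mono) auto
    have EI: "E I \<le> \<delta> * real n" using elim(2) by (simp add: I_def)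
    have J8: "J * real n = t * real n + 8 * (\<delta> * real n)" by (simp add: \<delta>_def field_simps)
    show ?case
    proof
      fix \<omega> assume \<omega>: "\<omega> \<in> choices"
      let ?S = "\<Sum>k<n. \<phi> ((shift_map ^^ k) (pt \<omega>))"
      have 1: "(\<Sum>u\<in>block p k. b u * real (visits u (pt \<omega>) n)) - real n * \<delta> \<le> ?S"
        using birkhoff_approx[where \<phi> = \<phi> and b = b and k = k and \<delta> = \<delta> and n = n, OF X1 X2 pt_X[OF \<omega>] b]
        by linarith
      have "(\<Sum>u\<in>block p k. b u * V u) - (\<Sum>u\<in>block p k. b u * real (visits u (pt \<omega>) n)) =
        (\<Sum>u\<in>block p k. b u * (V u - real (visits u (pt \<omega>) n)))"
        by (simp add: right_diff_distrib sum_subtractf)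
      also have "\<dots> \<le> (\<Sum>u\<in>block p k. \<bar>b u\<bar> * (\<eta> * real n))"
      proof (intro sum_mono)
        fix u assume "u \<in> block p k"
        then have "\<bar>real (visits u (pt \<omega>) n) - V u\<bar> \<le> \<eta> * real n" using elim(1) \<omega> by (simp add: V_def I_def)
        then have "\<bar>b u\<bar> * \<bar>V u - real (visits u (pt \<omega>) n)\<bar> \<le> \<bar>b u\<bar> * (\<eta> * real n)"
          by (intro mult_left_mono) (auto simp: abs_minus_commute)
        then show "b u * (V u - real (visits u (pt \<omega>) n)) \<le> \<bar>b u\<bar> * (\<eta> * real n)"
          unfolding abs_mult[symmetric] by linarith
      qed
      also have "\<dots> = (B * \<eta>) * real n" by (simp add: B_def sum_distrib_right mult.assoc)
      also have "\<dots> \<le> \<delta> * real n" using \<eta>(2) by (intro mult_right_mono) auto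
      finally have 2: "(\<Sum>u\<in>block p k. b u * V u) - (\<Sum>u\<in>block p k. b u * real (visits u (pt \<omega>) n)) \<le> \<delta> * real n" .
      have nn: "0 \<le> \<delta> * real n" using \<delta> by simp
      show "\<delta> * real n - (\<Sum>i<idx n. ln (real (card (D (s i))))) \<le> - t * real n + ?S"
      proof -
        have "- t * real n = - (t * real n)" "real n * \<delta> = \<delta> * real n" by simp_all
        then show ?thesis using 1 2 ent bV tot JL dL EI J8 nn unfolding I_def by argo
      qed
    qed
  qed
  show ?thesis
  proof (rule pressure_limit_ge[OF X3 \<phi> _ \<delta> key])
    fix \<omega> assume "\<omega> \<in> choices"
    then show "pt \<omega> \<in> saturated_set X K" by (intro pt_saturated[OF X3 K' comp cK dense])
  qed
qed

theorem theorem1p2: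
  fixes p :: nat
    and X :: "(nat \<Rightarrow> nat) set"
    and \<phi> :: "(nat \<Rightarrow> nat) \<Rightarrow> real"
    and G :: "nat list set"
    and K :: "(nat \<Rightarrow> nat) measure set"
  assumes "p \<ge> 2"
    and "shift_space p X"
    and "continuous_on X \<phi>"
    and "G \<subseteq> language p X"
    and "W_specification (language p X) G"
    and "edit_approachable p (language p X) G"
    and "K \<subseteq> invariant_measures X"
    and "K \<noteq> {}"
    and "compactin (weak_star X) K"
    and "connectedin (weak_star X) K"
  shows "pressure p X (saturated_set X K) \<phi> =
           (INF \<mu>\<in>K. ks_entropy \<mu> shift_map + ereal (\<integral>x. \<phi> x \<partial>\<mu>))"
proof (rule antisym)
  have X: "X \<subseteq> full_shift p" "compact X" "shift_map ` X \<subseteq> X"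
    using assms(2) by (auto simp: shift_space_def)
  show "pressure p X (saturated_set X K) \<phi> \<le> (INF \<mu>\<in>K. ks_entropy \<mu> shift_map + ereal (\<integral>x. \<phi> x \<partial>\<mu>))"
  proof (rule INF_greatest)
    fix \<mu> assume \<mu>: "\<mu> \<in> K"
    show "pressure p X (saturated_set X K) \<phi> \<le> ks_entropy \<mu> shift_map + ereal (\<integral>x. \<phi> x \<partial>\<mu>)"
    proof (rule pressure_upper[OF assms(1-3)])
      show "\<mu> \<in> invariant_measures X" using \<mu> assms(7) by blast
      show "saturated_set X K \<subseteq> X" by (auto simp: saturated_set_def)
      fix x F and \<epsilon> :: real
      assume x: "x \<in> saturated_set X K" and F: "finite F" "F \<subseteq> words p" "\<epsilon> > 0"
      have xX: "x \<in> X" using x by (simp add: saturated_set_def)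
      have "\<mu> \<in> seq_limit_points (weak_star X) (\<lambda>n. empirical_measure X n x)"
        using x \<mu> by (simp add: saturated_set_def)
      then show "\<exists>\<^sub>F n in sequentially. \<forall>w\<in>F. \<bar>frequency x n w - cyl_meas p X \<mu> w\<bar> < \<epsilon>"
        unfolding limit_points_empirical[OF X xX] using F by blast
    qed
  qed
  show "(INF \<mu>\<in>K. ks_entropy \<mu> shift_map + ereal (\<integral>x. \<phi> x \<partial>\<mu>)) \<le> pressure p X (saturated_set X K) \<phi>"
    unfolding pressure_def
  proof (rule INF_greatest)
    fix t assume t: "t \<in> {t. pressure_limit p X (saturated_set X K) t \<phi> = 0}"
    show "(INF \<mu>\<in>K. ks_entropy \<mu> shift_map + ereal (\<integral>x. \<phi> x \<partial>\<mu>)) \<le> ereal t"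
    proof (rule ccontr)
      assume "\<not> ?thesis"
      then have "ereal t < (INF \<mu>\<in>K. ks_entropy \<mu> shift_map + ereal (\<integral>x. \<phi> x \<partial>\<mu>))" by simp
      \<comment> \<open>\<open>pressure_lower\<close> distributes the gap \<open>J - t\<close> among
        its errors.\<close>
      then obtain J where J: "ereal t < ereal J" "ereal J < (INF \<mu>\<in>K. ks_entropy \<mu> shift_map + ereal (\<integral>x. \<phi> x \<partial>\<mu>))"
        using ereal_dense2 by blast
      have "1 \<le> pressure_limit p X (saturated_set X K) t \<phi>"
      proof (rule pressure_lower[OF assms(2-10)])
        show "ereal J \<le> ks_entropy \<mu> shift_map + ereal (\<integral>x. \<phi> x \<partial>\<mu>)" if "\<mu> \<in> K" for \<mu>
          by (rule order_trans[OF less_imp_le[OF J(2)] INF_lower[OF that]])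
        show "t < J" using J(1) by simp
      qed
      then show False using t by simp
    qed
  qed
qed

end
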